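(* If the compact, connected metric graph $\mathcal{G}$ has girth $s$ and total length $L$, then the second eigenvalue (spectral gap) of the Laplacian on $\mathcal{G}$ with standard conditions at all vertices satisfies $$\lambda_2^{\mathrm{N}}(\mathcal{G}) < \frac{48L}{s^3},$$ where the right-hand side is read as $+\infty$ if $s=0$.
   Context: A compact metric graph $\mathcal{G}=(\mathsf{V},\mathsf{E})$ has finitely many edges, each edge $\mathsf{e}$ being identified with an interval $(0,\ell_{\mathsf{e}})$ of finite length $\ell_{\mathsf{e}}>0$; loops and multiple edges are allowed. The total length $L$ is the sum of all edge lengths. The Laplacian with standard vertex conditions acts as $-\frac{d^2}{dx^2}$ on functions that are in $H^2(0,\ell_{\mathsf{e}})$ on each edge, are continuous at every vertex, and whose normal derivatives sum to zero at every vertex. It is self-adjoint with discrete spectrum; on a connected graph its eigenvalues, counted with multiplicity, are $0=\lambda_1^{\mathrm{N}}<\lambda_2^{\mathrm{N}}\leq\dots$. A cycle is (the image of) a continuous map $\gamma:[0,1]\to\mathcal{G}$ with $\gamma(0)=\gamma(1)$ and $\gamma$ injective on $[0,1)$. The girth $s$ of $\mathcal{G}$ (no Dirichlet vertices present) is the minimal total length of a cycle in $\mathcal{G}$, and is defined to be $0$ if $\mathcal{G}$ is a tree. *)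

theory Defs
  imports "HOL-Analysis.Analysis"
begin

section \<open>Compact metric graphs\<close>

text \<open>The two endpoint maps fix an arbitrary orientation, which identifies the edge e with the
  interval (0, len e). Loops and multiple edges are allowed.\<close>

record ('v, 'e) metric_graph =
  verts :: "'v set"
  edges :: "'e set"
  init_vert :: "'e \<Rightarrow> 'v"
  term_vert :: "'e \<Rightarrow> 'v"
  len :: "'e \<Rightarrow> real"

definition compact_metric_graph :: "('v, 'e) metric_graph \<Rightarrow> bool" where
  "compact_metric_graph G \<longleftrightarrow>
     finite (verts G) \<and> finite (edges G) \<and>
     (\<forall>e\<in>edges G. init_vert G e \<in> verts G \<and> term_vert G e \<in> verts G \<and> 0 < len G e)"

definition total_length :: "('v, 'e) metric_graph \<Rightarrow> real" where
  "total_length G = (\<Sum>e\<in>edges G. len G e)"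

subsection \<open>The underlying topological space\<close>

datatype ('v, 'e) graph_point = Vertex 'v | Inner 'e real

definition graph_points :: "('v, 'e) metric_graph \<Rightarrow> ('v, 'e) graph_point set" where
  "graph_points G = Vertex ` verts G \<union> {Inner e x | e x. e \<in> edges G \<and> 0 < x \<and> x < len G e}"

definition edge_map :: "('v, 'e) metric_graph \<Rightarrow> 'e \<Rightarrow> real \<Rightarrow> ('v, 'e) graph_point" where
  "edge_map G e x =
     (if x \<le> 0 then Vertex (init_vert G e)
      else if x \<ge> len G e then Vertex (term_vert G e)
      else Inner e x)"

text \<open>The quotient topology obtained by gluing the closed intervals [0, len e] at the vertices;
  since the graph is finite, it coincides with the topology of the path metric.\<close>

definition graph_topology :: "('v, 'e) metric_graph \<Rightarrow> ('v, 'e) graph_point topology" where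
  "graph_topology G = topology (\<lambda>U. U \<subseteq> graph_points G \<and>
     (\<forall>e\<in>edges G. openin (top_of_set {0..len G e}) {x \<in> {0..len G e}. edge_map G e x \<in> U}))"

lemma openin_graph_topology:
  "openin (graph_topology G) U \<longleftrightarrow> U \<subseteq> graph_points G \<and>
     (\<forall>e\<in>edges G. openin (top_of_set {0..len G e}) {x \<in> {0..len G e}. edge_map G e x \<in> U})"
proof -
  have "istopology (\<lambda>U. U \<subseteq> graph_points G \<and>
     (\<forall>e\<in>edges G. openin (top_of_set {0..len G e}) {x \<in> {0..len G e}. edge_map G e x \<in> U}))"
    (is "istopology ?P")
    unfolding istopology_def
  proof (intro conjI allI impI)
    fix S T assume "?P S" "?P T"
    moreover have "{x \<in> {0..len G e}. edge_map G e x \<in> S \<inter> T} =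
        {x \<in> {0..len G e}. edge_map G e x \<in> S} \<inter> {x \<in> {0..len G e}. edge_map G e x \<in> T}" for e
      by auto
    ultimately show "S \<inter> T \<subseteq> graph_points G"
      and "\<forall>e\<in>edges G. openin (top_of_set {0..len G e}) {x \<in> {0..len G e}. edge_map G e x \<in> S \<inter> T}"
      by (auto simp del: Int_iff)
  next
    fix K assume K: "\<forall>S\<in>K. ?P S"
    show "\<Union>K \<subseteq> graph_points G" using K by blast
    have "{x \<in> {0..len G e}. edge_map G e x \<in> \<Union>K} =
        (\<Union>S\<in>K. {x \<in> {0..len G e}. edge_map G e x \<in> S})" for e
      by auto
    then show "\<forall>e\<in>edges G. openin (top_of_set {0..len G e}) {x \<in> {0..len G e}. edge_map G e x \<in> \<Union>K}"
      using K by (auto simp del: Union_iff UN_iff intro!: openin_Union)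
  qed
  then show ?thesis
    by (simp add: graph_topology_def topology_inverse')
qed

lemma topspace_graph_topology:
  assumes "compact_metric_graph G"
  shows "topspace (graph_topology G) = graph_points G"
proof -
  have "{x \<in> {0..len G e}. edge_map G e x \<in> graph_points G} = {0..len G e}" if "e \<in> edges G" for e
    using assms that by (auto simp: compact_metric_graph_def edge_map_def graph_points_def)
  then have "openin (graph_topology G) (graph_points G)"
    by (simp add: openin_graph_topology)
  then show ?thesis
    by (metis openin_graph_topology openin_subset openin_topspace subset_antisym)
qed

subsection \<open>Cycles and girth\<close>

definition cycles :: "('v, 'e) metric_graph \<Rightarrow> ('v, 'e) graph_point set set" where
  "cycles G = {\<gamma> ` {0..1} | \<gamma>.
     continuous_map (top_of_set {0..1::real}) (graph_topology G) \<gamma> \<and>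
     \<gamma> 0 = \<gamma> 1 \<and> inj_on \<gamma> {0..<1}}"

definition subset_length :: "('v, 'e) metric_graph \<Rightarrow> ('v, 'e) graph_point set \<Rightarrow> real" where
  "subset_length G C = (\<Sum>e\<in>edges G. measure lborel {x. 0 < x \<and> x < len G e \<and> Inner e x \<in> C})"

text \<open>A connected graph is a tree iff it has no cycles.\<close>

definition girth :: "('v, 'e) metric_graph \<Rightarrow> real" where
  "girth G = (if cycles G = {} then 0 else Inf (subset_length G ` cycles G))"

section \<open>The Laplacian with standard vertex conditions\<close>

definition square_integrable :: "real \<Rightarrow> (real \<Rightarrow> real) \<Rightarrow> bool" where
  "square_integrable l f \<longleftrightarrow>
     set_borel_measurable lborel {0<..<l} f \<and> set_integrable lborel {0<..<l} (\<lambda>x. (f x)\<^sup>2)"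

text \<open>Continuously differentiable functions with compact support in (0, l). Using these rather
  than smooth test functions yields the same weak derivatives.\<close>

definition test_functions :: "real \<Rightarrow> (real \<Rightarrow> real) set" where
  "test_functions l = {\<phi>. (\<forall>x. \<phi> differentiable at x) \<and> continuous_on UNIV (deriv \<phi>) \<and>
     (\<exists>a b. 0 < a \<and> b < l \<and> (\<forall>x. x \<notin> {a..b} \<longrightarrow> \<phi> x = 0))}"

text \<open>f is in \<open>H\<^sup>1(0,l)\<close> with weak derivative g.\<close>

definition has_weak_deriv :: "real \<Rightarrow> (real \<Rightarrow> real) \<Rightarrow> (real \<Rightarrow> real) \<Rightarrow> bool" where
  "has_weak_deriv l f g \<longleftrightarrow> square_integrable l f \<and> square_integrable l g \<and>
     (\<forall>\<phi>\<in>test_functions l.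
        (LINT x:{0<..<l}|lborel. f x * deriv \<phi> x) = - (LINT x:{0<..<l}|lborel. g x * \<phi> x))"

definition has_weak_deriv2 :: "real \<Rightarrow> (real \<Rightarrow> real) \<Rightarrow> (real \<Rightarrow> real) \<Rightarrow> bool" where
  "has_weak_deriv2 l f h \<longleftrightarrow> (\<exists>g. has_weak_deriv l f g \<and> has_weak_deriv l g h)"

definition H2 :: "real \<Rightarrow> (real \<Rightarrow> real) set" where
  "H2 l = {f. \<exists>h. has_weak_deriv2 l f h}"

text \<open>A function on the graph is given by its restrictions u e to the edges. An element of
  \<open>H\<^sup>2(0,l)\<close> has a unique representative that is continuous on [0,l], and this representative is
  continuously differentiable up to the endpoints; endpoint values and derivatives refer to it.
  The derivatives in the last condition point from the vertex into the edge, and a loop at v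
  contributes to both sums.\<close>

definition laplacian_domain :: "('v, 'e) metric_graph \<Rightarrow> ('e \<Rightarrow> real \<Rightarrow> real) set" where
  "laplacian_domain G = {u.
     (\<forall>e\<in>edges G. u e \<in> H2 (len G e) \<and> continuous_on {0..len G e} (u e)) \<and>
     (\<exists>c. \<forall>e\<in>edges G. u e 0 = c (init_vert G e) \<and> u e (len G e) = c (term_vert G e)) \<and>
     (\<forall>v\<in>verts G.
        (\<Sum>e\<in>{e\<in>edges G. init_vert G e = v}.
            vector_derivative (u e) (at 0 within {0..len G e})) +
        (\<Sum>e\<in>{e\<in>edges G. term_vert G e = v}.
            - vector_derivative (u e) (at (len G e) within {0..len G e})) = 0)}"

definition laplacian_eigenspace ::
    "('v, 'e) metric_graph \<Rightarrow> real \<Rightarrow> ('e \<Rightarrow> real \<Rightarrow> real) set" where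
  "laplacian_eigenspace G \<mu> = {u \<in> laplacian_domain G.
     \<forall>e\<in>edges G. has_weak_deriv2 (len G e) (u e) (\<lambda>x. - \<mu> * u e x)}"

definition lin_indep_on_graph ::
    "('v, 'e) metric_graph \<Rightarrow> nat \<Rightarrow> (nat \<Rightarrow> 'e \<Rightarrow> real \<Rightarrow> real) \<Rightarrow> bool" where
  "lin_indep_on_graph G k u \<longleftrightarrow>
     (\<forall>c :: nat \<Rightarrow> real. (\<forall>e\<in>edges G. \<forall>x\<in>{0..len G e}. (\<Sum>i<k. c i * u i e x) = 0)
        \<longrightarrow> (\<forall>i<k. c i = 0))"

text \<open>The k-th eigenvalue (k = 1, 2, ...) in increasing order, counted with multiplicity: the
  least t such that there are k linearly independent eigenfunctions with eigenvalues at most t.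
  As eigenspaces of distinct eigenvalues are linearly independent, the maximal number of such
  eigenfunctions is the sum of the multiplicities of the eigenvalues up to t.\<close>

definition laplacian_eigenvalue :: "('v, 'e) metric_graph \<Rightarrow> nat \<Rightarrow> real" where
  "laplacian_eigenvalue G k = Inf {t. \<exists>\<mu> u.
     (\<forall>i<k. \<mu> i \<le> t \<and> u i \<in> laplacian_eigenspace G (\<mu> i)) \<and> lin_indep_on_graph G k u}"

end

theory Submission
  imports Defs "HOL-Probability.Sinc_Integral"
begin

text \<open>
  Why the bound holds. If the girth \<open>s\<close> is positive, some edge \<open>e\<close> is not a bridge. Let \<open>l\<close> be its
  length and let \<open>P\<close> be a shortest walk that joins its ends in the graph without \<open>e\<close>, of length \<open>D\<close>.
  Then \<open>e\<close> and \<open>P\<close> form a cycle \<open>C\<close>, so \<open>s \<le> l + D\<close>. The distance \<open>d\<close> from the initial vertex of \<open>e\<close>,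
  measured in the graph without \<open>e\<close>, changes along each other edge by at most the length of that edge,
  and it is the arc length along \<open>P\<close>. Hence there is a function \<open>f\<close> with slopes at most 1 on the whole graph that is
  on \<open>C\<close> the tent rising with slope 1 from the midpoint of \<open>e\<close> to the antipodal point: off \<open>e\<close>, take
  \<open>(l + D) / 2 - \<bar>d - D / 2\<bar>\<close>. Its Dirichlet energy is at most the total length \<open>L\<close>. Already on \<open>C\<close>
  the integral of \<open>(f + t)\<^sup>2\<close> is at least \<open>(l + D)\<^sup>3 / 48 \<ge> s\<^sup>3 / 48\<close> for every constant \<open>t\<close>. So on the span
  of \<open>f\<close> and the constants the Rayleigh quotient is at most \<open>K\<^sup>2\<close>, where \<open>K\<^sup>2 = 48 L / s\<^sup>3\<close>. The strict
  inequality comes from the fact that \<open>f\<close> is piecewise linear and thus no solution of \<open>u'' = - K\<^sup>2 u\<close>.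

  How an eigenfunction arises from this. Instead of minimising over a Sobolev space, all edges are cut into
  pieces of length \<open>h < \<pi> / K\<close>. For \<open>0 < k \<le> K\<close> a solution of \<open>u'' = - k\<^sup>2 u\<close> on a piece is
  determined by its end values, and the integral of \<open>(u')\<^sup>2 - k\<^sup>2 u\<^sup>2\<close> over the piece is a quadratic form in
  them. The sum of these forms is a form \<open>Q\<^sub>k\<close> on functions on the finitely many nodes, and the kernel of
  \<open>Q\<^sub>k\<close> consists of the node values of the eigenfunctions for \<open>k\<^sup>2\<close>: lying in the kernel means that slopes
  balance at every node. At \<open>k = K\<close> the form is negative on all \<open>f + t\<close>. Therefore there is
  a least \<open>k\<close> at which some \<open>c \<noteq> 0\<close> orthogonal to the constants has \<open>Q\<^sub>k(c) \<le> 0\<close>; it satisfies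
  \<open>0 < k < K\<close>, and minimality forces \<open>c\<close> into the kernel (\<open>exists_singular_parameter\<close>,
  \<open>kernel_imp_eigenfunction\<close>). Together with the constants, this eigenfunction shows that the second
  eigenvalue is at most \<open>k\<^sup>2 < K\<^sup>2\<close> (\<open>second_eigenvalue_le\<close>).

  Three facts connect this to the definitions. An eigenvalue is an infimum of a set of reals, so one needs that
  eigenvalues are bounded below; they are nonnegative (\<open>eigenvalue_nonneg\<close>), once weak solutions are
  known to be classical (\<open>weak_deriv2_imp_classical\<close>). A topological cycle never crosses a bridge
  (\<open>cycle_avoids_bridges\<close>), which provides \<open>e\<close>. Conversely the combinatorial cycle \<open>C\<close> is the image of
  a closed injective curve (\<open>girth_le_tight_cycle\<close>), which gives \<open>s \<le> l + D\<close>.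
\<close>

section \<open>The least singular parameter of a quadratic pencil on a weighted graph\<close>

text \<open>A multigraph with edge set \<open>J\<close>, whose edge \<open>j\<close> joins \<open>p j\<close> to \<open>q j\<close>. The functions \<open>A j\<close> and \<open>B j\<close> of
  the parameter weigh the squared difference and the squared sum of the two end values in the form below;
  difference and sum diagonalise the energy of an interval, which is symmetric under
  reflection.\<close>

locale edge_pencil =
  fixes J :: "'j set" and p q :: "'j \<Rightarrow> 'i" and A B :: "'j \<Rightarrow> real \<Rightarrow> real" and K :: real
  assumes finite_J: "finite J" and J_nonempty: "J \<noteq> {}" and K_pos: "0 < K"
    and continuous_A: "\<And>j. j \<in> J \<Longrightarrow> continuous_on {0..K} (A j)"
    and continuous_B: "\<And>j. j \<in> J \<Longrightarrow> continuous_on {0..K} (B j)"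
    and A_pos: "\<And>j. j \<in> J \<Longrightarrow> 0 < A j 0"
    and B_pos: "\<And>j k. \<lbrakk>j \<in> J; 0 \<le> k; k \<le> K\<rbrakk> \<Longrightarrow> 0 < B j k"
    and connected: "\<And>c :: 'i \<Rightarrow> real. \<forall>j\<in>J. c (p j) = c (q j) \<Longrightarrow>
      \<exists>t. \<forall>i\<in>p ` J \<union> q ` J. c i = t"
begin

definition nodes :: "'i set" where "nodes = p ` J \<union> q ` J"

definition form :: "real \<Rightarrow> ('i \<Rightarrow> real) \<Rightarrow> ('i \<Rightarrow> real) \<Rightarrow> real" where
  "form k c d = (\<Sum>j\<in>J. A j k * ((c (p j) - c (q j)) * (d (p j) - d (q j)))
      - k\<^sup>2 * (B j k * ((c (p j) + c (q j)) * (d (p j) + d (q j)))))"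

text \<open>The condition \<open>mass k c = 0\<close> is orthogonality of \<open>c\<close> to the constants with respect to the form, with the
  factor \<open>k\<^sup>2\<close> divided out, so that it still excludes the nonzero constants at \<open>k = 0\<close>.\<close>

definition mass :: "real \<Rightarrow> ('i \<Rightarrow> real) \<Rightarrow> real" where
  "mass k c = (\<Sum>j\<in>J. B j k * (c (p j) + c (q j)))"

lemma finite_nodes: "finite nodes"
  by (simp add: nodes_def finite_J)

lemma nodes_p: "j \<in> J \<Longrightarrow> p j \<in> nodes" and nodes_q: "j \<in> J \<Longrightarrow> q j \<in> nodes"
  by (auto simp: nodes_def)

lemma form_add_scaled:
  "form k (\<lambda>i. c i + t * d i) (\<lambda>i. c i + t * d i) = form k c c + 2 * t * form k c d + t\<^sup>2 * form k d d"
  unfolding form_def sum_distrib_left sum.distrib[symmetric]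
  by (rule sum.cong) (simp_all add: algebra_simps power2_eq_square)

lemma form_add_right: "form k c (\<lambda>i. d i + t * d' i) = form k c d + t * form k c d'"
  unfolding form_def sum_distrib_left sum.distrib[symmetric]
  by (rule sum.cong) (simp_all add: algebra_simps power2_eq_square)

lemma form_scale: "form k (\<lambda>i. t * c i) (\<lambda>i. t * c i) = t\<^sup>2 * form k c c"
  unfolding form_def sum_distrib_left
  by (rule sum.cong) (simp_all add: algebra_simps power2_eq_square)

lemma form_cong: "(\<And>i. i \<in> nodes \<Longrightarrow> c i = c' i) \<Longrightarrow> form k c c = form k c' c'"
  unfolding form_def by (rule sum.cong) (simp_all add: nodes_p nodes_q)

lemma form_one: "form k c (\<lambda>i. 1) = - 2 * k\<^sup>2 * mass k c"
  unfolding form_def mass_def sum_distrib_left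
  by (rule sum.cong) (simp_all add: algebra_simps power2_eq_square)

lemma mass_scale: "mass k (\<lambda>i. t * c i) = t * mass k c"
  unfolding mass_def sum_distrib_left
  by (rule sum.cong) (simp_all add: algebra_simps)

lemma mass_add: "mass k (\<lambda>i. c i + t * d i) = mass k c + t * mass k d"
  unfolding mass_def sum_distrib_left sum.distrib[symmetric]
  by (rule sum.cong) (simp_all add: algebra_simps)

lemma mass_cong: "(\<And>i. i \<in> nodes \<Longrightarrow> c i = c' i) \<Longrightarrow> mass k c = mass k c'"
  unfolding mass_def by (rule sum.cong) (simp_all add: nodes_p nodes_q)

lemma mass_one_pos: "0 \<le> k \<Longrightarrow> k \<le> K \<Longrightarrow> 0 < mass k (\<lambda>i. 1)"
  unfolding mass_def using B_pos finite_J J_nonempty by (intro sum_pos) auto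

lemma continuous_on_A_fst: "j \<in> J \<Longrightarrow> continuous_on ({0..K} \<times> UNIV) (\<lambda>x. A j (fst x))"
  by (rule continuous_on_compose2[OF continuous_A]) (auto intro!: continuous_intros)

lemma continuous_on_B_fst: "j \<in> J \<Longrightarrow> continuous_on ({0..K} \<times> UNIV) (\<lambda>x. B j (fst x))"
  by (rule continuous_on_compose2[OF continuous_B]) (auto intro!: continuous_intros)

lemma continuous_on_coordinate:
  fixes S :: "(real \<times> ('i \<Rightarrow> real)) set"
  shows "continuous_on S (\<lambda>x. snd x i)"
  using continuous_on_compose2[OF continuous_on_product_coordinates[of i], of S snd]
  by (simp add: continuous_on_snd[OF continuous_on_id])

lemma continuous_on_form: "continuous_on ({0..K} \<times> UNIV) (\<lambda>x. form (fst x) (snd x) (snd x))"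
  unfolding form_def
  by (intro continuous_intros continuous_on_A_fst continuous_on_B_fst continuous_on_coordinate)

lemma continuous_on_mass: "continuous_on ({0..K} \<times> UNIV) (\<lambda>x. mass (fst x) (snd x))"
  unfolding mass_def
  by (intro continuous_intros continuous_on_B_fst continuous_on_coordinate)

definition admissible :: "real \<Rightarrow> ('i \<Rightarrow> real) \<Rightarrow> bool" where
  "admissible k c \<longleftrightarrow> 0 \<le> k \<and> k \<le> K \<and> mass k c = 0 \<and> form k c c \<le> 0"

text \<open>Admissibility is invariant under scaling and depends on the values at the nodes only, so it can be
  studied on a unit sphere.\<close>

lemma admissible_normalize:
  assumes "admissible k c" and "\<exists>i\<in>nodes. c i \<noteq> 0"
  obtains c' where "admissible k c'" "\<forall>i. i \<notin> nodes \<longrightarrow> c' i = 0" "(\<Sum>i\<in>nodes. (c' i)\<^sup>2) = 1"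
proof -
  define r where "r = sqrt (\<Sum>i\<in>nodes. (c i)\<^sup>2)"
  have pos: "0 < (\<Sum>i\<in>nodes. (c i)\<^sup>2)"
    using assms(2) finite_nodes by (auto intro!: sum_pos2)
  then have r: "0 < r" "r\<^sup>2 = (\<Sum>i\<in>nodes. (c i)\<^sup>2)"
    by (auto simp: r_def)
  define c' where "c' i = (if i \<in> nodes then (1 / r) * c i else 0)" for i
  have "form k c' c' = (1/r)\<^sup>2 * form k c c"
    unfolding form_scale[symmetric] by (rule form_cong) (simp add: c'_def)
  moreover have "mass k c' = (1/r) * mass k c"
    unfolding mass_scale[symmetric] by (rule mass_cong) (simp add: c'_def)
  ultimately have "admissible k c'"
    using assms(1) by (auto simp: admissible_def mult_nonneg_nonpos divide_nonpos_nonneg)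
  moreover have "(\<Sum>i\<in>nodes. (c' i)\<^sup>2) = (\<Sum>i\<in>nodes. (1/r)\<^sup>2 * (c i)\<^sup>2)"
    by (rule sum.cong) (auto simp: c'_def power_divide)
  then have "(\<Sum>i\<in>nodes. (c' i)\<^sup>2) = 1"
    using r pos by (simp add: sum_divide_distrib[symmetric] power_divide)
  ultimately show ?thesis
    by (intro that[of c']) (auto simp: c'_def)
qed

definition admissible_unit_vectors :: "(real \<times> ('i \<Rightarrow> real)) set" where
  "admissible_unit_vectors = {(k, c). admissible k c \<and> (\<forall>i. i \<notin> nodes \<longrightarrow> c i = 0) \<and> (\<Sum>i\<in>nodes. (c i)\<^sup>2) = 1}"

lemma mem_admissible_unit_vectors:
  "x \<in> admissible_unit_vectors \<longleftrightarrow> fst x \<in> {0..K} \<and> (\<forall>i. i \<notin> nodes \<longrightarrow> snd x i = 0) \<and>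
     (\<Sum>i\<in>nodes. (snd x i)\<^sup>2) = 1 \<and> mass (fst x) (snd x) = 0 \<and> form (fst x) (snd x) (snd x) \<le> 0"
  by (auto simp: admissible_unit_vectors_def admissible_def)

text \<open>Since the vectors are supported on the finite set of nodes, they lie in a product of copies of
  \<open>{-1..1}\<close> and \<open>{0}\<close>, which is compact by Tychonoff's theorem; the remaining conditions are closed.\<close>

lemma compact_admissible_unit_vectors:
  "compact admissible_unit_vectors" (is "compact ?Z")
proof -
  define X where "X = {0..K} \<times> PiE UNIV (\<lambda>i. if i \<in> nodes then {-1..1::real} else {0})"
  have "compact (PiE UNIV (\<lambda>i. if i \<in> nodes then {-1..1::real} else {0}))"
    unfolding compactin_euclidean_iff[symmetric] euclidean_product_topology[symmetric]
    by (subst compactin_PiE) auto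
  then have "compact X" unfolding X_def by (intro compact_Times) auto
  have sq: "continuous_on X (\<lambda>x. \<Sum>i\<in>nodes. (snd x i)\<^sup>2)"
    by (intro continuous_intros continuous_on_coordinate)
  have sub: "X \<subseteq> {0..K} \<times> UNIV" by (auto simp: X_def)
  note fm = continuous_on_subset[OF continuous_on_form sub]
  note ms = continuous_on_subset[OF continuous_on_mass sub]
  have "closed (PiE UNIV (\<lambda>i. if i \<in> nodes then {-1..1::real} else {0}))"
    unfolding closed_closedin euclidean_product_topology[symmetric]
    by (subst closedin_product_topology) auto
  then have "closed X" unfolding X_def by (intro closed_Times) auto
  have "?Z \<subseteq> X"
  proof
    fix x assume x: "x \<in> ?Z"
    have "\<bar>snd x i\<bar> \<le> 1" if "i \<in> nodes" for i
    proof -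
      have "(snd x i)\<^sup>2 \<le> (\<Sum>i\<in>nodes. (snd x i)\<^sup>2)"
        using that finite_nodes by (intro member_le_sum) auto
      then show ?thesis using x by (simp add: mem_admissible_unit_vectors abs_square_le_1)
    qed
    then have "\<forall>i. snd x i \<in> (if i \<in> nodes then {-1..1} else {0})"
      using x by (auto simp: mem_admissible_unit_vectors abs_le_iff minus_le_iff)
    then have "snd x \<in> PiE UNIV (\<lambda>i. if i \<in> nodes then {-1..1} else {0})"
      unfolding PiE_iff by (auto simp del: if_split)
    then show "x \<in> X" using x unfolding X_def mem_Times_iff mem_admissible_unit_vectors by blast
  qed
  moreover have "X \<inter> ?Z = {x\<in>X. (\<Sum>i\<in>nodes. (snd x i)\<^sup>2) = 1} \<inter> {x\<in>X. mass (fst x) (snd x) = 0}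
      \<inter> {x\<in>X. form (fst x) (snd x) (snd x) \<le> 0}"
    unfolding X_def set_eq_iff Int_iff mem_Collect_eq mem_admissible_unit_vectors
    by (auto simp: mem_Times_iff PiE_iff split: if_splits)
  moreover have "closed {x\<in>X. (\<Sum>i\<in>nodes. (snd x i)\<^sup>2) = 1}"
    by (intro continuous_closed_preimage_constant sq \<open>closed X\<close>)
  moreover have "closed {x\<in>X. mass (fst x) (snd x) = 0}"
    by (intro continuous_closed_preimage_constant ms \<open>closed X\<close>)
  moreover have "closed (X \<inter> (\<lambda>x. form (fst x) (snd x) (snd x)) -` {..0})"
    by (intro continuous_closed_preimage fm \<open>closed X\<close>) auto
  moreover have "X \<inter> (\<lambda>x. form (fst x) (snd x) (snd x)) -` {..0} = {x\<in>X. form (fst x) (snd x) (snd x) \<le> 0}"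
    by auto
  ultimately have "closed (X \<inter> ?Z)" and Z: "X \<inter> ?Z = ?Z"
    by (simp_all add: closed_Int Int_absorb1)
  then have "compact (X \<inter> (X \<inter> ?Z))" using \<open>compact X\<close> by (intro compact_Int_closed)
  then show ?thesis unfolding Z .
qed

text \<open>The constant to be added to \<open>c\<close> in order to make its mass vanish. It depends continuously on \<open>k\<close>, which
  allows moving a vector from the constraint at one parameter to that at another.\<close>

definition recentre :: "real \<Rightarrow> ('i \<Rightarrow> real) \<Rightarrow> real" where
  "recentre k c = - mass k c / mass k (\<lambda>i. 1)"

lemma mass_recentre:
  assumes "0 \<le> k" "k \<le> K"
  shows "mass k (\<lambda>i. c i + recentre k c) = 0"
  using mass_add[of k c "recentre k c" "\<lambda>i. 1"] mass_one_pos[OF assms] by (simp add: recentre_def)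

lemma form_neg_imp_nonzero:
  assumes "form k c c < 0"
  shows "\<exists>i\<in>nodes. c i \<noteq> 0"
proof (rule ccontr)
  assume "\<not> ?thesis"
  then have "form k c c = form k (\<lambda>i. 0) (\<lambda>i. 0)" by (intro form_cong) auto
  then show False using assms by (simp add: form_def)
qed

text \<open>A strict inequality survives a small decrease of \<open>k\<close>, if the vector is recentred to satisfy the constraint
  at the smaller parameter.\<close>

lemma negative_form_earlier:
  assumes k: "0 < k" "k \<le> K" and "mass k c = 0" and neg: "form k c c < 0"
  obtains k' c' where "k' < k" "admissible k' c'" "\<exists>i\<in>nodes. c' i \<noteq> 0"
proof -
  define g where "g s = form s (\<lambda>i. c i + recentre s c) (\<lambda>i. c i + recentre s c)" for s
  have rc: "continuous_on {0..K} (\<lambda>s. recentre s c)"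
    unfolding recentre_def using mass_one_pos
    by (intro continuous_intros continuous_on_compose2[OF continuous_on_mass, of _ "\<lambda>s. (s, c)", simplified]
         continuous_on_compose2[OF continuous_on_mass, of _ "\<lambda>s. (s, \<lambda>i. 1)", simplified]) force+
  have "continuous_on {0..K} g"
    unfolding g_def
    by (intro continuous_on_compose2[OF continuous_on_form, of _ "\<lambda>s. (s, \<lambda>i. c i + recentre s c)", simplified]
         continuous_intros continuous_on_coordinatewise_then_product rc) auto
  moreover have "g k < 0"
    using neg \<open>mass k c = 0\<close> by (simp add: g_def recentre_def)
  ultimately have "eventually (\<lambda>s. g s < 0) (at k within {0..K})"
    using k by (intro order_tendstoD) (auto simp: continuous_on_def)
  then obtain d where d: "d > 0" "\<And>s. s \<in> {0..K} \<Longrightarrow> s \<noteq> k \<Longrightarrow> dist s k < d \<Longrightarrow> g s < 0"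
    unfolding eventually_at by blast
  define s where "s = max (k/2) (k - d/2)"
  have s: "s < k" "0 \<le> s" "s \<le> K" "dist s k < d"
    using k d(1) by (auto simp: s_def dist_real_def)
  have "g s < 0" using s by (intro d(2)) auto
  then show ?thesis
    using s mass_recentre[of s c]
    by (intro that[of s "\<lambda>i. c i + recentre s c"] form_neg_imp_nonzero) (auto simp: admissible_def g_def)
qed

text \<open>Let \<open>k\<close> be the least parameter with an admissible unit vector \<open>c\<close>. By \<open>negative_form_earlier\<close> the form is
  nonnegative on mass-zero vectors at \<open>k\<close>, so \<open>c\<close> minimises it there and is orthogonal to all mass-zero
  vectors. It is also orthogonal to the constants, and these two kinds of vectors span everything.
  Moreover \<open>k < K\<close>, because at \<open>K\<close> the recentred test vector has a negative form.\<close>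

theorem exists_singular_parameter:
  assumes test: "\<And>t. form K (\<lambda>i. c\<^sub>0 i + t) (\<lambda>i. c\<^sub>0 i + t) < 0"
  obtains k c where "0 < k" "k < K" "\<exists>i\<in>nodes. c i \<noteq> 0" "\<And>d. form k c d = 0"
proof -
  define Z where "Z = admissible_unit_vectors"
  have Z_I: "\<exists>c'. (k, c') \<in> Z" if "admissible k c" "\<exists>i\<in>nodes. c i \<noteq> 0" for k c
  proof -
    obtain c' where "admissible k c'" "\<forall>i. i \<notin> nodes \<longrightarrow> c' i = 0" "(\<Sum>i\<in>nodes. (c' i)\<^sup>2) = 1"
      using admissible_normalize[OF \<open>admissible k c\<close> \<open>\<exists>i\<in>nodes. c i \<noteq> 0\<close>] by blast
    then have "(k, c') \<in> Z" by (simp add: Z_def admissible_unit_vectors_def)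
    then show ?thesis by blast
  qed
  define c\<^sub>1 where "c\<^sub>1 = (\<lambda>i. c\<^sub>0 i + recentre K c\<^sub>0)"
  have c1: "form K c\<^sub>1 c\<^sub>1 < 0" "mass K c\<^sub>1 = 0"
    using test mass_recentre[of K c\<^sub>0] K_pos by (auto simp: c\<^sub>1_def)
  have "Z \<noteq> {}"
    using Z_I[of K c\<^sub>1] c1 form_neg_imp_nonzero[of K c\<^sub>1] K_pos by (auto simp: admissible_def)
  moreover have "compact Z" unfolding Z_def by (rule compact_admissible_unit_vectors)
  moreover have "continuous_on Z fst" by (intro continuous_intros)
  ultimately obtain x where x: "x \<in> Z" "\<And>y. y \<in> Z \<Longrightarrow> fst x \<le> fst y"
    using continuous_attains_inf[of Z fst] by metis
  define k c where "k = fst x" and "c = snd x"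
  have k: "0 \<le> k" "k \<le> K" and c: "mass k c = 0" "form k c c \<le> 0" "(\<Sum>i\<in>nodes. (c i)\<^sup>2) = 1"
    using x(1) by (auto simp: Z_def mem_admissible_unit_vectors k_def c_def)
  have nz: "\<exists>i\<in>nodes. c i \<noteq> 0"
    using c(3) by (rule_tac ccontr) auto
  \<comment> \<open>At 0 only the squared differences remain; they force \<open>c\<close> to be constant, and
      its mass forces that constant to be 0.\<close>
  have "k \<noteq> 0"
  proof
    assume "k = 0"
    then have "(\<Sum>j\<in>J. A j 0 * ((c (p j) - c (q j)) * (c (p j) - c (q j)))) \<le> 0"
      using c(2) by (simp add: form_def)
    moreover have "A j 0 * ((c (p j) - c (q j)) * (c (p j) - c (q j))) \<ge> 0" if "j \<in> J" for j
      using A_pos[OF that] by (simp add: mult_nonneg_nonneg)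
    ultimately have "\<forall>j\<in>J. A j 0 * ((c (p j) - c (q j)) * (c (p j) - c (q j))) = 0"
      by (subst sum_nonneg_eq_0_iff[symmetric, OF finite_J]) (auto intro!: antisym sum_nonneg)
    then have "\<forall>j\<in>J. c (p j) = c (q j)" using A_pos by force
    from connected[OF this] obtain t where t: "\<forall>i\<in>nodes. c i = t" by (auto simp: nodes_def)
    then have "mass 0 c = t * mass 0 (\<lambda>i. 1)"
      unfolding mass_scale[symmetric] by (intro mass_cong) auto
    then have "t = 0" using c(1) \<open>k = 0\<close> mass_one_pos[of 0] K_pos by auto
    then show False using nz t by auto
  qed
  then have "0 < k" using k by simp
  have nonneg: "form k d d \<ge> 0" if "mass k d = 0" for d
  proof (rule ccontr)
    assume "\<not> ?thesis"
    then obtain k' c' where "k' < k" "admissible k' c'" "\<exists>i\<in>nodes. c' i \<noteq> 0"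
      using negative_form_earlier[OF \<open>0 < k\<close> \<open>k \<le> K\<close> \<open>mass k d = 0\<close>] by auto
    then obtain c'' where "(k', c'') \<in> Z" using Z_I by blast
    then show False using x(2) \<open>k' < k\<close> by (force simp: k_def)
  qed
  have "k \<noteq> K" using nonneg[of c\<^sub>1] c1 by auto
  have zero: "form k c c = 0" using c nonneg[of c] by simp
  have one: "form k c (\<lambda>i. 1) = 0" by (simp add: form_one c)
  have orth: "form k c d = 0" if "mass k d = 0" for d
  proof -
    have le: "0 \<le> 2 * t * form k c d + t\<^sup>2 * form k d d" for t
      using nonneg[of "\<lambda>i. c i + t * d i"] that c(1) zero
      by (simp add: form_add_scaled mass_add)
    define a b where "a = form k c d" and "b = form k d d"
    have "b \<ge> 0" using nonneg[OF that] by (simp add: b_def)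
    \<comment> \<open>The quadratic is negative at \<open>- r\<close> unless \<open>a = 0\<close>. Its minimum is at \<open>- a / b\<close>, but \<open>b\<close> may be 0.\<close>
    define r where "r = a / (b + 1)"
    have a: "a = r * (b + 1)" using \<open>b \<ge> 0\<close> by (simp add: r_def)
    have "0 \<le> - (r\<^sup>2 * (b + 2))"
      using le[of "- r"] a by (simp add: a_def[symmetric] b_def[symmetric] algebra_simps power2_eq_square)
    then have "r = 0" using \<open>b \<ge> 0\<close> by (simp add: mult_le_0_iff)
    then have "a = 0" using a by simp
    then show ?thesis by (simp add: a_def)
  qed
  have "form k c d = 0" for d
  proof -
    have "form k c (\<lambda>i. d i + recentre k d * 1) = 0"
      using mass_recentre[OF k, of d] by (intro orth) simp
    then show ?thesis unfolding form_add_right one by simp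
  qed
  then show ?thesis
    using that[of k c] \<open>0 < k\<close> \<open>k \<noteq> K\<close> k nz by auto
qed

end

section \<open>Sinusoids on an interval\<close>

text \<open>With \<open>\<phi> = k h / 2\<close> these are \<open>k / 2 * cot \<phi>\<close> and, after multiplication of the second by \<open>k\<^sup>2\<close>,
  \<open>k / 2 * tan \<phi>\<close>. Writing them with \<open>sinc\<close> makes them continuous at \<open>k = 0\<close>.\<close>

definition stiffness :: "real \<Rightarrow> real \<Rightarrow> real" where
  "stiffness h k = cos (k * h / 2) / (h * sinc (k * h / 2))"

definition lump :: "real \<Rightarrow> real \<Rightarrow> real" where
  "lump h k = h / 4 * sinc (k * h / 2) / cos (k * h / 2)"

lemma sinc_pos:
  assumes "0 \<le> x" "x < pi"
  shows "0 < sinc x"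
  using assms by (auto intro!: divide_pos_pos sin_gt_zero)

lemma stiffness_zero: "0 < h \<Longrightarrow> stiffness h 0 = 1 / h"
  by (simp add: stiffness_def)

lemma lump_pos:
  assumes "0 < h" "0 \<le> k" "k * h < pi"
  shows "0 < lump h k"
proof -
  have kh: "0 \<le> k * h" using assms by simp
  have "0 < cos (k * h / 2)"
    using \<open>k * h < pi\<close> kh pi_gt_zero by (intro cos_gt_zero_pi) linarith+
  moreover have "0 < sinc (k * h / 2)"
    using \<open>k * h < pi\<close> kh pi_gt_zero by (intro sinc_pos) linarith+
  ultimately show ?thesis
    unfolding lump_def using assms by (intro divide_pos_pos mult_pos_pos) auto
qed

lemma
  assumes "0 < h" "k\<^sub>1 * h < pi"
  shows continuous_on_stiffness: "continuous_on {0..k\<^sub>1} (stiffness h)"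
    and continuous_on_lump: "continuous_on {0..k\<^sub>1} (lump h)"
proof -
  have kh: "0 \<le> k * h" "k * h < pi" if "k \<in> {0..k\<^sub>1}" for k
    using that assms order.strict_trans1[OF mult_right_mono[of k k\<^sub>1 h] assms(2)] by auto
  have *: "0 < cos (k * h / 2)" "0 < sinc (k * h / 2)" if "k \<in> {0..k\<^sub>1}" for k
    using kh[OF that] pi_gt_zero by (intro cos_gt_zero_pi sinc_pos; linarith)+
  have s: "continuous_on {0..k\<^sub>1} (\<lambda>k. sinc (k * h / 2))"
    by (intro continuous_on_sinc continuous_intros) auto
  show "continuous_on {0..k\<^sub>1} (stiffness h)"
    unfolding stiffness_def using * assms
    by (intro continuous_on_divide continuous_on_mult s continuous_intros) force+
  show "continuous_on {0..k\<^sub>1} (lump h)"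
    unfolding lump_def using * assms
    by (intro continuous_on_divide continuous_on_mult s continuous_intros) force+
qed

lemma
  assumes "0 < h" "0 < k"
  shows stiffness_eq: "stiffness h k = k / 2 * (cos (k * h / 2) / sin (k * h / 2))"
    and lump_eq: "k\<^sup>2 * lump h k = k / 2 * (sin (k * h / 2) / cos (k * h / 2))"
  using assms by (simp_all add: stiffness_def lump_def field_simps power2_eq_square)

lemma half_angle_fractions:
  fixes \<phi> :: real
  assumes "0 < \<phi>" "\<phi> < pi / 2"
  shows "cos \<phi> / sin \<phi> - sin \<phi> / cos \<phi> = 2 * cos (2 * \<phi>) / sin (2 * \<phi>)"
    and "cos \<phi> / sin \<phi> + sin \<phi> / cos \<phi> = 2 / sin (2 * \<phi>)"
proof -
  have "0 < sin \<phi>" "0 < cos \<phi>" using assms by (auto intro: sin_gt_zero cos_gt_zero)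
  then show "cos \<phi> / sin \<phi> - sin \<phi> / cos \<phi> = 2 * cos (2 * \<phi>) / sin (2 * \<phi>)"
    and "cos \<phi> / sin \<phi> + sin \<phi> / cos \<phi> = 2 / sin (2 * \<phi>)"
    unfolding sin_double cos_double using sin_cos_squared_add[of \<phi>]
    by (simp_all add: field_simps power2_eq_square)
qed

text \<open>For the solution of \<open>u'' = - k\<^sup>2 u\<close> on an interval of length \<open>h\<close> with end values \<open>a\<close> and \<open>b\<close>, the derivative
  at the end with value \<open>a\<close>, directed into the interval.\<close>

definition out_slope :: "real \<Rightarrow> real \<Rightarrow> real \<Rightarrow> real \<Rightarrow> real" where
  "out_slope k h a b = k * (b - a * cos (k * h)) / sin (k * h)"

text \<open>This is Green's formula: for solutions \<open>u\<close>, \<open>v\<close> of \<open>u'' = - k\<^sup>2 u\<close> the integral of \<open>u' v' - k\<^sup>2 u v\<close> reduces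
  to the boundary terms \<open>u' v\<close>.\<close>

lemma interval_form_eq_slopes:
  assumes "0 < h" "0 < k" "k * h < pi"
  shows "stiffness h k * ((a - b) * (y - z)) - k\<^sup>2 * (lump h k * ((a + b) * (y + z))) =
     - (out_slope k h a b * y + out_slope k h b a * z)"
proof -
  define \<phi> where "\<phi> = k * h / 2"
  have \<phi>: "0 < \<phi>" "\<phi> < pi / 2" "k * h = 2 * \<phi>" using assms by (auto simp: \<phi>_def)
  define S where "S = cos \<phi> / sin \<phi>"
  define T where "T = sin \<phi> / cos \<phi>"
  have ST: "S - T = 2 * cos (2 * \<phi>) / sin (2 * \<phi>)" "S + T = 2 / sin (2 * \<phi>)"
    unfolding S_def T_def using half_angle_fractions \<phi> by auto
  have slope: "out_slope k h a b = k / 2 * (b * (S + T) - a * (S - T))" for a b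
    unfolding out_slope_def ST \<phi>(3) by (simp add: diff_divide_distrib right_diff_distrib)
  have "stiffness h k = k / 2 * S" "k\<^sup>2 * lump h k = k / 2 * T"
    using stiffness_eq lump_eq assms by (simp_all add: S_def T_def \<phi>_def)
  then have "stiffness h k * ((a - b) * (y - z)) - k\<^sup>2 * (lump h k * ((a + b) * (y + z))) =
      k / 2 * S * ((a - b) * (y - z)) - k / 2 * T * ((a + b) * (y + z))"
    by (metis mult.assoc)
  also have "\<dots> = - (out_slope k h a b * y + out_slope k h b a * z)"
    unfolding slope by (simp add: field_simps)
  finally show ?thesis .
qed

lemma sin_minus_x_cos_pos:
  fixes x :: real
  assumes "0 < x" "x < pi"
  shows "x * cos x < sin x"
proof -
  have "(\<lambda>x. sin x - x * cos x) 0 < (\<lambda>x. sin x - x * cos x) x"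
  proof (rule DERIV_pos_imp_increasing_open[OF assms(1)])
    fix y assume y: "0 < y" "y < x"
    have "((\<lambda>x. sin x - x * cos x) has_real_derivative y * sin y) (at y)"
      by (auto intro!: derivative_eq_intros)
    moreover have "0 < y * sin y" using y assms by (intro mult_pos_pos sin_gt_zero) auto
    ultimately show "\<exists>d. ((\<lambda>x. sin x - x * cos x) has_real_derivative d) (at y) \<and> 0 < d" by blast
  qed (auto intro!: continuous_intros)
  then show ?thesis by simp
qed

text \<open>The difference of the two sides vanishes at 0 and has derivative \<open>x / 3 * (sin x - x * cos x)\<close>, which is
  positive by the preceding lemma.\<close>

lemma x_cos_less_cubic_sin:
  fixes x :: real
  assumes "0 < x" "x < pi"
  shows "x * cos x < (1 - x\<^sup>2 / 3) * sin x"
proof -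
  define f :: "real \<Rightarrow> real" where "f = (\<lambda>x. (1 - x\<^sup>2 / 3) * sin x - x * cos x)"
  have "f 0 < f x"
  proof (rule DERIV_pos_imp_increasing_open[OF assms(1)])
    fix y assume y: "0 < y" "y < x"
    have "(f has_real_derivative y / 3 * (sin y - y * cos y)) (at y)"
      unfolding f_def by (auto intro!: derivative_eq_intros simp: algebra_simps power2_eq_square)
    moreover have "0 < y / 3 * (sin y - y * cos y)"
      using y assms sin_minus_x_cos_pos[of y] by (intro mult_pos_pos) auto
    ultimately show "\<exists>d. (f has_real_derivative d) (at y) \<and> 0 < d" by blast
  qed (auto intro!: continuous_intros simp: f_def)
  then show ?thesis by (simp add: f_def)
qed

text \<open>Among all functions with end values \<open>a\<close> and \<open>b\<close> the sinusoid minimises the integral of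
  \<open>(u')\<^sup>2 - k\<^sup>2 u\<^sup>2\<close>, since \<open>k h < \<pi>\<close>; the right side is this integral for the linear interpolation. In the
  coordinates \<open>a - b\<close> and \<open>a + b\<close> the claim splits into \<open>\<phi> cot \<phi> < 1 - \<phi>\<^sup>2 / 3\<close> and \<open>\<phi> \<le> tan \<phi>\<close>.\<close>

lemma interval_form_le_linear:
  assumes "0 < h" "0 < k" "k * h < pi"
  shows "stiffness h k * ((a - b) * (a - b)) - k\<^sup>2 * (lump h k * ((a + b) * (a + b)))
      \<le> (a - b)\<^sup>2 / h - k\<^sup>2 * (h / 3 * (a\<^sup>2 + a * b + b\<^sup>2))" (is "?l \<le> ?r")
    and "a \<noteq> b \<Longrightarrow> stiffness h k * ((a - b) * (a - b)) - k\<^sup>2 * (lump h k * ((a + b) * (a + b)))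
      < (a - b)\<^sup>2 / h - k\<^sup>2 * (h / 3 * (a\<^sup>2 + a * b + b\<^sup>2))"
proof -
  define \<phi> where "\<phi> = k * h / 2"
  have \<phi>: "0 < \<phi>" "\<phi> < pi / 2" "k = 2 * \<phi> / h" using assms by (auto simp: \<phi>_def)
  have pos: "0 < sin \<phi>" "0 < cos \<phi>" using \<phi> by (auto intro: sin_gt_zero cos_gt_zero)
  have 1: "\<phi> * (cos \<phi> / sin \<phi>) < 1 - \<phi>\<^sup>2 / 3"
    using x_cos_less_cubic_sin[of \<phi>] \<phi> pos by (simp add: divide_less_eq)
  have 2: "\<phi>\<^sup>2 \<le> \<phi> * (sin \<phi> / cos \<phi>)"
    using sin_minus_x_cos_pos[of \<phi>] \<phi> pos by (simp add: power2_eq_square le_divide_eq)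
  have scale: "k / 2 * S * x - k / 2 * T * y = 1 / h * (\<phi> * S * x - \<phi> * T * y)" for S T x y
    using assms unfolding \<phi>(3) by (simp add: field_simps)
  have "stiffness h k = k / 2 * (cos \<phi> / sin \<phi>)" "k\<^sup>2 * lump h k = k / 2 * (sin \<phi> / cos \<phi>)"
    using stiffness_eq lump_eq assms by (simp_all add: \<phi>_def)
  then have "?l = k / 2 * (cos \<phi> / sin \<phi>) * ((a - b) * (a - b)) - k / 2 * (sin \<phi> / cos \<phi>) * ((a + b) * (a + b))"
    by (metis mult.assoc)
  also have "\<dots> = (1 / h) * (\<phi> * (cos \<phi> / sin \<phi>) * (a - b)\<^sup>2 - \<phi> * (sin \<phi> / cos \<phi>) * (a + b)\<^sup>2)"
    unfolding power2_eq_square by (rule scale)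
  finally have "?l = (1 / h) * (\<phi> * (cos \<phi> / sin \<phi>) * (a - b)\<^sup>2 - \<phi> * (sin \<phi> / cos \<phi>) * (a + b)\<^sup>2)" .
  moreover have "?r = (1 / h) * ((1 - \<phi>\<^sup>2 / 3) * (a - b)\<^sup>2 - \<phi>\<^sup>2 * (a + b)\<^sup>2)"
    using assms unfolding \<phi>(3) by (simp add: field_simps power2_eq_square)
  moreover have "\<phi>\<^sup>2 * (a + b)\<^sup>2 \<le> \<phi> * (sin \<phi> / cos \<phi>) * (a + b)\<^sup>2"
    by (rule mult_right_mono[OF 2]) simp
  moreover have "\<phi> * (cos \<phi> / sin \<phi>) * (a - b)\<^sup>2 \<le> (1 - \<phi>\<^sup>2 / 3) * (a - b)\<^sup>2"
    using 1 by (intro mult_right_mono) auto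
  moreover have "\<phi> * (cos \<phi> / sin \<phi>) * (a - b)\<^sup>2 < (1 - \<phi>\<^sup>2 / 3) * (a - b)\<^sup>2" if "a \<noteq> b"
    using 1 that by (intro mult_strict_right_mono) auto
  ultimately show "?l \<le> ?r" "a \<noteq> b \<Longrightarrow> ?l < ?r"
    using assms(1) by (simp_all add: divide_right_mono divide_strict_right_mono)
qed

definition sinusoid :: "real \<Rightarrow> real \<Rightarrow> real \<Rightarrow> real \<Rightarrow> real" where
  "sinusoid k \<alpha> \<beta> x = \<alpha> * cos (k * x) + \<beta> * sin (k * x)"

lemma sinusoid_has_derivative:
  "(sinusoid k \<alpha> \<beta> has_real_derivative sinusoid k (k * \<beta>) (- (k * \<alpha>)) x) (at x within S)"
  unfolding sinusoid_def[abs_def] by (auto intro!: derivative_eq_intros simp: algebra_simps)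

lemma continuous_on_sinusoid: "continuous_on S (sinusoid k \<alpha> \<beta>)"
  unfolding sinusoid_def[abs_def] by (intro continuous_intros)

lemma sinusoid_shift:
  "sinusoid k \<alpha> \<beta> (x + h) * k = k * cos (k * h) * sinusoid k \<alpha> \<beta> x
     + sin (k * h) * sinusoid k (k * \<beta>) (- (k * \<alpha>)) x"
  by (simp add: sinusoid_def distrib_left cos_add sin_add algebra_simps)

lemma out_slope_sinusoid:
  assumes "0 < k" "0 < h" "k * h < pi"
  shows "out_slope k h (sinusoid k \<alpha> \<beta> x) (sinusoid k \<alpha> \<beta> (x + h)) = sinusoid k (k * \<beta>) (- (k * \<alpha>)) x"
    and "out_slope k h (sinusoid k \<alpha> \<beta> (x + h)) (sinusoid k \<alpha> \<beta> x) = - sinusoid k (k * \<beta>) (- (k * \<alpha>)) (x + h)"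
proof -
  have s: "0 < sin (k * h)" using assms by (intro sin_gt_zero) auto
  show "out_slope k h (sinusoid k \<alpha> \<beta> x) (sinusoid k \<alpha> \<beta> (x + h)) = sinusoid k (k * \<beta>) (- (k * \<alpha>)) x"
    using s sinusoid_shift[of k \<alpha> \<beta> x h]
    by (simp add: out_slope_def divide_eq_eq algebra_simps)
  show "out_slope k h (sinusoid k \<alpha> \<beta> (x + h)) (sinusoid k \<alpha> \<beta> x) = - sinusoid k (k * \<beta>) (- (k * \<alpha>)) (x + h)"
    using s sinusoid_shift[of k \<alpha> \<beta> "x + h" "- h"]
    by (simp add: out_slope_def divide_eq_eq algebra_simps)
qed

lemma out_slope_inject:
  assumes "0 < k" "0 < h" "k * h < pi" "out_slope k h a b = out_slope k h a b'"
  shows "b = b'"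
proof -
  have "0 < sin (k * h)" using assms by (intro sin_gt_zero) auto
  then show ?thesis using assms by (simp add: out_slope_def)
qed

text \<open>The sinusoid is determined by the first two nodes. At every further node the balance condition says that
  the derivative is continuous, and value and derivative at a node determine the next value.\<close>

lemma exists_sinusoid_through_nodes:
  assumes k: "0 < k" and n: "0 < n" and "x 0 = 0"
    and h: "\<And>j. j < n \<Longrightarrow> x j < x (Suc j)" "\<And>j. j < n \<Longrightarrow> k * (x (Suc j) - x j) < pi"
    and balance: "\<And>j. Suc j < n \<Longrightarrow>
      out_slope k (x (Suc j) - x j) (c (Suc j)) (c j) +
      out_slope k (x (Suc (Suc j)) - x (Suc j)) (c (Suc j)) (c (Suc (Suc j))) = 0"
  obtains \<alpha> \<beta> where "\<And>j. j \<le> n \<Longrightarrow> c j = sinusoid k \<alpha> \<beta> (x j)"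
proof -
  define \<alpha> where "\<alpha> = c 0"
  define \<beta> where "\<beta> = out_slope k (x (Suc 0) - x 0) (c 0) (c (Suc 0)) / k"
  define U where "U = sinusoid k \<alpha> \<beta>"
  define V where "V = sinusoid k (k * \<beta>) (- (k * \<alpha>))"
  have slopes: "out_slope k (x (Suc j) - x j) (U (x j)) (U (x (Suc j))) = V (x j)"
     "out_slope k (x (Suc j) - x j) (U (x (Suc j))) (U (x j)) = - V (x (Suc j))" if "j < n" for j
    using out_slope_sinusoid[of k "x (Suc j) - x j" \<alpha> \<beta> "x j"] h[OF that] k by (simp_all add: U_def V_def)
  have "c j = U (x j) \<and> c (Suc j) = U (x (Suc j))" if "j < n" for j
    using that
  proof (induction j)
    case 0
    have c0: "c 0 = U (x 0)" by (simp add: U_def sinusoid_def \<alpha>_def \<open>x 0 = 0\<close>)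
    have "out_slope k (x (Suc 0) - x 0) (c 0) (c (Suc 0)) = V (x 0)"
      using k by (simp add: V_def sinusoid_def \<beta>_def \<open>x 0 = 0\<close>)
    then have "c (Suc 0) = U (x (Suc 0))"
      using slopes(1)[OF 0] h[OF 0] k c0
        out_slope_inject[of k "x (Suc 0) - x 0" "c 0" "c (Suc 0)" "U (x (Suc 0))"] by simp
    with c0 show ?case by simp
  next
    case (Suc j)
    then have c: "c j = U (x j)" "c (Suc j) = U (x (Suc j))" by auto
    have "out_slope k (x (Suc (Suc j)) - x (Suc j)) (c (Suc j)) (c (Suc (Suc j))) = V (x (Suc j))"
      using balance[of j] slopes(2)[of j] Suc.prems c by simp
    then have "c (Suc (Suc j)) = U (x (Suc (Suc j)))"
      using slopes(1)[OF Suc.prems] h[OF Suc.prems] k c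
        out_slope_inject[of k "x (Suc (Suc j)) - x (Suc j)" "c (Suc j)" "c (Suc (Suc j))" "U (x (Suc (Suc j)))"]
      by simp
    with c show ?case by simp
  qed
  then have "c j = U (x j)" if "j \<le> n" for j
    using that n by (cases "j < n") (auto simp: le_less gr0_conv_Suc)
  then show ?thesis using that[of \<alpha> \<beta>] by (simp add: U_def)
qed

section \<open>Regularity of weak solutions and nonnegativity of the eigenvalues\<close>

lemma set_integrable_continuous_open:
  fixes f :: "real \<Rightarrow> real"
  assumes "continuous_on {0..l} f"
  shows "set_integrable lborel {0<..<l} f"
  by (rule set_integrable_subset[OF borel_integrable_atLeastAtMost'[OF assms]]) auto

lemma square_integrable_continuous:
  assumes "continuous_on {0..l} f"
  shows "square_integrable l f"
proof -
  have "set_integrable lborel {0<..<l} f" "set_integrable lborel {0<..<l} (\<lambda>x. (f x)\<^sup>2)"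
    by (intro set_integrable_continuous_open assms continuous_intros)+
  then show ?thesis
    by (simp add: square_integrable_def set_integrable_def set_borel_measurable_def borel_measurable_integrable)
qed

lemma square_integrable_imp_integrable:
  assumes "square_integrable l f"
  shows "set_integrable lborel {0<..<l} f"
proof (rule set_integrable_bound)
  show "set_integrable lborel {0<..<l} (\<lambda>x. 1 + (f x)\<^sup>2)"
    using assms set_integrable_continuous_open[of l "\<lambda>x. 1"]
    by (intro set_integral_add) (auto simp: square_integrable_def)
  show "set_borel_measurable lborel {0<..<l} f"
    using assms by (simp add: square_integrable_def)
  have "\<bar>t\<bar> \<le> 1 + t\<^sup>2" for t :: real
    using zero_le_power2[of "\<bar>t\<bar> - 1/2"] by (simp add: power2_eq_square algebra_simps abs_if split: if_splits)
  then show "AE x in lborel. x \<in> {0<..<l} \<longrightarrow> norm (f x) \<le> norm (1 + (f x)\<^sup>2)" by simp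
qed

lemma set_integrable_mult_continuous:
  fixes f g :: "real \<Rightarrow> real"
  assumes f: "set_integrable lborel {0<..<l} f" and g: "continuous_on UNIV g"
  shows "set_integrable lborel {0<..<l} (\<lambda>x. f x * g x)"
proof -
  have "compact (g ` {0..l})"
    by (intro compact_continuous_image continuous_on_subset[OF g]) auto
  then have "bounded (g ` {0..l})" by (rule compact_imp_bounded)
  then obtain M where M: "\<And>x. x \<in> {0..l} \<Longrightarrow> \<bar>g x\<bar> \<le> M"
    unfolding bounded_iff by (metis imageI real_norm_def)
  have [measurable]: "g \<in> borel_measurable borel" using g by (rule borel_measurable_continuous_onI)
  show ?thesis
  proof (rule set_integrable_bound)
    show "set_integrable lborel {0<..<l} (\<lambda>x. M * f x)" using f by simp
    have "(\<lambda>x. indicator {0<..<l} x *\<^sub>R f x) \<in> borel_measurable lborel"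
      using f by (simp add: set_integrable_def borel_measurable_integrable)
    then have "(\<lambda>x. (indicator {0<..<l} x *\<^sub>R f x) * g x) \<in> borel_measurable lborel"
      by measurable
    then show "set_borel_measurable lborel {0<..<l} (\<lambda>x. f x * g x)"
      by (simp add: set_borel_measurable_def mult.assoc)
    have "\<bar>f x * g x\<bar> \<le> \<bar>M * f x\<bar>" if "x \<in> {0<..<l}" for x
    proof -
      have "\<bar>g x\<bar> \<le> \<bar>M\<bar>" using M[of x] that by auto
      from mult_left_mono[OF this, of "\<bar>f x\<bar>"] show ?thesis by (simp add: abs_mult mult.commute)
    qed
    then show "AE x in lborel. x \<in> {0<..<l} \<longrightarrow> norm (f x * g x) \<le> norm (M * f x)" by auto
  qed
qed

lemma test_functionD:
  assumes "\<phi> \<in> test_functions l"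
  shows "(\<phi> has_real_derivative deriv \<phi> x) (at x)" "continuous_on UNIV (deriv \<phi>)"
    "continuous_on UNIV \<phi>" "0 \<le> l \<Longrightarrow> \<phi> 0 = 0" "0 \<le> l \<Longrightarrow> \<phi> l = 0"
proof -
  have d: "\<And>x. \<phi> differentiable at x" using assms by (simp add: test_functions_def)
  show "(\<phi> has_real_derivative deriv \<phi> x) (at x)" for x
    using d by (simp add: DERIV_deriv_iff_real_differentiable)
  then show "continuous_on UNIV \<phi>" by (intro DERIV_continuous_on) auto
  show "continuous_on UNIV (deriv \<phi>)" "0 \<le> l \<Longrightarrow> \<phi> 0 = 0" "0 \<le> l \<Longrightarrow> \<phi> l = 0"
    using assms by (auto simp: test_functions_def)
qed

lemma integral_by_parts_test_function:
  assumes l: "0 < l" and F: "\<And>x. (F has_real_derivative f x) (at x)" and f: "continuous_on UNIV f"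
    and \<phi>: "\<phi> \<in> test_functions l"
  shows "(LINT x:{0<..<l}|lborel. F x * deriv \<phi> x) = - (LINT x:{0<..<l}|lborel. f x * \<phi> x)"
proof -
  note \<phi>D = test_functionD[OF \<phi>]
  have cF: "continuous_on UNIV F" using F by (intro DERIV_continuous_on) auto
  have c1: "continuous_on {0..l} (\<lambda>x. F x * deriv \<phi> x)"
    using cF \<phi>D(2) by (intro continuous_on_mult) (auto elim: continuous_on_subset)
  have c2: "continuous_on {0..l} (\<lambda>x. f x * \<phi> x)"
    using f \<phi>D(3) by (intro continuous_on_mult) (auto elim: continuous_on_subset)
  have "(LBINT x=ereal 0..ereal l. F x * deriv \<phi> x + f x * \<phi> x) = F l * \<phi> l - F 0 * \<phi> 0"
  proof (rule interval_integral_FTC_finite)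
    show "continuous_on {min 0 l..max 0 l} (\<lambda>x. F x * deriv \<phi> x + f x * \<phi> x)"
      using l c1 c2 by (auto intro!: continuous_on_add)
    show "((\<lambda>x. F x * \<phi> x) has_vector_derivative F x * deriv \<phi> x + f x * \<phi> x)
        (at x within {min 0 l..max 0 l})" for x
      unfolding has_real_derivative_iff_has_vector_derivative[symmetric]
      by (rule DERIV_subset[where s=UNIV]) (auto intro!: derivative_eq_intros F \<phi>D(1))
  qed
  then have "(LINT x:{0<..<l}|lborel. F x * deriv \<phi> x + f x * \<phi> x) = 0"
    using l \<phi>D(4,5) by (simp add: interval_lebesgue_integral_le_eq del: zero_ereal_def[symmetric] ereal_eq_0)
  then show ?thesis
    using set_integral_add(2)[OF set_integrable_continuous_open[OF c1] set_integrable_continuous_open[OF c2]]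
    by simp
qed

lemma has_weak_deriv_classical:
  assumes l: "0 < l" and F: "\<And>x. (F has_real_derivative f x) (at x)" and f: "continuous_on UNIV f"
  shows "has_weak_deriv l F f"
proof -
  have "continuous_on UNIV F" using F by (intro DERIV_continuous_on) auto
  then show ?thesis
    unfolding has_weak_deriv_def
    using integral_by_parts_test_function[OF l F f] f
    by (auto intro!: square_integrable_continuous elim: continuous_on_subset)
qed

lemma exists_antiderivative:
  fixes f :: "real \<Rightarrow> real"
  assumes "continuous_on UNIV f"
  obtains F where "\<And>x. (F has_real_derivative f x) (at x)"
proof -
  have "\<exists>F. \<forall>x. - \<infinity> < ereal x \<longrightarrow> ereal x < \<infinity> \<longrightarrow> (F has_vector_derivative f x) (at x)"
    using assms by (intro einterval_antiderivative) (auto simp: continuous_on_eq_continuous_at)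
  then show ?thesis
    using that by (auto simp: has_real_derivative_iff_has_vector_derivative)
qed

definition supported_functions :: "real \<Rightarrow> (real \<Rightarrow> real) set" where
  "supported_functions l = {\<psi>. continuous_on UNIV \<psi> \<and>
     (\<exists>a b. 0 < a \<and> b < l \<and> (\<forall>x. x \<notin> {a..b} \<longrightarrow> \<psi> x = 0))}"

lemma test_function_supported: "\<phi> \<in> test_functions l \<Longrightarrow> \<phi> \<in> supported_functions l"
  using test_functionD(3)[of \<phi> l] by (simp add: supported_functions_def test_functions_def)

lemma supported_function_integrable:
  "\<psi> \<in> supported_functions l \<Longrightarrow> set_integrable lborel {0<..<l} \<psi>"
  by (intro set_integrable_continuous_open) (auto simp: supported_functions_def elim: continuous_on_subset)

text \<open>An antiderivative is constant on either side of the support, and mean zero makes the two constants equal,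
  so that subtracting this constant leaves compact support.\<close>

lemma mean_zero_is_deriv_of_test_function:
  assumes l: "0 < l" and \<eta>: "\<eta> \<in> supported_functions l" and mean: "(LINT x:{0<..<l}|lborel. \<eta> x) = 0"
  obtains \<phi> where "\<phi> \<in> test_functions l" "deriv \<phi> = \<eta>"
proof -
  have c: "continuous_on UNIV \<eta>" using \<eta> by (simp add: supported_functions_def)
  obtain a b where ab: "0 < a" "b < l" "\<And>x. x \<notin> {a..b} \<Longrightarrow> \<eta> x = 0"
    using \<eta> by (auto simp: supported_functions_def)
  obtain F where F: "\<And>x. (F has_real_derivative \<eta> x) (at x)"
    using exists_antiderivative[OF c] by blast
  have "(LBINT x=ereal 0..ereal l. \<eta> x) = F l - F 0"
    by (rule interval_integral_FTC_finite)
       (auto intro!: continuous_on_subset[OF c] has_vector_derivative_at_within[OF F[unfolded has_real_derivative_iff_has_vector_derivative]])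
  then have ends: "F l = F 0"
    using l mean by (simp add: interval_lebesgue_integral_le_eq del: zero_ereal_def[symmetric] ereal_eq_0)
  define \<phi> where "\<phi> x = F x - F 0" for x
  have d: "(\<phi> has_real_derivative \<eta> x) (at x)" for x
    unfolding \<phi>_def[abs_def] by (auto intro!: derivative_eq_intros F)
  then have "deriv \<phi> = \<eta>" by (intro ext DERIV_imp_deriv)
  have const: "F x = F y" if "\<And>z. z \<in> S \<Longrightarrow> \<eta> z = 0" "convex S" "x \<in> S" "y \<in> S" for S x y
  proof -
    have "\<And>z. z \<in> S \<Longrightarrow> (F has_real_derivative 0) (at z within S)"
      using F that(1) by (metis DERIV_subset subset_UNIV)
    from has_field_derivative_zero_constant[OF that(2) this] show ?thesis using that(3,4) by metis
  qed
  have "\<phi> x = 0" if "x \<notin> {a..b}" for x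
  proof (cases "x < a")
    case True
    then have "F x = F 0" using ab by (intro const[of "{..<a}"]) auto
    then show ?thesis by (simp add: \<phi>_def)
  next
    case False
    then have "F x = F l" using ab that by (intro const[of "{b<..}"]) auto
    then show ?thesis by (simp add: \<phi>_def ends)
  qed
  moreover have "\<phi> differentiable at x" for x
    using d real_differentiable_def by blast
  ultimately have "\<phi> \<in> test_functions l"
    using ab c \<open>deriv \<phi> = \<eta>\<close> by (auto simp: test_functions_def)
  then show ?thesis using that \<open>deriv \<phi> = \<eta>\<close> by blast
qed

lemma supported_bump:
  assumes "0 < \<delta>"
  shows "(\<lambda>x. max 0 (min (x - \<delta>) (l - \<delta> - x))) \<in> supported_functions l"
  unfolding supported_functions_def mem_Collect_eq
proof
  show "continuous_on UNIV (\<lambda>x. max 0 (min (x - \<delta>) (l - \<delta> - x)))" by (intro continuous_intros)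
  show "\<exists>a b. 0 < a \<and> b < l \<and> (\<forall>x. x \<notin> {a..b} \<longrightarrow> max 0 (min (x - \<delta>) (l - \<delta> - x)) = 0)"
    by (rule exI[of _ \<delta>], rule exI[of _ "l - \<delta>"]) (use assms in auto)
qed

text \<open>A function with vanishing weak derivative is constant, in the weak sense of its action on compactly supported
  functions: subtracting from \<open>\<psi>\<close> a multiple of a fixed bump \<open>\<beta>\<close> gives a mean-zero function, hence the
  derivative of a test function.\<close>

lemma du_Bois_Reymond:
  assumes l: "0 < l" and f: "set_integrable lborel {0<..<l} f"
    and zero: "\<And>\<phi>. \<phi> \<in> test_functions l \<Longrightarrow> (LINT x:{0<..<l}|lborel. f x * deriv \<phi> x) = 0"
  obtains c where "\<And>\<psi>. \<psi> \<in> supported_functions l \<Longrightarrow>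
    (LINT x:{0<..<l}|lborel. f x * \<psi> x) = c * (LINT x:{0<..<l}|lborel. \<psi> x)"
proof -
  define \<beta> where "\<beta> x = max 0 (min (x - l / 4) (l - l / 4 - x))" for x
  have \<beta>: "\<beta> \<in> supported_functions l" unfolding \<beta>_def[abs_def] using l by (intro supported_bump) auto
  define m where "m = (LINT x:{0<..<l}|lborel. \<beta> x)"
  have "m \<noteq> 0"
  proof
    assume "m = 0"
    have c: "continuous_on UNIV \<beta>" using \<beta> by (simp add: supported_functions_def)
    have "m = integral {0<..<l} \<beta>"
      unfolding m_def using supported_function_integrable[OF \<beta>] by (rule set_borel_integral_eq_integral)
    also have "\<dots> = integral {0..l} \<beta>"
      by (simp add: integral_open_interval_real[symmetric])
    finally have "integral {0..l} \<beta> = 0" using \<open>m = 0\<close> by simp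
    then have "\<forall>x\<in>{0..l}. \<beta> x = 0"
      using l continuous_on_subset[OF c, of "{0..l}"] by (subst (asm) integral_eq_0_iff) (auto simp: \<beta>_def)
    then have "\<beta> (l / 2) = 0" using l by simp
    then show False using l by (simp add: \<beta>_def)
  qed
  have "(LINT x:{0<..<l}|lborel. f x * \<psi> x) = (LINT x:{0<..<l}|lborel. f x * \<beta> x) / m * (LINT x:{0<..<l}|lborel. \<psi> x)"
    if \<psi>: "\<psi> \<in> supported_functions l" for \<psi>
  proof -
    define r where "r = (LINT x:{0<..<l}|lborel. \<psi> x) / m"
    define \<eta> where "\<eta> x = \<psi> x - r * \<beta> x" for x
    obtain a b a' b' where ab: "0 < a" "b < l" "\<And>x. x \<notin> {a..b} \<Longrightarrow> \<psi> x = 0"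
        "0 < a'" "b' < l" "\<And>x. x \<notin> {a'..b'} \<Longrightarrow> \<beta> x = 0"
      using \<psi> \<beta> by (auto simp: supported_functions_def)
    have c: "continuous_on UNIV \<psi>" "continuous_on UNIV \<beta>" using \<psi> \<beta> by (auto simp: supported_functions_def)
    have "\<eta> \<in> supported_functions l"
      unfolding supported_functions_def mem_Collect_eq
    proof
      show "continuous_on UNIV \<eta>" unfolding \<eta>_def[abs_def] by (intro continuous_intros c)
      have "\<eta> x = 0" if "x \<notin> {min a a'..max b b'}" for x
      proof -
        have "x \<notin> {a..b}" "x \<notin> {a'..b'}" using that by auto
        from ab(3)[OF this(1)] ab(6)[OF this(2)] show ?thesis by (simp add: \<eta>_def)
      qed
      then show "\<exists>a b. 0 < a \<and> b < l \<and> (\<forall>x. x \<notin> {a..b} \<longrightarrow> \<eta> x = 0)"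
        using ab by (rule_tac exI[of _ "min a a'"], rule_tac exI[of _ "max b b'"]) auto
    qed
    moreover have "(LINT x:{0<..<l}|lborel. \<eta> x) = 0"
      unfolding \<eta>_def using supported_function_integrable[OF \<psi>] supported_function_integrable[OF \<beta>] \<open>m \<noteq> 0\<close>
      by (subst set_integral_diff) (auto simp: m_def[symmetric] r_def)
    ultimately obtain \<phi> where \<phi>: "\<phi> \<in> test_functions l" "deriv \<phi> = \<eta>"
      using mean_zero_is_deriv_of_test_function[OF l] by blast
    have "0 = (LINT x:{0<..<l}|lborel. f x * \<psi> x - r * (f x * \<beta> x))"
      using zero[OF \<phi>(1)] unfolding \<phi>(2) \<eta>_def by (simp add: algebra_simps)
    also have "\<dots> = (LINT x:{0<..<l}|lborel. f x * \<psi> x) - r * (LINT x:{0<..<l}|lborel. f x * \<beta> x)"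
      using set_integrable_mult_continuous[OF f c(1)] set_integrable_mult_continuous[OF f c(2)]
      by (subst set_integral_diff) auto
    finally show ?thesis by (simp add: r_def)
  qed
  then show ?thesis using that by blast
qed

text \<open>Test against the product of \<open>f\<close> and a bump that is positive at the given point; the integrand is then
  nonnegative and continuous.\<close>

lemma continuous_zero_of_orthogonal:
  assumes l: "0 < l" and f: "continuous_on UNIV f"
    and zero: "\<And>\<psi>. \<psi> \<in> supported_functions l \<Longrightarrow> (LINT x:{0<..<l}|lborel. f x * \<psi> x) = 0"
    and x: "x \<in> {0..l}"
  shows "f x = 0"
proof -
  have inner: "f y = 0" if y: "y \<in> {0<..<l}" for y
  proof -
    define \<delta> where "\<delta> = min y (l - y) / 2"
    have \<delta>: "0 < \<delta>" "\<delta> < y" "y < l - \<delta>" using y by (auto simp: \<delta>_def min_def field_simps)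
    define \<beta> where "\<beta> x = max 0 (min (x - \<delta>) (l - \<delta> - x))" for x
    have \<beta>: "\<beta> \<in> supported_functions l" unfolding \<beta>_def[abs_def] using \<delta> by (intro supported_bump) auto
    then have c: "continuous_on UNIV \<beta>" by (simp add: supported_functions_def)
    have "(\<lambda>x. f x * \<beta> x) \<in> supported_functions l"
      using \<beta> f unfolding supported_functions_def
      by (auto intro!: continuous_on_mult)
    from zero[OF this] have "0 = (LINT x:{0<..<l}|lborel. (f x)\<^sup>2 * \<beta> x)"
      by (simp add: power2_eq_square mult.assoc)
    also have "\<dots> = integral {0<..<l} (\<lambda>x. (f x)\<^sup>2 * \<beta> x)"
      by (intro set_borel_integral_eq_integral set_integrable_continuous_open continuous_on_mult
          continuous_on_power continuous_on_subset[OF c] continuous_on_subset[OF f]) auto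
    also have "\<dots> = integral {0..l} (\<lambda>x. (f x)\<^sup>2 * \<beta> x)"
      by (simp add: integral_open_interval_real[symmetric])
    finally have "integral {0..l} (\<lambda>x. (f x)\<^sup>2 * \<beta> x) = 0" by simp
    then have "\<forall>x\<in>{0..l}. (f x)\<^sup>2 * \<beta> x = 0"
      using l by (subst (asm) integral_eq_0_iff)
        (auto simp: \<beta>_def intro!: continuous_on_mult continuous_on_power continuous_on_subset[OF f] continuous_intros)
    moreover have "\<beta> y \<noteq> 0" using \<delta> by (simp add: \<beta>_def)
    ultimately show "f y = 0" using y by (auto dest: bspec[of _ _ y])
  qed
  have "closure {0<..<l} = {0..l}" using l by simp
  moreover have "f constant_on closure {0<..<l}"
    using inner by (intro constant_on_closureI continuous_on_subset[OF f]) (auto simp: constant_on_def)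
  ultimately have "f x = f (l / 2)" using x l by (auto simp: constant_on_def)
  then show ?thesis using inner[of "l / 2"] l by simp
qed


lemma clamp_continuous_extension:
  fixes f :: "real \<Rightarrow> real"
  assumes "continuous_on {0..l} f" "0 \<le> l"
  obtains g where "continuous_on UNIV g" "\<And>x. x \<in> {0..l} \<Longrightarrow> g x = f x"
proof
  show "continuous_on UNIV (\<lambda>x. f (max 0 (min l x)))"
    using assms by (intro continuous_on_compose2[OF assms(1)] continuous_intros) auto
qed (use assms in auto)

lemma set_lebesgue_integral_cong_open:
  fixes f g :: "real \<Rightarrow> real"
  assumes "\<And>x. x \<in> {0<..<l} \<Longrightarrow> f x = g x"
  shows "(LINT x:{0<..<l}|lborel. f x) = (LINT x:{0<..<l}|lborel. g x)"
  by (rule set_lebesgue_integral_cong) (use assms in auto)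

text \<open>If \<open>H\<close> is an antiderivative of \<open>h\<close>, then \<open>g - H\<close> has vanishing weak derivative and acts on test functions
  like a constant \<open>c\<close>. Thus \<open>u\<close> has the continuous weak derivative \<open>H + c\<close>, and the same argument shows that
  \<open>u\<close> differs by a constant from an antiderivative of \<open>H + c\<close>.\<close>

lemma weak_deriv2_imp_classical:
  assumes l: "0 < l" and u: "continuous_on {0..l} u" and h: "continuous_on {0..l} h"
    and weak: "has_weak_deriv2 l u h"
  obtains v where "\<And>x. x \<in> {0..l} \<Longrightarrow> (u has_real_derivative v x) (at x within {0..l})"
    "\<And>x. x \<in> {0..l} \<Longrightarrow> (v has_real_derivative h x) (at x within {0..l})"
proof -
  obtain g where ug: "has_weak_deriv l u g" and gh: "has_weak_deriv l g h"
    using weak by (auto simp: has_weak_deriv2_def)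
  have g: "set_integrable lborel {0<..<l} g"
    using gh by (intro square_integrable_imp_integrable) (simp add: has_weak_deriv_def)
  obtain h' where h': "continuous_on UNIV h'" "\<And>x. x \<in> {0..l} \<Longrightarrow> h' x = h x"
    using clamp_continuous_extension[OF h] l by auto
  obtain u' where u': "continuous_on UNIV u'" "\<And>x. x \<in> {0..l} \<Longrightarrow> u' x = u x"
    using clamp_continuous_extension[OF u] l by auto
  obtain H where H: "\<And>x. (H has_real_derivative h' x) (at x)"
    using exists_antiderivative[OF h'(1)] by blast
  have cH: "continuous_on UNIV H" using H by (intro DERIV_continuous_on) auto
  have iH: "set_integrable lborel {0<..<l} H"
    by (intro set_integrable_continuous_open continuous_on_subset[OF cH]) auto
  have "(LINT x:{0<..<l}|lborel. (g x - H x) * deriv \<phi> x) = 0" if \<phi>: "\<phi> \<in> test_functions l" for \<phi>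
  proof -
    have "(LINT x:{0<..<l}|lborel. g x * deriv \<phi> x) = - (LINT x:{0<..<l}|lborel. h x * \<phi> x)"
      using gh \<phi> by (simp add: has_weak_deriv_def)
    also have "(LINT x:{0<..<l}|lborel. h x * \<phi> x) = (LINT x:{0<..<l}|lborel. h' x * \<phi> x)"
      by (intro set_lebesgue_integral_cong_open) (simp add: h')
    also have "- \<dots> = (LINT x:{0<..<l}|lborel. H x * deriv \<phi> x)"
      using integral_by_parts_test_function[OF l H h'(1) \<phi>] by simp
    finally have *: "(LINT x:{0<..<l}|lborel. g x * deriv \<phi> x) = (LINT x:{0<..<l}|lborel. H x * deriv \<phi> x)" .
    show ?thesis
      unfolding left_diff_distrib
      using set_integrable_mult_continuous[OF g test_functionD(2)[OF \<phi>]]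
        set_integrable_mult_continuous[OF iH test_functionD(2)[OF \<phi>]] *
      by (subst set_integral_diff) auto
  qed
  then obtain c where c: "\<And>\<psi>. \<psi> \<in> supported_functions l \<Longrightarrow>
      (LINT x:{0<..<l}|lborel. (g x - H x) * \<psi> x) = c * (LINT x:{0<..<l}|lborel. \<psi> x)"
    using du_Bois_Reymond[OF l set_integral_diff(1)[OF g iH]] by blast
  define v where "v x = H x + c" for x
  have cv: "continuous_on UNIV v" unfolding v_def[abs_def] by (intro continuous_intros cH)
  obtain W where W: "\<And>x. (W has_real_derivative v x) (at x)"
    using exists_antiderivative[OF cv] by blast
  have cW: "continuous_on UNIV W" using W by (intro DERIV_continuous_on) auto
  have gv: "(LINT x:{0<..<l}|lborel. g x * \<phi> x) = (LINT x:{0<..<l}|lborel. v x * \<phi> x)"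
    if \<phi>: "\<phi> \<in> test_functions l" for \<phi>
  proof -
    have s: "\<phi> \<in> supported_functions l" by (rule test_function_supported[OF \<phi>])
    note ig = set_integrable_mult_continuous[OF g test_functionD(3)[OF \<phi>]]
    note iH = set_integrable_mult_continuous[OF iH test_functionD(3)[OF \<phi>]]
    have "(LINT x:{0<..<l}|lborel. v x * \<phi> x) = (LINT x:{0<..<l}|lborel. H x * \<phi> x) + c * (LINT x:{0<..<l}|lborel. \<phi> x)"
      unfolding v_def distrib_right using iH supported_function_integrable[OF s]
      by (subst set_integral_add) auto
    also have "c * (LINT x:{0<..<l}|lborel. \<phi> x) = (LINT x:{0<..<l}|lborel. g x * \<phi> x - H x * \<phi> x)"
      using c[OF s] by (simp add: left_diff_distrib)
    also have "\<dots> = (LINT x:{0<..<l}|lborel. g x * \<phi> x) - (LINT x:{0<..<l}|lborel. H x * \<phi> x)"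
      by (rule set_integral_diff(2)[OF ig iH])
    finally show ?thesis by simp
  qed
  have "continuous_on UNIV (\<lambda>x. u' x - W x)" by (intro continuous_intros u' cW)
  then have iW: "set_integrable lborel {0<..<l} (\<lambda>x. u' x - W x)"
    by (intro set_integrable_continuous_open) (auto elim: continuous_on_subset)
  have "(LINT x:{0<..<l}|lborel. (u' x - W x) * deriv \<phi> x) = 0" if \<phi>: "\<phi> \<in> test_functions l" for \<phi>
  proof -
    have "(LINT x:{0<..<l}|lborel. u' x * deriv \<phi> x) = (LINT x:{0<..<l}|lborel. u x * deriv \<phi> x)"
      by (intro set_lebesgue_integral_cong_open) (simp add: u')
    also have "\<dots> = - (LINT x:{0<..<l}|lborel. g x * \<phi> x)"
      using ug \<phi> by (simp add: has_weak_deriv_def)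
    also have "\<dots> = (LINT x:{0<..<l}|lborel. W x * deriv \<phi> x)"
      using integral_by_parts_test_function[OF l W cv \<phi>] gv[OF \<phi>] by simp
    finally have *: "(LINT x:{0<..<l}|lborel. u' x * deriv \<phi> x) = (LINT x:{0<..<l}|lborel. W x * deriv \<phi> x)" .
    have "set_integrable lborel {0<..<l} (\<lambda>x. u' x * deriv \<phi> x)"
         "set_integrable lborel {0<..<l} (\<lambda>x. W x * deriv \<phi> x)"
      using u'(1) cW test_functionD(2)[OF \<phi>]
      by (auto intro!: set_integrable_continuous_open continuous_on_mult elim: continuous_on_subset)
    then show ?thesis
      unfolding left_diff_distrib using * by (subst set_integral_diff) auto
  qed
  from du_Bois_Reymond[OF l iW this] obtain c' where c': "\<And>\<psi>. \<psi> \<in> supported_functions l \<Longrightarrow>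
      (LINT x:{0<..<l}|lborel. (u' x - W x) * \<psi> x) = c' * (LINT x:{0<..<l}|lborel. \<psi> x)"
    by blast
  have "u' x - W x - c' = 0" if "x \<in> {0..l}" for x
  proof (rule continuous_zero_of_orthogonal[OF l _ _ that])
    show "continuous_on UNIV (\<lambda>x. u' x - W x - c')" by (intro continuous_intros u' cW)
    fix \<psi> assume \<psi>: "\<psi> \<in> supported_functions l"
    then have "continuous_on UNIV \<psi>" by (simp add: supported_functions_def)
    from set_integrable_mult_continuous[OF iW this] show "(LINT x:{0<..<l}|lborel. (u' x - W x - c') * \<psi> x) = 0"
      unfolding left_diff_distrib[of _ c'] using supported_function_integrable[OF \<psi>] c'[OF \<psi>]
      by (subst set_integral_diff) auto
  qed
  then have uW: "u x = W x + c'" if "x \<in> {0..l}" for x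
    using u'(2)[OF that] that by force
  show ?thesis
  proof (rule that[of v])
    fix x assume x: "x \<in> {0..l}"
    have "((\<lambda>x. W x + c') has_real_derivative v x) (at x within {0..l})"
      by (auto intro!: derivative_eq_intros DERIV_subset[OF W])
    then show "(u has_real_derivative v x) (at x within {0..l})"
      by (rule has_field_derivative_transform_within[OF _ zero_less_one x]) (simp add: uW)
    show "(v has_real_derivative h x) (at x within {0..l})"
      unfolding v_def[abs_def] using h'(2)[OF x]
      by (auto intro!: derivative_eq_intros DERIV_subset[OF H])
  qed
qed

text \<open>With \<open>v e\<close> the derivative on the edge \<open>e\<close>, this is the sum of normal derivatives in the vertex condition.\<close>

definition vertex_slope :: "('v, 'e) metric_graph \<Rightarrow> ('e \<Rightarrow> real \<Rightarrow> real) \<Rightarrow> 'v \<Rightarrow> real" where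
  "vertex_slope G v w = (\<Sum>e\<in>{e\<in>edges G. init_vert G e = w}. v e 0) +
     (\<Sum>e\<in>{e\<in>edges G. term_vert G e = w}. - v e (len G e))"

text \<open>Every edge is counted once at its initial and once at its terminal vertex.\<close>

lemma sum_vertex_slope:
  assumes G: "compact_metric_graph G"
  shows "(\<Sum>w\<in>verts G. c w * vertex_slope G v w) =
    (\<Sum>e\<in>edges G. c (init_vert G e) * v e 0 - c (term_vert G e) * v e (len G e))"
proof -
  have fin: "finite (verts G)" "finite (edges G)"
    and ends: "init_vert G ` edges G \<subseteq> verts G" "term_vert G ` edges G \<subseteq> verts G"
    using G by (auto simp: compact_metric_graph_def)
  have "(\<Sum>w\<in>verts G. c w * vertex_slope G v w) =
      (\<Sum>w\<in>verts G. \<Sum>e\<in>{e\<in>edges G. init_vert G e = w}. c (init_vert G e) * v e 0) +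
      (\<Sum>w\<in>verts G. \<Sum>e\<in>{e\<in>edges G. term_vert G e = w}. - (c (term_vert G e) * v e (len G e)))"
    unfolding vertex_slope_def distrib_left sum.distrib sum_distrib_left
    by (intro arg_cong2[where f="(+)"] sum.cong) auto
  also have "\<dots> = (\<Sum>e\<in>edges G. c (init_vert G e) * v e 0) + (\<Sum>e\<in>edges G. - (c (term_vert G e) * v e (len G e)))"
    by (simp only: sum.group[OF fin(2,1) ends(1)] sum.group[OF fin(2,1) ends(2)])
  finally show ?thesis by (simp add: sum.distrib[symmetric])
qed

text \<open>On each edge \<open>u u'\<close> has derivative \<open>(u')\<^sup>2 - \<mu> u\<^sup>2\<close>, which is nonnegative if \<open>\<mu> < 0\<close>. By the vertex conditions
  the total increase of \<open>u u'\<close> over all edges is 0. So \<open>u u'\<close> is constant on each edge, its derivative is 0,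
  and \<open>u\<close> vanishes.\<close>

lemma eigenvalue_nonneg:
  assumes G: "compact_metric_graph G" and u: "u \<in> laplacian_eigenspace G \<mu>"
    and nz: "e\<^sub>0 \<in> edges G" "x\<^sub>0 \<in> {0..len G e\<^sub>0}" "u e\<^sub>0 x\<^sub>0 \<noteq> 0"
  shows "0 \<le> \<mu>"
proof (rule ccontr)
  assume "\<not> 0 \<le> \<mu>"
  then have \<mu>: "\<mu> < 0" by simp
  have len: "0 < len G e" if "e \<in> edges G" for e
    using G that by (simp add: compact_metric_graph_def)
  have cont: "continuous_on {0..len G e} (u e)" if "e \<in> edges G" for e
    using u that by (auto simp: laplacian_eigenspace_def laplacian_domain_def)
  have "\<exists>v. \<forall>x\<in>{0..len G e}. (u e has_real_derivative v x) (at x within {0..len G e}) \<and>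
      (v has_real_derivative - \<mu> * u e x) (at x within {0..len G e})" if e: "e \<in> edges G" for e
  proof -
    have "has_weak_deriv2 (len G e) (u e) (\<lambda>x. - \<mu> * u e x)"
      using u e by (simp add: laplacian_eigenspace_def)
    moreover have "continuous_on {0..len G e} (\<lambda>x. - \<mu> * u e x)" by (intro continuous_intros cont e)
    ultimately show ?thesis
      using weak_deriv2_imp_classical[OF len[OF e] cont[OF e]] by metis
  qed
  then obtain v where v: "\<And>e x. e \<in> edges G \<Longrightarrow> x \<in> {0..len G e} \<Longrightarrow> (u e has_real_derivative v e x) (at x within {0..len G e})"
      "\<And>e x. e \<in> edges G \<Longrightarrow> x \<in> {0..len G e} \<Longrightarrow> (v e has_real_derivative - \<mu> * u e x) (at x within {0..len G e})"
    by metis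
  define w where "w e x = u e x * v e x" for e x
  have w: "(w e has_real_derivative (v e x)\<^sup>2 - \<mu> * (u e x)\<^sup>2) (at x within {0..len G e})"
    if "e \<in> edges G" "x \<in> {0..len G e}" for e x
    unfolding w_def[abs_def]
    using DERIV_mult[OF v(1)[OF that] v(2)[OF that]] by (simp add: power2_eq_square algebra_simps)
  have nonneg: "0 \<le> (v e x)\<^sup>2 - \<mu> * (u e x)\<^sup>2" for e x
    using \<mu> mult_nonpos_nonneg[of \<mu> "(u e x)\<^sup>2"] zero_le_power2[of "v e x"] zero_le_power2[of "u e x"]
    by linarith
  have mono: "w e x \<le> w e y" if "e \<in> edges G" "0 \<le> x" "x \<le> y" "y \<le> len G e" for e x y
  proof (rule DERIV_nonneg_imp_increasing_open[OF \<open>x \<le> y\<close>])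
    fix z assume "x < z" "z < y"
    then have "z \<in> interior {0..len G e}" "z \<in> {0..len G e}" using that by auto
    then show "\<exists>d. (w e has_real_derivative d) (at z) \<and> 0 \<le> d"
      using w[OF \<open>e \<in> edges G\<close>, of z] nonneg by (metis at_within_interior)
  next
    have "continuous_on {0..len G e} (w e)" using w[OF \<open>e \<in> edges G\<close>] by (intro DERIV_continuous_on) auto
    then show "continuous_on {x..y} (w e)" using that by (elim continuous_on_subset) auto
  qed
  obtain c where c: "\<And>e. e \<in> edges G \<Longrightarrow> u e 0 = c (init_vert G e) \<and> u e (len G e) = c (term_vert G e)"
    using u by (auto simp: laplacian_eigenspace_def laplacian_domain_def)
  have "vertex_slope G v x = 0" if "x \<in> verts G" for x
  proof -
    have "vector_derivative (u e) (at y within {0..len G e}) = v e y" if "e \<in> edges G" "y \<in> {0..len G e}" for e y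
      using v(1)[OF that] len[OF that(1)] that(2)
      by (intro vector_derivative_within_closed_interval) (auto simp: has_real_derivative_iff_has_vector_derivative)
    note vd = this
    have "vertex_slope G v x = (\<Sum>e\<in>{e\<in>edges G. init_vert G e = x}.
            vector_derivative (u e) (at 0 within {0..len G e})) +
        (\<Sum>e\<in>{e\<in>edges G. term_vert G e = x}.
            - vector_derivative (u e) (at (len G e) within {0..len G e}))"
      unfolding vertex_slope_def using len
      by (intro arg_cong2[where f="(+)"] sum.cong refl; force simp: vd)
    also have "\<dots> = 0" using u that by (simp add: laplacian_eigenspace_def laplacian_domain_def)
    finally show ?thesis .
  qed
  then have "0 = (\<Sum>x\<in>verts G. c x * vertex_slope G v x)" by simp
  also have "\<dots> = (\<Sum>e\<in>edges G. w e 0 - w e (len G e))"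
    unfolding sum_vertex_slope[OF G] using c by (intro sum.cong) (auto simp: w_def)
  finally have "(\<Sum>e\<in>edges G. w e (len G e) - w e 0) = 0"
    by (simp add: sum_subtractf)
  moreover have "0 \<le> w e (len G e) - w e 0" if "e \<in> edges G" for e
    using mono[OF that, of 0 "len G e"] len[OF that] by simp
  ultimately have "w e\<^sub>0 (len G e\<^sub>0) - w e\<^sub>0 0 = 0"
    using nz(1) G by (subst (asm) sum_nonneg_eq_0_iff) (auto simp: compact_metric_graph_def)
  then have const: "w e\<^sub>0 x = w e\<^sub>0 0" if "x \<in> {0..len G e\<^sub>0}" for x
    using mono[OF nz(1), of 0 x] mono[OF nz(1), of x "len G e\<^sub>0"] that by auto
  have "((\<lambda>_. w e\<^sub>0 0) has_real_derivative (v e\<^sub>0 x\<^sub>0)\<^sup>2 - \<mu> * (u e\<^sub>0 x\<^sub>0)\<^sup>2) (at x\<^sub>0 within {0..len G e\<^sub>0})"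
    by (rule has_field_derivative_transform_within[OF w[OF nz(1,2)] zero_less_one nz(2)]) (rule const)
  then have "(v e\<^sub>0 x\<^sub>0)\<^sup>2 - \<mu> * (u e\<^sub>0 x\<^sub>0)\<^sup>2 = 0"
    using vector_derivative_within_closed_interval[OF len[OF nz(1)] nz(2), of "\<lambda>_. w e\<^sub>0 0" 0]
      vector_derivative_within_closed_interval[OF len[OF nz(1)] nz(2), of "\<lambda>_. w e\<^sub>0 0"]
    unfolding has_real_derivative_iff_has_vector_derivative by simp
  moreover have "0 < - \<mu> * (u e\<^sub>0 x\<^sub>0)\<^sup>2" using \<mu> nz(3) by (intro mult_pos_pos) auto
  moreover have "0 \<le> (v e\<^sub>0 x\<^sub>0)\<^sup>2" by simp
  ultimately show False by linarith
qed

section \<open>From singular parameters to eigenfunctions\<close>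

lemma sinusoid_laplacian_eigenspace:
  assumes G: "compact_metric_graph G"
    and ends: "\<And>e. e \<in> edges G \<Longrightarrow> sinusoid k (\<alpha> e) (\<beta> e) 0 = c (init_vert G e)"
      "\<And>e. e \<in> edges G \<Longrightarrow> sinusoid k (\<alpha> e) (\<beta> e) (len G e) = c (term_vert G e)"
    and slopes: "\<And>w. w \<in> verts G \<Longrightarrow> vertex_slope G (\<lambda>e. sinusoid k (k * \<beta> e) (- (k * \<alpha> e))) w = 0"
  shows "(\<lambda>e. sinusoid k (\<alpha> e) (\<beta> e)) \<in> laplacian_eigenspace G (k\<^sup>2)"
proof -
  define v where "v e = sinusoid k (k * \<beta> e) (- (k * \<alpha> e))" for e
  have len: "0 < len G e" if "e \<in> edges G" for e
    using G that by (simp add: compact_metric_graph_def)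
  have weak: "has_weak_deriv2 (len G e) (sinusoid k (\<alpha> e) (\<beta> e)) (\<lambda>x. - k\<^sup>2 * sinusoid k (\<alpha> e) (\<beta> e) x)"
    if "e \<in> edges G" for e
  proof -
    have "sinusoid k (k * - (k * \<alpha> e)) (- (k * (k * \<beta> e))) = (\<lambda>x. - k\<^sup>2 * sinusoid k (\<alpha> e) (\<beta> e) x)"
      by (auto simp: sinusoid_def power2_eq_square algebra_simps)
    then have "has_weak_deriv (len G e) (v e) (\<lambda>x. - k\<^sup>2 * sinusoid k (\<alpha> e) (\<beta> e) x)"
      unfolding v_def
      by (metis has_weak_deriv_classical[OF len[OF that] sinusoid_has_derivative continuous_on_sinusoid])
    moreover have "has_weak_deriv (len G e) (sinusoid k (\<alpha> e) (\<beta> e)) (v e)"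
      unfolding v_def
      by (rule has_weak_deriv_classical[OF len[OF that] sinusoid_has_derivative continuous_on_sinusoid])
    ultimately show ?thesis unfolding has_weak_deriv2_def by blast
  qed
  have vd: "vector_derivative (sinusoid k (\<alpha> e) (\<beta> e)) (at y within {0..len G e}) = v e y"
    if "e \<in> edges G" "y \<in> {0..len G e}" for e y
    using len[OF that(1)] that(2) sinusoid_has_derivative[of k "\<alpha> e" "\<beta> e" y "{0..len G e}"]
    by (intro vector_derivative_within_closed_interval)
       (auto simp: has_real_derivative_iff_has_vector_derivative v_def)
  have "(\<Sum>e\<in>{e\<in>edges G. init_vert G e = w}.
            vector_derivative (sinusoid k (\<alpha> e) (\<beta> e)) (at 0 within {0..len G e})) +
        (\<Sum>e\<in>{e\<in>edges G. term_vert G e = w}.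
            - vector_derivative (sinusoid k (\<alpha> e) (\<beta> e)) (at (len G e) within {0..len G e})) = 0"
    if "w \<in> verts G" for w
  proof -
    have "?thesis \<longleftrightarrow> vertex_slope G v w = 0"
      unfolding vertex_slope_def using len
      by (intro arg_cong2[where f="(=)"] arg_cong2[where f="(+)"] sum.cong refl; force simp: vd)
    then show ?thesis using slopes[OF that] by (simp add: v_def[abs_def])
  qed
  then show ?thesis
    unfolding laplacian_eigenspace_def laplacian_domain_def H2_def
    using weak ends by (auto intro!: exI[of _ c] continuous_on_sinusoid)
qed

lemma constant_laplacian_eigenspace:
  assumes G: "compact_metric_graph G"
  shows "(\<lambda>e. sinusoid 0 1 0) \<in> laplacian_eigenspace G 0"
  using sinusoid_laplacian_eigenspace[OF G, of 0 "\<lambda>_. 1" "\<lambda>_. 0" "\<lambda>_. 1"]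
  by (simp add: sinusoid_def vertex_slope_def)

text \<open>Two linearly independent eigenfunctions are the constant 1 and \<open>u\<close>. The infimum in the definition of the
  eigenvalue is over a set of reals, which must also be bounded below.\<close>

lemma second_eigenvalue_le:
  assumes G: "compact_metric_graph G" and "0 \<le> \<nu>"
    and u: "u \<in> laplacian_eigenspace G \<nu>"
    and nonconst: "\<not> (\<exists>t. \<forall>e\<in>edges G. \<forall>y\<in>{0..len G e}. u e y = t)"
  shows "laplacian_eigenvalue G 2 \<le> \<nu>"
  unfolding laplacian_eigenvalue_def
proof (rule cInf_lower)
  define us where "us i = (if i = 0 then (\<lambda>e. sinusoid 0 1 0) else u)" for i :: nat
  define \<mu> where "\<mu> i = (if i = 0 then 0 else \<nu>)" for i :: nat
  have "lin_indep_on_graph G 2 us"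
    unfolding lin_indep_on_graph_def
  proof (intro allI impI)
    fix c :: "nat \<Rightarrow> real" and i :: nat
    assume "\<forall>e\<in>edges G. \<forall>x\<in>{0..len G e}. (\<Sum>i<2. c i * us i e x) = 0" and "i < 2"
    then have c: "\<forall>e\<in>edges G. \<forall>x\<in>{0..len G e}. c 0 + c 1 * u e x = 0"
      by (simp add: us_def sinusoid_def numeral_2_eq_2)
    have "c 1 = 0"
    proof (rule ccontr)
      assume "c 1 \<noteq> 0"
      then have "\<forall>e\<in>edges G. \<forall>y\<in>{0..len G e}. u e y = - c 0 / c 1"
        using c by (auto simp: field_simps add_eq_0_iff)
      then show False using nonconst by blast
    qed
    moreover obtain e y where "e \<in> edges G" "y \<in> {0..len G e}" using nonconst by blast
    ultimately have "c 0 = 0" using c by auto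
    then show "c i = 0" using \<open>c 1 = 0\<close> \<open>i < 2\<close> by (auto simp: less_2_cases_iff)
  qed
  moreover have "\<forall>i<2. \<mu> i \<le> \<nu> \<and> us i \<in> laplacian_eigenspace G (\<mu> i)"
    using u \<open>0 \<le> \<nu>\<close> constant_laplacian_eigenspace[OF G] by (auto simp: \<mu>_def us_def)
  ultimately show "\<nu> \<in> {t. \<exists>\<mu> u. (\<forall>i<2. \<mu> i \<le> t \<and> u i \<in> laplacian_eigenspace G (\<mu> i)) \<and> lin_indep_on_graph G 2 u}"
    by blast
  show "bdd_below {t. \<exists>\<mu> u. (\<forall>i<2. \<mu> i \<le> t \<and> u i \<in> laplacian_eigenspace G (\<mu> i)) \<and> lin_indep_on_graph G 2 u}"
  proof (rule bdd_belowI[of _ 0], clarify)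
    fix t \<mu> and u :: "nat \<Rightarrow> 'b \<Rightarrow> real \<Rightarrow> real"
    assume u: "\<forall>i<2. \<mu> i \<le> t \<and> u i \<in> laplacian_eigenspace G (\<mu> i)" and ind: "lin_indep_on_graph G 2 u"
    have "\<exists>e\<in>edges G. \<exists>x\<in>{0..len G e}. u 0 e x \<noteq> 0"
    proof (rule ccontr)
      assume "\<not> ?thesis"
      then have "\<forall>e\<in>edges G. \<forall>x\<in>{0..len G e}. (\<Sum>i<2. of_bool (i = 0) * u i e x) = 0"
        by (simp add: numeral_2_eq_2)
      then have "of_bool (0 = (0::nat)) = (0::real)"
        using ind[unfolded lin_indep_on_graph_def, rule_format, of "\<lambda>i. of_bool (i = 0)" 0] by auto
      then show False by simp
    qed
    then have "0 \<le> \<mu> 0" using eigenvalue_nonneg[OF G, of "u 0" "\<mu> 0"] u by auto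
    then show "0 \<le> t" using u[rule_format, of 0] by simp
  qed
qed

text \<open>Differentiating twice multiplies by \<open>- k\<^sup>2\<close>.\<close>

lemma sinusoid_constant_imp_zero:
  assumes "0 < k" "0 < l" and const: "\<And>y. y \<in> {0..l} \<Longrightarrow> sinusoid k \<alpha> \<beta> y = t"
  shows "t = 0"
proof -
  have deriv_zero: "sinusoid k (k * \<beta>) (- (k * \<alpha>)) y = 0"
    if "\<And>y. y \<in> {0<..<l} \<Longrightarrow> sinusoid k \<alpha> \<beta> y = t" "y \<in> {0<..<l}" for \<alpha> \<beta> t y
  proof -
    have "((\<lambda>_. t) has_real_derivative sinusoid k (k * \<beta>) (- (k * \<alpha>)) y) (at y)"
      by (rule has_field_derivative_transform_within_open[OF sinusoid_has_derivative _ that(2)]) (auto simp: that(1))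
    then show ?thesis using DERIV_unique[OF _ DERIV_const] by blast
  qed
  have "sinusoid k (k * \<beta>) (- (k * \<alpha>)) y = 0" if "y \<in> {0<..<l}" for y
    using that const by (intro deriv_zero[of \<alpha> \<beta> t]) auto
  then have "sinusoid k (k * - (k * \<alpha>)) (- (k * (k * \<beta>))) (l / 2) = 0"
    using \<open>0 < l\<close> by (rule_tac deriv_zero[of "k * \<beta>" "- (k * \<alpha>)" 0]) auto
  then have "k * (k * sinusoid k \<alpha> \<beta> (l / 2)) = 0"
    by (simp add: sinusoid_def algebra_simps)
  then show ?thesis using assms(1,2) const[of "l / 2"] by simp
qed

text \<open>A graph whose edges are cut at the points \<open>x e 0, ..., x e n\<close>. The mesh condition guarantees that no piece
  has a Dirichlet eigenvalue in \<open>{0..K\<^sup>2}\<close>, so a solution on a piece is determined by its end values. The number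
  of pieces is the same for all edges only to keep the index set a product.\<close>

locale subdivided_graph =
  fixes G :: "('v, 'e) metric_graph" and x :: "'e \<Rightarrow> nat \<Rightarrow> real" and n :: nat and K :: real
  assumes graph: "compact_metric_graph G" and edges_nonempty: "edges G \<noteq> {}"
    and n_pos: "0 < n" and K_pos: "0 < K"
    and x_zero: "\<And>e. e \<in> edges G \<Longrightarrow> x e 0 = 0"
    and x_n: "\<And>e. e \<in> edges G \<Longrightarrow> x e n = len G e"
    and x_less: "\<And>e j. e \<in> edges G \<Longrightarrow> j < n \<Longrightarrow> x e j < x e (Suc j)"
    and mesh: "\<And>e j. e \<in> edges G \<Longrightarrow> j < n \<Longrightarrow> K * (x e (Suc j) - x e j) < pi"
    and vertex_connected: "\<And>A w. A \<subseteq> verts G \<Longrightarrow> A \<noteq> {} \<Longrightarrow>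
      \<forall>e\<in>edges G. init_vert G e \<in> A \<longleftrightarrow> term_vert G e \<in> A \<Longrightarrow> A = verts G"
begin

definition node :: "'e \<Rightarrow> nat \<Rightarrow> ('v, 'e) graph_point" where
  "node e j = edge_map G e (x e j)"

abbreviation pieces :: "('e \<times> nat) set" where "pieces \<equiv> edges G \<times> {..<n}"

abbreviation width :: "'e \<Rightarrow> nat \<Rightarrow> real" where "width e j \<equiv> x e (Suc j) - x e j"

lemma x_strict_mono: "e \<in> edges G \<Longrightarrow> i < j \<Longrightarrow> j \<le> n \<Longrightarrow> x e i < x e j"
proof (induction j)
  case (Suc j)
  then show ?case using x_less[of e j] by (cases "i = j") (auto intro: less_trans)
qed simp

lemma node_eq:
  assumes "e \<in> edges G" "j \<le> n"
  shows "node e j = (if j = 0 then Vertex (init_vert G e) else if j = n then Vertex (term_vert G e)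
     else Inner e (x e j))"
proof -
  have "0 < len G e" using graph assms by (simp add: compact_metric_graph_def)
  moreover have "j \<noteq> 0 \<longrightarrow> 0 < x e j" "j \<noteq> n \<longrightarrow> x e j < len G e"
    using x_strict_mono[OF assms(1), of 0 j] x_strict_mono[OF assms(1), of j n] assms x_zero x_n by auto
  ultimately show ?thesis
    using assms x_zero x_n by (auto simp: node_def edge_map_def)
qed

lemma node_inner_eq:
  assumes "e \<in> edges G" "0 < j" "j < n" "e' \<in> edges G" "i \<le> n"
  shows "node e' i = Inner e (x e j) \<longleftrightarrow> e' = e \<and> i = j"
proof -
  have "i = j" if "x e i = x e j"
    using assms that x_strict_mono[of e i j] x_strict_mono[of e j i] by (cases i j rule: linorder_cases) auto
  then show ?thesis using assms by (auto simp: node_eq)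
qed

sublocale pencil: edge_pencil pieces "\<lambda>(e, j). node e j" "\<lambda>(e, j). node e (Suc j)"
  "\<lambda>(e, j). stiffness (width e j)" "\<lambda>(e, j). lump (width e j)" K
proof
  show "finite pieces" using graph by (simp add: compact_metric_graph_def)
  show "pieces \<noteq> {}" using edges_nonempty n_pos by auto
  show "0 < K" by (rule K_pos)
  fix z assume z: "z \<in> pieces"
  then obtain e j where ej: "z = (e, j)" "e \<in> edges G" "j < n" by auto
  have w: "0 < width e j" "K * width e j < pi" using x_less mesh ej by auto
  show "continuous_on {0..K} ((\<lambda>(e, j). stiffness (width e j)) z)"
    using continuous_on_stiffness[OF w] by (simp add: ej)
  show "continuous_on {0..K} ((\<lambda>(e, j). lump (width e j)) z)"
    using continuous_on_lump[OF w] by (simp add: ej)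
  show "0 < (\<lambda>(e, j). stiffness (width e j)) z 0"
    using w by (simp add: ej stiffness_zero)
  fix k assume "0 \<le> k" "k \<le> K"
  then show "0 < (\<lambda>(e, j). lump (width e j)) z k"
    using w lump_pos[of "width e j" k] order.strict_trans1[OF mult_right_mono w(2)] by (simp add: ej)
next
  fix c :: "('v, 'e) graph_point \<Rightarrow> real"
  assume c: "\<forall>z\<in>pieces. c ((\<lambda>(e, j). node e j) z) = c ((\<lambda>(e, j). node e (Suc j)) z)"
  have along: "c (node e j) = c (node e 0)" if "e \<in> edges G" "j \<le> n" for e j
    using that(2)
  proof (induction j)
    case (Suc j)
    then show ?case using c that(1) by force
  qed simp
  obtain e\<^sub>0 where e0: "e\<^sub>0 \<in> edges G" using edges_nonempty by auto
  define A where "A = {w\<in>verts G. c (Vertex w) = c (node e\<^sub>0 0)}"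
  have ends: "node e 0 = Vertex (init_vert G e)" "node e n = Vertex (term_vert G e)" if "e \<in> edges G" for e
    using node_eq[OF that] n_pos by auto
  have V: "init_vert G e \<in> verts G" "term_vert G e \<in> verts G" if "e \<in> edges G" for e
    using graph that by (auto simp: compact_metric_graph_def)
  have "A = verts G"
  proof (rule vertex_connected)
    show "A \<noteq> {}" using e0 ends V by (force simp: A_def)
    show "\<forall>e\<in>edges G. init_vert G e \<in> A \<longleftrightarrow> term_vert G e \<in> A"
      using along[of _ n] ends V by (simp add: A_def)
  qed (auto simp: A_def)
  then have "c (node e 0) = c (node e\<^sub>0 0)" if "e \<in> edges G" for e
    using V[OF that] ends[OF that] by (auto simp: A_def)
  then have "c (node e j) = c (node e\<^sub>0 0)" if "e \<in> edges G" "j \<le> n" for e j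
    using along[OF that] that by simp
  then show "\<exists>t. \<forall>i\<in>(\<lambda>(e, j). node e j) ` pieces \<union> (\<lambda>(e, j). node e (Suc j)) ` pieces. c i = t"
    by (intro exI[of _ "c (node e\<^sub>0 0)"]) auto
qed

text \<open>The form is minus the sum of all slopes weighted by the values of \<open>d\<close>, hence an indicator function \<open>d\<close>
  extracts the slopes at a single node.\<close>

lemma form_eq_slopes:
  assumes "0 < k" "k < K"
  shows "pencil.form k c d = - (\<Sum>(e, j)\<in>pieces.
     out_slope k (width e j) (c (node e j)) (c (node e (Suc j))) * d (node e j) +
     out_slope k (width e j) (c (node e (Suc j))) (c (node e j)) * d (node e (Suc j)))"
  unfolding pencil.form_def sum_negf[symmetric]
proof (rule sum.cong[OF refl])
  fix z assume "z \<in> pieces"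
  then obtain e j where ej: "z = (e, j)" "e \<in> edges G" "j < n" by auto
  have w: "0 < width e j" "K * width e j < pi" using x_less mesh ej by auto
  then have "k * width e j < pi" using order.strict_trans1[OF mult_right_mono w(2), of k] assms by auto
  from interval_form_eq_slopes[OF w(1) assms(1) this]
  show "(case z of (e, j) \<Rightarrow> stiffness (width e j)) k *
      ((c (case z of (e, j) \<Rightarrow> node e j) - c (case z of (e, j) \<Rightarrow> node e (Suc j))) *
       (d (case z of (e, j) \<Rightarrow> node e j) - d (case z of (e, j) \<Rightarrow> node e (Suc j)))) -
      k\<^sup>2 * ((case z of (e, j) \<Rightarrow> lump (width e j)) k *
      ((c (case z of (e, j) \<Rightarrow> node e j) + c (case z of (e, j) \<Rightarrow> node e (Suc j))) *
       (d (case z of (e, j) \<Rightarrow> node e j) + d (case z of (e, j) \<Rightarrow> node e (Suc j))))) =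
      - (case z of (e, j) \<Rightarrow> out_slope k (width e j) (c (node e j)) (c (node e (Suc j))) * d (node e j) +
     out_slope k (width e j) (c (node e (Suc j))) (c (node e j)) * d (node e (Suc j)))"
    by (simp add: ej)
qed

text \<open>Testing with the indicator of an interior node leaves the slopes on the two pieces that meet there.\<close>

lemma kernel_balance:
  assumes "0 < k" "k < K" and ker: "\<And>d. pencil.form k c d = 0" and e: "e \<in> edges G" and j: "Suc j < n"
  shows "out_slope k (width e j) (c (node e (Suc j))) (c (node e j)) +
      out_slope k (width e (Suc j)) (c (node e (Suc j))) (c (node e (Suc (Suc j)))) = 0"
proof -
  define L where "L = (\<lambda>(e, j). out_slope k (width e j) (c (node e j)) (c (node e (Suc j))))"
  define R where "R = (\<lambda>(e, j). out_slope k (width e j) (c (node e (Suc j))) (c (node e j)))"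
  define d :: "('v, 'e) graph_point \<Rightarrow> real" where "d i = of_bool (i = Inner e (x e (Suc j)))" for i
  have fin: "finite pieces" using graph by (simp add: compact_metric_graph_def)
  have "0 = (\<Sum>(e, j)\<in>pieces.
     out_slope k (width e j) (c (node e j)) (c (node e (Suc j))) * d (node e j) +
     out_slope k (width e j) (c (node e (Suc j))) (c (node e j)) * d (node e (Suc j)))"
    using form_eq_slopes[OF assms(1,2), of c d] ker[of d] by simp
  also have "\<dots> = (\<Sum>z\<in>pieces. (if z = (e, Suc j) then L z else 0) + (if z = (e, j) then R z else 0))"
  proof (rule sum.cong[OF refl])
    fix z assume "z \<in> pieces"
    then obtain e' i where z: "z = (e', i)" "e' \<in> edges G" "i < n" by auto
    have "d (node e' i) = of_bool (e' = e \<and> i = Suc j)" "d (node e' (Suc i)) = of_bool (e' = e \<and> i = j)"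
      using node_inner_eq[OF e _ j z(2), of i] node_inner_eq[OF e _ j z(2), of "Suc i"] z(3) by (auto simp: d_def)
    then show "(case z of (e, j) \<Rightarrow>
        out_slope k (width e j) (c (node e j)) (c (node e (Suc j))) * d (node e j) +
        out_slope k (width e j) (c (node e (Suc j))) (c (node e j)) * d (node e (Suc j))) =
        (if z = (e, Suc j) then L z else 0) + (if z = (e, j) then R z else 0)"
      by (auto simp: z L_def R_def)
  qed
  also have "\<dots> = L (e, Suc j) + R (e, j)"
    unfolding sum.distrib using fin e j by (simp add: sum.delta)
  finally show ?thesis by (simp add: L_def R_def)
qed

text \<open>Balance at the interior nodes of an edge joins the sinusoids on its pieces to a single one; testing with the
  indicator of a vertex gives the vertex condition.\<close>

lemma kernel_imp_eigenfunction:
  assumes k: "0 < k" "k < K" and ker: "\<And>d. pencil.form k c d = 0"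
  obtains \<alpha> \<beta> where "(\<lambda>e. sinusoid k (\<alpha> e) (\<beta> e)) \<in> laplacian_eigenspace G (k\<^sup>2)"
    "\<And>e j. e \<in> edges G \<Longrightarrow> j \<le> n \<Longrightarrow> c (node e j) = sinusoid k (\<alpha> e) (\<beta> e) (x e j)"
proof -
  have mesh_k: "k * width e j < pi" if "e \<in> edges G" "j < n" for e j
    using order.strict_trans1[OF mult_right_mono mesh[OF that], of k] x_less[OF that] k by auto
  have "\<exists>\<alpha> \<beta>. \<forall>j\<le>n. c (node e j) = sinusoid k \<alpha> \<beta> (x e j)" if e: "e \<in> edges G" for e
    using exists_sinusoid_through_nodes[OF k(1) n_pos x_zero[OF e] x_less[OF e] mesh_k[OF e]
        kernel_balance[OF k ker e]] by blast
  then obtain \<alpha> \<beta> where U: "\<And>e j. e \<in> edges G \<Longrightarrow> j \<le> n \<Longrightarrow> c (node e j) = sinusoid k (\<alpha> e) (\<beta> e) (x e j)"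
    by metis
  define v where "v e = sinusoid k (k * \<beta> e) (- (k * \<alpha> e))" for e
  have fin: "finite (edges G)" using graph by (simp add: compact_metric_graph_def)
  obtain m where m: "n = Suc m" using n_pos by (cases n) auto
  have "vertex_slope G v w = 0" for w
  proof -
    define d :: "('v, 'e) graph_point \<Rightarrow> real" where "d i = of_bool (i = Vertex w)" for i
    have "0 = (\<Sum>(e, j)\<in>pieces.
       out_slope k (width e j) (c (node e j)) (c (node e (Suc j))) * d (node e j) +
       out_slope k (width e j) (c (node e (Suc j))) (c (node e j)) * d (node e (Suc j)))"
      using form_eq_slopes[OF k, of c d] ker[of d] by simp
    also have "\<dots> = (\<Sum>(e, j)\<in>pieces. (if j = 0 then v e 0 * of_bool (init_vert G e = w) else 0)
        + (if j = m then - v e (len G e) * of_bool (term_vert G e = w) else 0))"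
    proof (rule sum.cong[OF refl])
      fix z assume "z \<in> pieces"
      then obtain e j where z: "z = (e, j)" and ej: "e \<in> edges G" "j \<in> {..<n}" by auto
      have 1: "out_slope k (width e j) (c (node e j)) (c (node e (Suc j))) = v e (x e j)"
        and 2: "out_slope k (width e j) (c (node e (Suc j))) (c (node e j)) = - v e (x e (Suc j))"
        using out_slope_sinusoid[of k "width e j" "\<alpha> e" "\<beta> e" "x e j"] k ej x_less mesh_k U
        by (auto simp: v_def)
      have "d (node e j) = of_bool (j = 0 \<and> init_vert G e = w)"
        "d (node e (Suc j)) = of_bool (j = m \<and> term_vert G e = w)"
        using ej by (auto simp: d_def node_eq m)
      then have "out_slope k (width e j) (c (node e j)) (c (node e (Suc j))) * d (node e j) +
          out_slope k (width e j) (c (node e (Suc j))) (c (node e j)) * d (node e (Suc j)) =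
          (if j = 0 then v e 0 * of_bool (init_vert G e = w) else 0)
          + (if j = m then - v e (len G e) * of_bool (term_vert G e = w) else 0)"
        unfolding 1 2 using x_zero[OF ej(1)] x_n[OF ej(1)] m by auto
      then show "(case z of (e, j) \<Rightarrow>
          out_slope k (width e j) (c (node e j)) (c (node e (Suc j))) * d (node e j) +
          out_slope k (width e j) (c (node e (Suc j))) (c (node e j)) * d (node e (Suc j))) =
        (case z of (e, j) \<Rightarrow> (if j = 0 then v e 0 * of_bool (init_vert G e = w) else 0)
          + (if j = m then - v e (len G e) * of_bool (term_vert G e = w) else 0))"
        by (simp add: z)
    qed
    also have "\<dots> = (\<Sum>e\<in>edges G. v e 0 * of_bool (init_vert G e = w)) + (\<Sum>e\<in>edges G. - v e (len G e) * of_bool (term_vert G e = w))"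
      unfolding sum.cartesian_product[symmetric] sum.distrib using n_pos m
      by (intro arg_cong2[where f="(+)"] sum.cong refl) (simp_all add: sum.delta del: sum.lessThan_Suc)
    also have "\<dots> = vertex_slope G v w"
      unfolding vertex_slope_def using fin
      by (simp add: sum.inter_filter of_bool_def if_distrib[of "\<lambda>t. _ * t"] cong: if_cong)
    finally show ?thesis by simp
  qed
  moreover have "sinusoid k (\<alpha> e) (\<beta> e) 0 = c (Vertex (init_vert G e))"
    "sinusoid k (\<alpha> e) (\<beta> e) (len G e) = c (Vertex (term_vert G e))" if "e \<in> edges G" for e
    using U[OF that, of 0] U[OF that, of n] x_zero[OF that] x_n[OF that] node_eq[OF that] n_pos by auto
  ultimately have "(\<lambda>e. sinusoid k (\<alpha> e) (\<beta> e)) \<in> laplacian_eigenspace G (k\<^sup>2)"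
    by (intro sinusoid_laplacian_eigenspace[OF graph, of _ _ _ "\<lambda>w. c (Vertex w)"]) (auto simp: v_def[abs_def])
  then show ?thesis using that U by blast
qed

text \<open>This replaces the min-max principle: \<open>c\<^sub>0\<close> and the constants are the test space, and the
  hypothesis says that its Rayleigh quotients lie below \<open>K\<^sup>2\<close>.\<close>

theorem second_eigenvalue_less:
  assumes test: "\<And>t. pencil.form K (\<lambda>i. c\<^sub>0 i + t) (\<lambda>i. c\<^sub>0 i + t) < 0"
  shows "laplacian_eigenvalue G 2 < K\<^sup>2"
proof -
  obtain k c where k: "0 < k" "k < K" and nz: "\<exists>i\<in>pencil.nodes. c i \<noteq> 0" and ker: "\<And>d. pencil.form k c d = 0"
    using pencil.exists_singular_parameter[OF test] by blast
  obtain \<alpha> \<beta> where u: "(\<lambda>e. sinusoid k (\<alpha> e) (\<beta> e)) \<in> laplacian_eigenspace G (k\<^sup>2)"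
    and U: "\<And>e j. e \<in> edges G \<Longrightarrow> j \<le> n \<Longrightarrow> c (node e j) = sinusoid k (\<alpha> e) (\<beta> e) (x e j)"
    using kernel_imp_eigenfunction[OF k ker] by blast
  have "\<not> (\<exists>t. \<forall>e\<in>edges G. \<forall>y\<in>{0..len G e}. sinusoid k (\<alpha> e) (\<beta> e) y = t)"
  proof
    assume "\<exists>t. \<forall>e\<in>edges G. \<forall>y\<in>{0..len G e}. sinusoid k (\<alpha> e) (\<beta> e) y = t"
    then obtain t where t: "\<And>e y. e \<in> edges G \<Longrightarrow> y \<in> {0..len G e} \<Longrightarrow> sinusoid k (\<alpha> e) (\<beta> e) y = t" by blast
    obtain e\<^sub>0 where e0: "e\<^sub>0 \<in> edges G" using edges_nonempty by auto
    then have "0 < len G e\<^sub>0" using graph by (simp add: compact_metric_graph_def)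
    from sinusoid_constant_imp_zero[OF k(1) this t[OF e0]] have "t = 0" .
    have range: "x e j \<in> {0..len G e}" if "e \<in> edges G" "j \<le> n" for e j
      using x_strict_mono[OF that(1), of 0 j] x_strict_mono[OF that(1), of j n] that x_zero x_n
      by (cases "j = 0"; cases "j = n") (auto intro: less_imp_le)
    have "c (node e j) = 0" if "e \<in> edges G" "j \<le> n" for e j
      using U[OF that] t[OF that(1) range[OF that]] \<open>t = 0\<close> by simp
    then have "\<forall>i\<in>pencil.nodes. c i = 0" by (auto simp: pencil.nodes_def)
    then show False using nz by blast
  qed
  from second_eigenvalue_le[OF graph _ u this] have "laplacian_eigenvalue G 2 \<le> k\<^sup>2" by simp
  also have "\<dots> < K\<^sup>2" using k by (intro power_strict_mono) auto
  finally show ?thesis .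
qed

end

section \<open>Cycles avoid bridges\<close>

text \<open>Sets of this shape describe all open sets that occur below: the vertices in \<open>A\<close> and, on each edge \<open>e\<close>, the part
  with coordinates in \<open>S e\<close>.\<close>

definition region :: "('v, 'e) metric_graph \<Rightarrow> 'v set \<Rightarrow> ('e \<Rightarrow> real set) \<Rightarrow> ('v, 'e) graph_point set" where
  "region G A S = Vertex ` A \<union> {Inner e z | e z. e \<in> edges G \<and> 0 < z \<and> z < len G e \<and> z \<in> S e}"

lemma Vertex_in_region [simp]: "Vertex w \<in> region G A S \<longleftrightarrow> w \<in> A"
  and Inner_in_region [simp]: "Inner e z \<in> region G A S \<longleftrightarrow> e \<in> edges G \<and> 0 < z \<and> z < len G e \<and> z \<in> S e"
  by (auto simp: region_def)

lemma openin_region: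
  assumes "A \<subseteq> verts G" and S: "\<And>e. e \<in> edges G \<Longrightarrow> open (S e)"
    and ends: "\<And>e. e \<in> edges G \<Longrightarrow> 0 \<in> S e \<longleftrightarrow> init_vert G e \<in> A"
      "\<And>e. e \<in> edges G \<Longrightarrow> len G e \<in> S e \<longleftrightarrow> term_vert G e \<in> A"
  shows "openin (graph_topology G) (region G A S)"
  unfolding openin_graph_topology
proof (intro conjI ballI)
  show "region G A S \<subseteq> graph_points G"
    using assms(1) by (auto simp: region_def graph_points_def)
  fix e assume e: "e \<in> edges G"
  have "{z \<in> {0..len G e}. edge_map G e z \<in> region G A S} = {0..len G e} \<inter> S e"
    (is "?P = ?Q")
  proof (rule set_eqI)
    fix z
    consider "z \<notin> {0..len G e}" | "z = 0" "z \<in> {0..len G e}" | "z = len G e" "0 < z" | "0 < z" "z < len G e" by force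
    then show "z \<in> ?P \<longleftrightarrow> z \<in> ?Q"
      using ends[OF e] e by cases (simp_all add: edge_map_def, auto)
  qed
  then show "openin (top_of_set {0..len G e}) {z \<in> {0..len G e}. edge_map G e z \<in> region G A S}"
    using S[OF e] by (simp add: openin_open_Int)
qed

lemma continuous_map_edge_map:
  assumes G: "compact_metric_graph G" and e: "e \<in> edges G"
  shows "continuous_map (top_of_set {0..len G e}) (graph_topology G) (edge_map G e)"
  unfolding continuous_map_def topspace_graph_topology[OF G]
proof (intro conjI allI impI)
  show "edge_map G e \<in> topspace (top_of_set {0..len G e}) \<rightarrow> graph_points G"
    using G e by (auto simp: compact_metric_graph_def edge_map_def graph_points_def)
qed (use e in \<open>auto simp: openin_graph_topology\<close>)

text \<open>Otherwise the edges with ends in \<open>A\<close> and those with ends outside \<open>A\<close> would separate the space.\<close>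

lemma vertex_set_connected:
  assumes G: "compact_metric_graph G" and conn: "connected_space (graph_topology G)"
    and A: "A \<subseteq> verts G" "A \<noteq> {}"
    and closed: "\<And>e. e \<in> edges G \<Longrightarrow> init_vert G e \<in> A \<longleftrightarrow> term_vert G e \<in> A"
  shows "A = verts G"
proof (rule ccontr)
  assume "A \<noteq> verts G"
  then obtain w where w: "w \<in> verts G - A" using A by blast
  define U where "U = region G A (\<lambda>e. if init_vert G e \<in> A then UNIV else {})"
  define W where "W = region G (verts G - A) (\<lambda>e. if init_vert G e \<in> A then {} else UNIV)"
  have V: "init_vert G e \<in> verts G" "term_vert G e \<in> verts G" if "e \<in> edges G" for e
    using G that by (auto simp: compact_metric_graph_def)
  have "openin (graph_topology G) U" "openin (graph_topology G) W"
    unfolding U_def W_def using A closed V by (auto intro!: openin_region split: if_splits)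
  moreover have "i \<notin> U \<inter> W" "i \<in> graph_points G \<longrightarrow> i \<in> U \<union> W" for i
    by (cases i; auto simp: U_def W_def graph_points_def)+
  then have "U \<inter> W = {}" "graph_points G \<subseteq> U \<union> W" by auto
  moreover have "U \<noteq> {}" "W \<noteq> {}" using A w by (auto simp: U_def W_def region_def)
  ultimately show False
    using conn unfolding connected_space_def topspace_graph_topology[OF G] by blast
qed

text \<open>The set \<open>A\<close> is the vertex set of a union of components of the graph without \<open>e\<close>, and \<open>e\<close> leads out of it.\<close>

definition bridge_cut :: "('v, 'e) metric_graph \<Rightarrow> 'e \<Rightarrow> 'v set \<Rightarrow> bool" where
  "bridge_cut G e A \<longleftrightarrow> A \<subseteq> verts G \<and> init_vert G e \<in> A \<and> term_vert G e \<notin> A \<and>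
     (\<forall>f\<in>edges G - {e}. init_vert G f \<in> A \<longleftrightarrow> term_vert G f \<in> A)"

lemma connectedin_one_side:
  assumes "connectedin X C" "openin X U" "openin X W" "U \<inter> W = {}" "C \<subseteq> U \<union> W" "a \<in> C" "b \<in> C" "a \<in> U"
  shows "b \<in> U"
  using connectedinD[OF assms(1,2,3,5)] assms by blast

text \<open>Removing an inner point of a bridge \<open>e\<close> splits the space into two open sides \<open>U\<close> and \<open>W\<close>. Near the time \<open>t\<close> at
  which the curve is at this point it moves inside \<open>e\<close>, and being continuous and injective it passes
  monotonically from one side to the other. But the rest of the closed curve is connected and misses the point, so it
  stays on one side.\<close>

lemma cycle_avoids_bridges:
  assumes G: "compact_metric_graph G"
    and \<gamma>: "continuous_map (top_of_set {0..1::real}) (graph_topology G) \<gamma>" "\<gamma> 0 = \<gamma> 1" "inj_on \<gamma> {0..<1}"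
    and t: "0 < t" "t < 1" "\<gamma> t = Inner e y"
  shows "\<not> bridge_cut G e A"
proof
  assume cut: "bridge_cut G e A"
  have pts: "\<gamma> s \<in> graph_points G" if "s \<in> {0..1}" for s
    using \<gamma>(1) that topspace_graph_topology[OF G] by (auto simp: continuous_map_def)
  have e: "e \<in> edges G" and y: "0 < y" "y < len G e"
  proof -
    have "t \<in> {0..1}" using t by auto
    from pts[OF this] have "Inner e y \<in> graph_points G" by (simp add: t)
    then show "e \<in> edges G" "0 < y" "y < len G e" by (auto simp: graph_points_def)
  qed
  define I where "I a b = region G {} (\<lambda>f. if f = e then {0<..<len G e} \<inter> {a<..<b} else {})" for a b
  have I: "openin (graph_topology G) (I a b)" for a b
    unfolding I_def by (rule openin_region) auto
  have preI: "openin (top_of_set {0..1}) {s\<in>{0..1}. \<gamma> s \<in> I a b}" for a b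
    using openin_continuous_map_preimage[OF \<gamma>(1) I] by simp
  have "t \<in> {s\<in>{0..1}. \<gamma> s \<in> I 0 (len G e)} \<inter> {0<..<1}"
    using t y e by (auto simp: I_def)
  moreover have "open ({s\<in>{0..1}. \<gamma> s \<in> I 0 (len G e)} \<inter> {0<..<1})"
  proof -
    obtain T where T: "open T" "{s\<in>{0..1}. \<gamma> s \<in> I 0 (len G e)} = {0..1} \<inter> T"
      using preI[of 0 "len G e"] by (auto simp: openin_open)
    have "{0..1} \<inter> T \<inter> {0<..<1} = T \<inter> {0<..<1}" by auto
    then show ?thesis unfolding T(2) using T(1) by (simp add: open_Int)
  qed
  ultimately obtain \<delta> where \<delta>: "0 < \<delta>" "cball t \<delta> \<subseteq> {s\<in>{0..1}. \<gamma> s \<in> I 0 (len G e)} \<inter> {0<..<1}"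
    by (meson open_contains_cball)
  define a b where "a = t - \<delta>" and "b = t + \<delta>"
  have ab: "a < t" "t < b" and sub: "{a..b} \<subseteq> {0<..<1}" "\<And>s. s \<in> {a..b} \<Longrightarrow> \<gamma> s \<in> I 0 (len G e)"
  proof -
    have "{a..b} = cball t \<delta>" by (simp add: a_def b_def cball_eq_atLeastAtMost)
    then show "{a..b} \<subseteq> {0<..<1}" "\<And>s. s \<in> {a..b} \<Longrightarrow> \<gamma> s \<in> I 0 (len G e)"
      using \<delta>(2) by blast+
  qed (use \<delta>(1) in \<open>simp_all add: a_def b_def\<close>)
  define g where "g s = (case \<gamma> s of Inner f z \<Rightarrow> z | _ \<Rightarrow> 0)" for s
  have \<gamma>g: "\<gamma> s = Inner e (g s)" "0 < g s" "g s < len G e" if "s \<in> {a..b}" for s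
    using sub(2)[OF that] by (auto simp: I_def region_def g_def split: if_splits)
  have "continuous_on {a..b} g"
    unfolding continuous_on_open_invariant
  proof (intro allI impI)
    fix B :: "real set" assume B: "open B"
    have "openin (graph_topology G) (region G {} (\<lambda>f. if f = e then {0<..<len G e} \<inter> B else {}))"
      using B by (intro openin_region) auto
    from openin_continuous_map_preimage[OF \<gamma>(1) this]
    obtain T where T: "open T" "{s\<in>{0..1}. \<gamma> s \<in> region G {} (\<lambda>f. if f = e then {0<..<len G e} \<inter> B else {})} = {0..1} \<inter> T"
      by (auto simp: openin_open)
    have "T \<inter> {a..b} = g -` B \<inter> {a..b}"
    proof (rule set_eqI)
      fix s
      show "s \<in> T \<inter> {a..b} \<longleftrightarrow> s \<in> g -` B \<inter> {a..b}"
      proof (cases "s \<in> {a..b}")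
        case True
        then have "s \<in> {0..1}" using sub(1) by force
        then have "s \<in> T \<longleftrightarrow> \<gamma> s \<in> region G {} (\<lambda>f. if f = e then {0<..<len G e} \<inter> B else {})"
          using T(2) by blast
        also have "\<dots> \<longleftrightarrow> g s \<in> B" using \<gamma>g[OF True] e by simp
        finally show ?thesis using True by simp
      qed auto
    qed
    then show "\<exists>T. open T \<and> T \<inter> {a..b} = g -` B \<inter> {a..b}" using T(1) by blast
  qed
  moreover have "inj_on g {a..b}"
  proof (rule inj_onI)
    fix r s assume "r \<in> {a..b}" "s \<in> {a..b}" "g r = g s"
    then have "\<gamma> r = \<gamma> s" using \<gamma>g by metis
    moreover have "r \<in> {0..<1}" "s \<in> {0..<1}" using sub(1) \<open>r \<in> {a..b}\<close> \<open>s \<in> {a..b}\<close> by force+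
    ultimately show "r = s" using \<gamma>(3) by (auto dest: inj_onD)
  qed
  moreover have gt: "g t = y" using \<gamma>g(1)[of t] ab t by simp
  ultimately have sides: "(g a < y \<and> y < g b) \<or> (g b < y \<and> y < g a)"
    using continuous_inj_imp_mono[of a t b g] ab by auto
  define U where "U = region G A (\<lambda>f. if f = e then {..<y} else if init_vert G f \<in> A then UNIV else {})"
  define W where "W = region G (verts G - A) (\<lambda>f. if f = e then {y<..} else if init_vert G f \<in> A then {} else UNIV)"
  have V: "init_vert G e \<in> verts G" "term_vert G e \<in> verts G" if "e \<in> edges G" for e
    using G that by (auto simp: compact_metric_graph_def)
  have U: "openin (graph_topology G) U"
    unfolding U_def using cut y by (intro openin_region) (auto simp: bridge_cut_def)
  have W: "openin (graph_topology G) W"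
    unfolding W_def using cut y V e by (intro openin_region) (auto simp: bridge_cut_def)
  have UW: "U \<inter> W = {}" by (auto simp: U_def W_def region_def split: if_splits)
  have cover: "i \<in> U \<union> W" if "i \<in> graph_points G" "i \<noteq> Inner e y" for i
    using that by (auto simp: U_def W_def graph_points_def split: if_splits)
  have avoid: "\<gamma> s \<in> U \<union> W" if "s \<in> {0..1}" "s \<noteq> t" for s
  proof (rule cover[OF pts[OF that(1)]])
    have "\<gamma> s = \<gamma> (if s = 1 then 0 else s)" using \<gamma>(2) by simp
    moreover have "\<gamma> (if s = 1 then 0 else s) \<noteq> \<gamma> t"
      using inj_onD[OF \<gamma>(3), of "if s = 1 then 0 else s" t] that t by auto
    ultimately show "\<gamma> s \<noteq> Inner e y" using t by simp
  qed
  have conn: "connectedin (graph_topology G) (\<gamma> ` {r..s})" if "0 \<le> r" "s \<le> 1" for r s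
    using that by (intro connectedin_continuous_map_image[OF \<gamma>(1)]) (auto simp: connectedin_subtopology)
  have a: "0 < a" "b < 1" using subsetD[OF sub(1), of a] subsetD[OF sub(1), of b] ab by auto
  have left: "\<gamma> ` {0..a} \<subseteq> U \<union> W" and right: "\<gamma> ` {b..1} \<subseteq> U \<union> W"
    using ab a t(1,2) by (intro image_subsetI avoid; simp)+
  have in_sides: "\<gamma> a \<in> U \<longleftrightarrow> g a < y" "\<gamma> b \<in> U \<longleftrightarrow> g b < y" "\<gamma> a \<in> W \<longleftrightarrow> y < g a" "\<gamma> b \<in> W \<longleftrightarrow> y < g b"
    using \<gamma>g[of a] \<gamma>g[of b] ab e by (auto simp: U_def W_def)
  have WU: "W \<inter> U = {}" "\<gamma> ` {0..a} \<subseteq> W \<union> U" "\<gamma> ` {b..1} \<subseteq> W \<union> U" using UW left right by auto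
  note cl = conn[of 0 a] and cr = conn[of b 1]
  have mem: "\<gamma> 0 \<in> \<gamma> ` {0..a}" "\<gamma> a \<in> \<gamma> ` {0..a}" "\<gamma> 1 \<in> \<gamma> ` {b..1}" "\<gamma> b \<in> \<gamma> ` {b..1}" using a ab by auto
  have "\<gamma> 0 \<in> U \<inter> W"
    using sides
  proof
    assume s: "g a < y \<and> y < g b"
    have "\<gamma> 0 \<in> U" using connectedin_one_side[OF cl U W UW left mem(2,1)] s in_sides a ab by auto
    moreover have "\<gamma> 1 \<in> W" using connectedin_one_side[OF cr W U WU(1,3) mem(4,3)] s in_sides a ab by auto
    ultimately show ?thesis using \<gamma>(2) by simp
  next
    assume s: "g b < y \<and> y < g a"
    have "\<gamma> 0 \<in> W" using connectedin_one_side[OF cl W U WU(1,2) mem(2,1)] s in_sides a ab by auto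
    moreover have "\<gamma> 1 \<in> U" using connectedin_one_side[OF cr U W UW right mem(4,3)] s in_sides a ab by auto
    ultimately show ?thesis using \<gamma>(2) by simp
  qed
  then show False using UW by auto
qed

text \<open>The image of the curve is infinite while there are only finitely many vertices, so the curve meets the interior
  of an edge.\<close>

lemma cycle_imp_non_bridge:
  assumes G: "compact_metric_graph G" and "cycles G \<noteq> {}"
  obtains e where "e \<in> edges G" "\<And>A. \<not> bridge_cut G e A"
proof -
  obtain \<gamma> where \<gamma>: "continuous_map (top_of_set {0..1::real}) (graph_topology G) \<gamma>" "\<gamma> 0 = \<gamma> 1" "inj_on \<gamma> {0..<1}"
    using assms(2) by (auto simp: cycles_def)
  have pts: "\<gamma> s \<in> graph_points G" if "s \<in> {0..1}" for s
    using \<gamma>(1) that topspace_graph_topology[OF G] by (auto simp: continuous_map_def)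
  have "infinite {0<..<1::real}" by simp
  moreover have "inj_on \<gamma> {0<..<1}" using \<gamma>(3) by (rule inj_on_subset) auto
  ultimately have "infinite (\<gamma> ` {0<..<1})" by (simp add: finite_image_iff)
  moreover have "finite (Vertex ` verts G)" using G by (simp add: compact_metric_graph_def)
  ultimately obtain t where t: "0 < t" "t < 1" "\<gamma> t \<notin> Vertex ` verts G"
    by (metis (no_types, lifting) finite_subset greaterThanLessThan_iff image_subsetI)
  then obtain e y where "e \<in> edges G" "\<gamma> t = Inner e y"
    using pts[of t] by (auto simp: graph_points_def)
  then show ?thesis using cycle_avoids_bridges[OF G \<gamma> t(1,2)] that by blast
qed

section \<open>Shortest walks and the cycles they close\<close>

definition joins :: "('v, 'e) metric_graph \<Rightarrow> 'e \<Rightarrow> 'v \<Rightarrow> 'v \<Rightarrow> bool" where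
  "joins G f a b \<longleftrightarrow> init_vert G f = a \<and> term_vert G f = b \<or> init_vert G f = b \<and> term_vert G f = a"

inductive walk :: "('v, 'e) metric_graph \<Rightarrow> 'e set \<Rightarrow> 'v \<Rightarrow> 'e list \<Rightarrow> 'v \<Rightarrow> bool" for G F where
  Nil: "walk G F a [] a"
| Cons: "f \<in> F \<Longrightarrow> joins G f a b \<Longrightarrow> walk G F b es c \<Longrightarrow> walk G F a (f # es) c"

lemma walk_snoc: "walk G F a es b \<Longrightarrow> f \<in> F \<Longrightarrow> joins G f b c \<Longrightarrow> walk G F a (es @ [f]) c"
  by (induction rule: walk.induct) (auto intro: walk.intros)

lemma walk_edges: "walk G F a es b \<Longrightarrow> set es \<subseteq> F"
  by (induction rule: walk.induct) auto

abbreviation walk_length :: "('v, 'e) metric_graph \<Rightarrow> 'e list \<Rightarrow> real" where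
  "walk_length G es \<equiv> sum_list (map (len G) es)"

text \<open>Edge lengths are bounded below, so only finitely many walks are not longer than the given one.\<close>

lemma exists_shortest_walk:
  assumes F: "finite F" "\<And>f. f \<in> F \<Longrightarrow> 0 < len G f" and "walk G F a es\<^sub>0 b"
  obtains es where "walk G F a es b" "\<And>es'. walk G F a es' b \<Longrightarrow> walk_length G es \<le> walk_length G es'"
proof (cases "F = {}")
  case True
  then have "es = []" if "walk G F a es b" for es using walk_edges[OF that] by auto
  then show ?thesis using that[OF assms(3)] assms(3) by auto
next
  case False
  define m where "m = Min (len G ` F)"
  have m: "0 < m" "\<And>f. f \<in> F \<Longrightarrow> m \<le> len G f" using F False by (auto simp: m_def)
  have long: "m * length es \<le> walk_length G es" if "set es \<subseteq> F" for es
    using that by (induction es) (auto simp: algebra_simps intro!: add_mono m)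
  define N where "N = nat \<lceil>walk_length G es\<^sub>0 / m\<rceil>"
  define X where "X = {es. walk G F a es b \<and> length es \<le> N}"
  have short: "length es \<le> N" if "walk G F a es b" "walk_length G es \<le> walk_length G es\<^sub>0" for es
  proof -
    have "real (length es) \<le> walk_length G es\<^sub>0 / m"
      using long[OF walk_edges[OF that(1)]] that(2) m(1) by (simp add: le_divide_eq mult.commute)
    then show ?thesis unfolding N_def by linarith
  qed
  have "finite X"
    by (rule finite_subset[OF _ finite_lists_length_le[OF F(1), of N]]) (auto simp: X_def dest: walk_edges)
  moreover have es0: "es\<^sub>0 \<in> X" using short[OF assms(3)] assms(3) by (simp add: X_def)
  ultimately obtain es where es: "es \<in> X" "\<And>es'. es' \<in> X \<Longrightarrow> walk_length G es \<le> walk_length G es'"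
    using ex_is_arg_min_if_finite[of X "walk_length G"] by (auto simp: is_arg_min_linorder)
  show ?thesis
  proof (rule that)
    show "walk G F a es b" using es by (simp add: X_def)
    fix es' assume w: "walk G F a es' b"
    show "walk_length G es \<le> walk_length G es'"
    proof (cases "walk_length G es' \<le> walk_length G es\<^sub>0")
      case True
      then show ?thesis using es(2)[of es'] short[OF w] w by (simp add: X_def)
    next
      case False
      then show ?thesis using es(2)[OF es0] by simp
    qed
  qed
qed

definition edge_lipschitz :: "('v, 'e) metric_graph \<Rightarrow> 'e set \<Rightarrow> ('v \<Rightarrow> real) \<Rightarrow> bool" where
  "edge_lipschitz G F d \<longleftrightarrow> (\<forall>f\<in>F. \<bar>d (init_vert G f) - d (term_vert G f)\<bar> \<le> len G f)"

lemma edge_lipschitz_joins: "edge_lipschitz G F d \<Longrightarrow> f \<in> F \<Longrightarrow> joins G f a b \<Longrightarrow> d b \<le> d a + len G f"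
  by (force simp: edge_lipschitz_def joins_def)

lemma edge_lipschitz_walk:
  assumes d: "edge_lipschitz G F d" and "walk G F a es b"
  shows "d b \<le> d a + walk_length G es"
  using assms(2)
proof induction
  case (Cons f a b es c)
  then show ?case using edge_lipschitz_joins[OF d, of f a b] by simp
qed simp

text \<open>Take for \<open>d\<close> the distance from the initial vertex of \<open>e\<close> in the graph without \<open>e\<close>. It is finite everywhere: the set of
  reachable vertices contains both ends of \<open>e\<close> since \<open>e\<close> is not a bridge, so it is closed under all edges of
  the connected graph.\<close>

lemma exists_distance_function:
  assumes G: "compact_metric_graph G" and conn: "connected_space (graph_topology G)"
    and e: "e \<in> edges G" and no_bridge: "\<And>A. \<not> bridge_cut G e A"
  obtains d es where "edge_lipschitz G (edges G - {e}) d" "d (init_vert G e) = 0"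
    "walk G (edges G - {e}) (init_vert G e) es (term_vert G e)" "d (term_vert G e) = walk_length G es"
proof -
  define F where "F = edges G - {e}"
  define a where "a = init_vert G e"
  have F: "finite F" "\<And>f. f \<in> F \<Longrightarrow> 0 < len G f" using G by (auto simp: F_def compact_metric_graph_def)
  have V: "init_vert G f \<in> verts G" "term_vert G f \<in> verts G" if "f \<in> edges G" for f
    using G that by (auto simp: compact_metric_graph_def)
  define A where "A = {w\<in>verts G. \<exists>es. walk G F a es w}"
  have closed: "init_vert G f \<in> A \<longleftrightarrow> term_vert G f \<in> A" if "f \<in> F" for f
    using walk_snoc[of G F a _ _ f] that V[of f] unfolding A_def joins_def F_def by blast
  have a: "a \<in> A" using V e by (auto simp: A_def a_def intro: walk.Nil)
  have b: "term_vert G e \<in> A"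
    using no_bridge[of A] closed a V e unfolding bridge_cut_def F_def a_def by (auto simp: A_def)
  have "A = verts G"
  proof (rule vertex_set_connected[OF G conn])
    fix f assume f: "f \<in> edges G"
    show "init_vert G f \<in> A \<longleftrightarrow> term_vert G f \<in> A"
      using a b closed[of f] f by (cases "f = e") (auto simp: F_def a_def)
  qed (use a in \<open>auto simp: A_def\<close>)
  then have "\<exists>es. walk G F a es w \<and> (\<forall>es'. walk G F a es' w \<longrightarrow> walk_length G es \<le> walk_length G es')" if "w \<in> verts G" for w
    using exists_shortest_walk[OF F] that unfolding A_def by blast
  then obtain p where p: "\<And>w. w \<in> verts G \<Longrightarrow> walk G F a (p w) w"
    "\<And>w es'. w \<in> verts G \<Longrightarrow> walk G F a es' w \<Longrightarrow> walk_length G (p w) \<le> walk_length G es'"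
    by metis
  define d where "d w = walk_length G (p w)" for w
  have step: "d w \<le> d u + len G f" if "f \<in> F" "joins G f u w" "u \<in> verts G" "w \<in> verts G" for f u w
    using p(2)[OF that(4) walk_snoc[OF p(1)[OF that(3)] that(1,2)]] by (simp add: d_def)
  have "edge_lipschitz G F d"
    unfolding edge_lipschitz_def
  proof
    fix f assume f: "f \<in> F"
    then have "f \<in> edges G" by (simp add: F_def)
    from V[OF this] show "\<bar>d (init_vert G f) - d (term_vert G f)\<bar> \<le> len G f"
      using step[OF f, of "init_vert G f" "term_vert G f"] step[OF f, of "term_vert G f" "init_vert G f"]
      by (auto simp: joins_def abs_le_iff)
  qed
  moreover have "d a = 0"
  proof -
    have av: "a \<in> verts G" using a by (simp add: A_def)
    have "d a \<le> 0" using p(2)[OF av walk.Nil] by (simp add: d_def)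
    moreover have "0 \<le> d a"
      unfolding d_def using walk_edges[OF p(1)[OF av]] F(2) by (intro sum_list_nonneg) (auto intro: less_imp_le)
    ultimately show ?thesis by simp
  qed
  ultimately show ?thesis
    using that[of d "p (term_vert G e)"] p(1)[OF V(2)[OF e]] by (simp add: F_def a_def d_def)
qed

text \<open>Along a walk the function \<open>d\<close> can rise by at most the length of the walk. If the rise is that large, the walk is
  called tight here; then it is tight edge by edge.\<close>

lemma tight_walk_Cons:
  assumes d: "edge_lipschitz G F d" and f: "f \<in> F" "joins G f a b" and w: "walk G F b es c"
    and tight: "d c = d a + walk_length G (f # es)"
  shows "d b = d a + len G f" "d c = d b + walk_length G es"
  using edge_lipschitz_joins[OF d f] edge_lipschitz_walk[OF d w] tight by auto

lemma tight_walk_above: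
  assumes d: "edge_lipschitz G F d" and F: "\<And>f. f \<in> F \<Longrightarrow> 0 < len G f" and "walk G F a es b"
    and "d b = d a + walk_length G es"
  shows "\<forall>f\<in>set es. d a \<le> d (init_vert G f) \<and> d a \<le> d (term_vert G f)"
  using assms(3,4)
proof induction
  case (Cons f a b es c)
  note t = tight_walk_Cons[OF d Cons.hyps Cons.prems]
  have "d a < d b" using t F[OF \<open>f \<in> F\<close>] by simp
  then show ?case using Cons.IH[OF t(2)] \<open>joins G f a b\<close> by (force simp: joins_def)
qed simp

text \<open>The later edges lie above the level of the end of \<open>f\<close>, whereas \<open>f\<close> starts strictly below this level.\<close>

lemma tight_walk_first_edge_notin:
  assumes d: "edge_lipschitz G F d" and F: "\<And>f. f \<in> F \<Longrightarrow> 0 < len G f"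
    and f: "f \<in> F" "joins G f a b" and w: "walk G F b es c" and tight: "d c = d a + walk_length G (f # es)"
  shows "f \<notin> set es"
proof
  note t = tight_walk_Cons[OF d f w tight]
  assume "f \<in> set es"
  then have "d b \<le> d a" using tight_walk_above[OF d F w t(2)] f(2) by (auto simp: joins_def)
  then show False using t(1) F[OF f(1)] by simp
qed

lemma tight_walk_distinct:
  assumes d: "edge_lipschitz G F d" and F: "\<And>f. f \<in> F \<Longrightarrow> 0 < len G f" and "walk G F a es b"
    and "d b = d a + walk_length G es"
  shows "distinct es"
  using assms(3,4)
proof induction
  case (Cons f a b es c)
  then show ?case
    using tight_walk_first_edge_notin[OF d F Cons.hyps Cons.prems] tight_walk_Cons(2)[OF d Cons.hyps Cons.prems]
    by simp
qed simp

lemma continuous_map_join: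
  assumes \<gamma>: "continuous_map (top_of_set {0..1::real}) X \<gamma>" and \<delta>: "continuous_map (top_of_set {0..1::real}) X \<delta>"
    and "\<gamma> 1 = \<delta> 0"
  shows "continuous_map (top_of_set {0..1}) X (\<lambda>t. if t \<le> 1/2 then \<gamma> (2 * t) else \<delta> (2 * t - 1))"
proof (rule pasting_lemma_closed[where I = UNIV and T = "\<lambda>b. if b then {0..1/2} else {1/2..1}"
      and f = "\<lambda>b t. if b then \<gamma> (2 * t) else \<delta> (2 * t - 1)"])
  fix i :: bool
  show "closedin (top_of_set {0..1}) (if i then {0..1/2} else {1/2..1::real})"
    by (auto intro!: closed_subset)
  have 1: "continuous_map (top_of_set {0..1/2}) (top_of_set {0..1}) (\<lambda>t::real. 2 * t)"
    by (auto intro!: continuous_intros)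
  have 2: "continuous_map (top_of_set {1/2..1}) (top_of_set {0..1}) (\<lambda>t::real. 2 * t - 1)"
    by (auto intro!: continuous_intros)
  show "continuous_map (subtopology (top_of_set {0..1}) (if i then {0..1/2} else {1/2..1})) X
      (\<lambda>t. if i then \<gamma> (2 * t) else \<delta> (2 * t - 1))"
    using continuous_map_compose[OF 1 \<gamma>] continuous_map_compose[OF 2 \<delta>]
    by (cases i) (simp_all add: subtopology_subtopology o_def Int_absorb1)
next
  fix i j :: bool and t :: real
  assume "t \<in> topspace (top_of_set {0..1}) \<inter> (if i then {0..1/2} else {1/2..1}) \<inter> (if j then {0..1/2} else {1/2..1})"
  then have "i = j \<or> 2 * t = 1" by (auto split: if_splits)
  then show "(if i then \<gamma> (2 * t) else \<delta> (2 * t - 1)) = (if j then \<gamma> (2 * t) else \<delta> (2 * t - 1))"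
    using assms(3) by (metis diff_self)
next
  fix t :: real
  assume "t \<in> topspace (top_of_set {0..1})"
  then show "\<exists>j. j \<in> UNIV \<and> t \<in> (if j then {0..1/2} else {1/2..1}) \<and>
      (if t \<le> 1/2 then \<gamma> (2 * t) else \<delta> (2 * t - 1)) = (if j then \<gamma> (2 * t) else \<delta> (2 * t - 1))"
    by (intro exI[of _ "t \<le> 1/2"]) auto
qed simp

lemma inj_on_join:
  assumes "inj_on \<gamma> {0..1::real}" and \<delta>: "inj_on \<delta> T" and T: "T = {0..1} \<or> T = {0..<1::real}"
    and disj: "\<And>s t. s \<in> {0..1} \<Longrightarrow> t \<in> T \<Longrightarrow> 0 < t \<Longrightarrow> \<gamma> s \<noteq> \<delta> t"
  shows "inj_on (\<lambda>t. if t \<le> 1/2 then \<gamma> (2 * t) else \<delta> (2 * t - 1)) T"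
proof (rule inj_onI)
  fix s t assume s: "s \<in> T" and t: "t \<in> T"
    and eq: "(if s \<le> 1/2 then \<gamma> (2 * s) else \<delta> (2 * s - 1)) = (if t \<le> 1/2 then \<gamma> (2 * t) else \<delta> (2 * t - 1))"
  have lo: "2 * r \<in> {0..1}" if "r \<in> T" "r \<le> 1/2" for r using T that by auto
  have hi: "2 * r - 1 \<in> T" "0 < 2 * r - 1" if "r \<in> T" "\<not> r \<le> 1/2" for r using T that by auto
  show "s = t"
    using eq lo[OF s] lo[OF t] hi[OF s] hi[OF t] disj[of "2 * s" "2 * t - 1"] disj[of "2 * t" "2 * s - 1"]
      inj_onD[OF assms(1), of "2 * s" "2 * t"] inj_onD[OF \<delta>, of "2 * s - 1" "2 * t - 1"]
    by (cases "s \<le> 1/2"; cases "t \<le> 1/2") auto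
qed

lemma edge_arc:
  assumes G: "compact_metric_graph G" and f: "f \<in> edges G" and "joins G f a b"
  obtains \<gamma> where "continuous_map (top_of_set {0..1::real}) (graph_topology G) \<gamma>" "\<gamma> 0 = Vertex a" "\<gamma> 1 = Vertex b"
    "inj_on \<gamma> {0<..<1}" "\<And>t. t \<in> {0<..<1} \<Longrightarrow> \<exists>z. \<gamma> t = Inner f z"
proof -
  have l: "0 < len G f" using G f by (simp add: compact_metric_graph_def)
  have "\<exists>h :: real \<Rightarrow> real. continuous_on {0..1} h \<and> h ` {0..1} \<subseteq> {0..len G f} \<and> (\<forall>t\<in>{0<..<1}. 0 < h t \<and> h t < len G f) \<and> inj_on h {0<..<1}
      \<and> edge_map G f (h 0) = Vertex a \<and> edge_map G f (h 1) = Vertex b"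
    using assms(3) unfolding joins_def
  proof
    assume "init_vert G f = a \<and> term_vert G f = b"
    then show ?thesis using l
      by (intro exI[of _ "\<lambda>t. t * len G f"]) (auto simp: edge_map_def inj_on_def intro!: continuous_intros)
  next
    assume "init_vert G f = b \<and> term_vert G f = a"
    then show ?thesis using l
      by (intro exI[of _ "\<lambda>t. (1 - t) * len G f"])
         (auto simp: edge_map_def inj_on_def mult_le_cancel_right2 mult_less_cancel_right2 intro!: continuous_intros)
  qed
  then obtain h :: "real \<Rightarrow> real" where h: "continuous_on {0..1} h" "h ` {0..1} \<subseteq> {0..len G f}" "\<forall>t\<in>{0<..<1}. 0 < h t \<and> h t < len G f"
    "inj_on h {0<..<1}" "edge_map G f (h 0) = Vertex a" "edge_map G f (h 1) = Vertex b" by blast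
  have in_eq: "edge_map G f (h t) = Inner f (h t)" if "t \<in> {0<..<1}" for t
    using bspec[OF h(3) that] by (simp add: edge_map_def)
  show ?thesis
  proof (rule that[of "edge_map G f \<circ> h"])
    show "continuous_map (top_of_set {0..1}) (graph_topology G) (edge_map G f \<circ> h)"
      by (rule continuous_map_compose[OF _ continuous_map_edge_map[OF G f]]) (use h in auto)
    show "inj_on (edge_map G f \<circ> h) {0<..<1}"
      using h(4) in_eq by (auto simp: inj_on_def)
    show "\<exists>z. (edge_map G f \<circ> h) t = Inner f z" if "t \<in> {0<..<1}" for t
      using in_eq[OF that] by simp
  qed (use h in auto)
qed

lemma unit_interval_cases:
  assumes "t \<in> {0..1::real}"
  obtains "t = 0" | "t = 1" | "t \<in> {0<..<1}"
  using assms by force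

lemma inj_on_closed_unit_interval:
  assumes "inj_on \<gamma> {0<..<1::real}" "\<gamma> 0 \<noteq> \<gamma> 1" "\<And>t. t \<in> {0<..<1} \<Longrightarrow> \<gamma> t \<noteq> \<gamma> 0 \<and> \<gamma> t \<noteq> \<gamma> 1"
  shows "inj_on \<gamma> {0..1}"
proof -
  have "{0..1} = insert 0 (insert 1 {0<..<1::real})" by force
  moreover have "\<gamma> 0 \<notin> \<gamma> ` (insert 1 {0<..<1})" "\<gamma> 1 \<notin> \<gamma> ` {0<..<1}" using assms by force+
  ultimately show ?thesis using assms(1) by (metis Diff_insert_absorb Diff_subset image_mono inj_on_insert subsetD)
qed

text \<open>The arcs of the single edges are joined from the end backwards. The level function \<open>d\<close> keeps them apart: the first
  edge starts strictly below all vertices of the rest of the walk, and does not occur in it.\<close>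

lemma tight_walk_arc:
  assumes G: "compact_metric_graph G" and d: "edge_lipschitz G F d" and F: "F \<subseteq> edges G"
    and "walk G F a es b" and "es \<noteq> []" and "d b = d a + walk_length G es"
  shows "\<exists>\<gamma>. continuous_map (top_of_set {0..1::real}) (graph_topology G) \<gamma> \<and> inj_on \<gamma> {0..1} \<and>
    \<gamma> 0 = Vertex a \<and> \<gamma> 1 = Vertex b \<and>
    \<gamma> ` {0..1} \<subseteq> Vertex ` {w. d a \<le> d w} \<union> {Inner f z | f z. f \<in> set es}"
  using assms(4,5,6)
proof induction
  case (Cons f a b es c)
  have F_pos: "\<And>f. f \<in> F \<Longrightarrow> 0 < len G f" using F G by (auto simp: compact_metric_graph_def)
  note t = tight_walk_Cons[OF d Cons.hyps Cons.prems(2)]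
  have less: "d a < d b" using t F_pos[OF \<open>f \<in> F\<close>] by simp
  have "f \<in> edges G" using F Cons.hyps by auto
  then obtain \<gamma> where \<gamma>: "continuous_map (top_of_set {0..1::real}) (graph_topology G) \<gamma>" "\<gamma> 0 = Vertex a" "\<gamma> 1 = Vertex b"
    "inj_on \<gamma> {0<..<1}" and inner: "\<And>t. t \<in> {0<..<1} \<Longrightarrow> \<exists>z. \<gamma> t = Inner f z"
    using edge_arc[OF G _ Cons.hyps(2)] by metis
  have \<gamma>_inj: "inj_on \<gamma> {0..1}"
  proof (rule inj_on_closed_unit_interval[OF \<gamma>(4)])
    show "\<gamma> 0 \<noteq> \<gamma> 1" using less \<gamma> by auto
    fix t :: real assume "t \<in> {0<..<1}"
    then show "\<gamma> t \<noteq> \<gamma> 0 \<and> \<gamma> t \<noteq> \<gamma> 1" using inner[of t] \<gamma>(2,3) by auto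
  qed
  have \<gamma>_image: "\<gamma> s \<in> {Vertex a, Vertex b} \<union> {Inner f z | z. True}" if "s \<in> {0..1}" for s
    using that inner \<gamma>(2,3) by (elim unit_interval_cases) auto
  show ?case
  proof (cases "es = []")
    case True
    then have "c = b" using \<open>walk G F b es c\<close> by (auto elim: walk.cases)
    have "\<gamma> ` {0..1} \<subseteq> Vertex ` {w. d a \<le> d w} \<union> {Inner g z | g z. g \<in> set (f # es)}"
      using \<gamma>_image less by fastforce
    then show ?thesis using \<gamma> \<gamma>_inj \<open>c = b\<close> by blast
  next
    case False
    from Cons.IH[OF this t(2)] obtain \<delta> where \<delta>: "continuous_map (top_of_set {0..1::real}) (graph_topology G) \<delta>"
      "inj_on \<delta> {0..1}" "\<delta> 0 = Vertex b" "\<delta> 1 = Vertex c"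
      "\<delta> ` {0..1} \<subseteq> Vertex ` {w. d b \<le> d w} \<union> {Inner f z | f z. f \<in> set es}" by blast
    have f: "f \<notin> set es" by (rule tight_walk_first_edge_notin[OF d F_pos Cons.hyps Cons.prems(2)])
    have disj: "\<gamma> s \<noteq> \<delta> r" if "s \<in> {0..1}" "r \<in> {0..1}" "0 < r" for s r
    proof
      assume eq: "\<gamma> s = \<delta> r"
      have "\<delta> r \<in> Vertex ` {w. d b \<le> d w} \<union> {Inner f z | f z. f \<in> set es}" using \<delta>(5) that by blast
      then have "\<delta> r = Vertex b" using \<gamma>_image[OF that(1)] eq less f by auto
      then have "r = 0" using inj_onD[OF \<delta>(2), of r 0] \<delta>(3) that by simp
      then show False using that by simp
    qed
    define \<eta> where "\<eta> t = (if t \<le> 1/2 then \<gamma> (2 * t) else \<delta> (2 * t - 1))" for t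
    have "continuous_map (top_of_set {0..1}) (graph_topology G) \<eta>"
      unfolding \<eta>_def[abs_def] by (rule continuous_map_join[OF \<gamma>(1) \<delta>(1)]) (simp add: \<gamma> \<delta>)
    moreover have "inj_on \<eta> {0..1}"
      unfolding \<eta>_def[abs_def] by (rule inj_on_join[OF \<gamma>_inj \<delta>(2)]) (use disj in auto)
    moreover have "\<eta> t \<in> Vertex ` {w. d a \<le> d w} \<union> {Inner g z | g z. g \<in> set (f # es)}" if "t \<in> {0..1}" for t
    proof (cases "t \<le> 1/2")
      case True
      then have "\<eta> t \<in> {Vertex a, Vertex b} \<union> {Inner f z | z. True}"
        using \<gamma>_image[of "2 * t"] that by (simp add: \<eta>_def)
      then show ?thesis using less by auto
    next
      case False
      then have "2 * t - 1 \<in> {0..1}" using that by auto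
      then have "\<delta> (2 * t - 1) \<in> Vertex ` {w. d b \<le> d w} \<union> {Inner f z | f z. f \<in> set es}"
        using \<delta>(5) by blast
      then show ?thesis using less False by (auto simp: \<eta>_def)
    qed
    moreover have "\<eta> 0 = Vertex a" "\<eta> 1 = Vertex c" by (simp_all add: \<eta>_def \<gamma> \<delta>)
    ultimately show ?thesis by (intro exI[of _ \<eta>]) blast
  qed
qed simp

text \<open>The sets whose measure is taken may fail to be measurable, but then their measure is 0 and the bound holds as well.\<close>

lemma subset_length_le:
  assumes G: "compact_metric_graph G" and F: "F \<subseteq> edges G" and C: "C \<subseteq> range Vertex \<union> {Inner f z | f z. f \<in> F}"
  shows "subset_length G C \<le> (\<Sum>f\<in>F. len G f)"
proof -
  have le: "measure lborel {x. 0 < x \<and> x < len G f \<and> Inner f x \<in> C} \<le> (if f \<in> F then len G f else 0)" if "f \<in> edges G" for f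
  proof (cases "f \<in> F")
    case True
    have "0 \<le> len G f" using G that by (auto simp: compact_metric_graph_def)
    have "measure lborel {x. 0 < x \<and> x < len G f \<and> Inner f x \<in> C} \<le> measure lborel {0<..<len G f}"
    proof (cases "{x. 0 < x \<and> x < len G f \<and> Inner f x \<in> C} \<in> sets lborel")
      case True
      then show ?thesis
        using emeasure_lborel_Ioo[OF \<open>0 \<le> len G f\<close>]
        by (intro measure_mono_fmeasurable) (auto simp: fmeasurable_def)
    qed (simp add: measure_notin_sets)
    then show ?thesis using True \<open>0 \<le> len G f\<close> by simp
  next
    case False
    then have empty: "{x. 0 < x \<and> x < len G f \<and> Inner f x \<in> C} = {}" using C by auto
    show ?thesis unfolding empty using False by simp
  qed
  have "subset_length G C \<le> (\<Sum>f\<in>edges G. if f \<in> F then len G f else 0)"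
    unfolding subset_length_def by (rule sum_mono[OF le])
  also have "\<dots> = (\<Sum>f\<in>F. len G f)"
    using G F by (simp add: sum.If_cases compact_metric_graph_def Int_absorb1)
  finally show ?thesis .
qed

lemma girth_le:
  assumes "C \<in> cycles G"
  shows "girth G \<le> subset_length G C"
proof -
  have "Inf (subset_length G ` cycles G) \<le> subset_length G C"
    using assms by (intro cInf_lower bdd_belowI[of _ 0]) (auto simp: subset_length_def sum_nonneg)
  then show ?thesis using assms by (auto simp: girth_def)
qed

text \<open>The arc of the walk followed by the edge \<open>e\<close>, traversed backwards, is a closed injective curve. If \<open>e\<close> is a loop, the
  walk is empty and \<open>e\<close> alone is such a curve.\<close>

lemma girth_le_tight_cycle:
  assumes G: "compact_metric_graph G" and e: "e \<in> edges G" and d: "edge_lipschitz G (edges G - {e}) d"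
    and w: "walk G (edges G - {e}) (init_vert G e) es (term_vert G e)"
    and tight: "d (term_vert G e) = d (init_vert G e) + walk_length G es"
  shows "girth G \<le> len G e + walk_length G es"
proof -
  define F where "F = edges G - {e}"
  have F_pos: "\<And>f. f \<in> F \<Longrightarrow> 0 < len G f" using G by (auto simp: compact_metric_graph_def F_def)
  have es: "distinct es" "set es \<subseteq> edges G" "e \<notin> set es"
    using tight_walk_distinct[OF d _ w tight] walk_edges[OF w] F_pos by (auto simp: F_def)
  have "joins G e (term_vert G e) (init_vert G e)" by (simp add: joins_def)
  then obtain \<delta> where \<delta>: "continuous_map (top_of_set {0..1::real}) (graph_topology G) \<delta>"
    "\<delta> 0 = Vertex (term_vert G e)" "\<delta> 1 = Vertex (init_vert G e)" "inj_on \<delta> {0<..<1}"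
    and inner: "\<And>t. t \<in> {0<..<1} \<Longrightarrow> \<exists>z. \<delta> t = Inner e z"
    using edge_arc[OF G e] by metis
  have \<delta>_inj: "inj_on \<delta> {0..<1}"
  proof (rule inj_onI)
    fix s r assume sr: "s \<in> {0..<1::real}" "r \<in> {0..<1::real}" "\<delta> s = \<delta> r"
    consider "s = 0" "r = 0" | "s = 0" "r \<in> {0<..<1}" | "r = 0" "s \<in> {0<..<1}" | "r \<in> {0<..<1}" "s \<in> {0<..<1}"
      using sr by force
    then show "s = r"
      using sr(3) inner[of r] inner[of s] \<delta>(2) inj_onD[OF \<delta>(4), of s r] by cases auto
  qed
  have \<delta>_image: "\<delta> s \<in> range Vertex \<union> {Inner f z | f z. f \<in> insert e (set es)}" if "s \<in> {0..1}" for s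
    using that inner \<delta>(2,3) by (elim unit_interval_cases) auto
  have "\<exists>\<eta>. continuous_map (top_of_set {0..1::real}) (graph_topology G) \<eta> \<and> \<eta> 0 = \<eta> 1 \<and> inj_on \<eta> {0..<1} \<and>
      \<eta> ` {0..1} \<subseteq> range Vertex \<union> {Inner f z | f z. f \<in> insert e (set es)}"
  proof (cases "es = []")
    case True
    then have "init_vert G e = term_vert G e" using w by (auto elim: walk.cases)
    then show ?thesis using \<delta>(1-3) \<delta>_inj \<delta>_image
      by (intro exI[of _ \<delta>] conjI image_subsetI) simp_all
  next
    case False
    from tight_walk_arc[OF G d _ w this tight] obtain \<gamma> where
      \<gamma>: "continuous_map (top_of_set {0..1::real}) (graph_topology G) \<gamma>" "inj_on \<gamma> {0..1}"
      "\<gamma> 0 = Vertex (init_vert G e)" "\<gamma> 1 = Vertex (term_vert G e)"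
      and im: "\<gamma> ` {0..1} \<subseteq> Vertex ` {w. d (init_vert G e) \<le> d w} \<union> {Inner f z | f z. f \<in> set es}"
      by auto
    have \<gamma>_image: "\<gamma> s \<in> range Vertex \<union> {Inner f z | f z. f \<in> set es}" if "s \<in> {0..1}" for s
      using subsetD[OF im imageI[OF that]] by auto
    define \<eta> where "\<eta> t = (if t \<le> 1/2 then \<gamma> (2 * t) else \<delta> (2 * t - 1))" for t
    have "continuous_map (top_of_set {0..1}) (graph_topology G) \<eta>"
      unfolding \<eta>_def[abs_def] by (rule continuous_map_join[OF \<gamma>(1) \<delta>(1)]) (simp add: \<gamma> \<delta>)
    moreover have "inj_on \<eta> {0..<1}"
      unfolding \<eta>_def[abs_def]
    proof (rule inj_on_join[OF \<gamma>(2) \<delta>_inj])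
      fix s t :: real assume "s \<in> {0..1}" "t \<in> {0..<1}" "0 < t"
      then show "\<gamma> s \<noteq> \<delta> t" using \<gamma>_image[of s] inner[of t] es(3) by auto
    qed simp
    moreover have "\<eta> t \<in> range Vertex \<union> {Inner f z | f z. f \<in> insert e (set es)}" if "t \<in> {0..1}" for t
    proof (cases "t \<le> 1/2")
      case True
      then have "\<gamma> (2 * t) \<in> range Vertex \<union> {Inner f z | f z. f \<in> set es}"
        using that by (intro \<gamma>_image) auto
      then show ?thesis using True by (auto simp: \<eta>_def)
    next
      case False
      then have "\<delta> (2 * t - 1) \<in> range Vertex \<union> {Inner f z | f z. f \<in> insert e (set es)}"
        using that by (intro \<delta>_image) auto
      then show ?thesis using False by (simp add: \<eta>_def)
    qed
    moreover have "\<eta> 0 = \<eta> 1" by (simp add: \<eta>_def \<gamma> \<delta>)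
    ultimately show ?thesis by (intro exI[of _ \<eta>]) blast
  qed
  then obtain \<eta> where \<eta>: "continuous_map (top_of_set {0..1::real}) (graph_topology G) \<eta>" "\<eta> 0 = \<eta> 1" "inj_on \<eta> {0..<1}"
    "\<eta> ` {0..1} \<subseteq> range Vertex \<union> {Inner f z | f z. f \<in> insert e (set es)}" by (elim exE conjE)
  have "\<eta> ` {0..1} \<in> cycles G" unfolding cycles_def using \<eta>(1-3) by (intro CollectI exI[of _ \<eta>] conjI refl)
  note \<eta> = this \<eta>(4)
  then have "girth G \<le> (\<Sum>f\<in>insert e (set es). len G f)"
    using girth_le[OF \<eta>(1)] subset_length_le[OF G _ \<eta>(2)] e es(2) by simp
  also have "\<dots> = len G e + walk_length G es"
    using es by (simp add: sum_list_distinct_conv_sum_set)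
  finally show ?thesis .
qed

section \<open>The tent function of a cycle\<close>

text \<open>Both \<open>{0..m}\<close> and \<open>{m..l}\<close> are cut into \<open>N\<close> equal pieces. This makes \<open>m\<close> a node, so that a function with a
  kink at \<open>m\<close> is linear on every piece.\<close>

definition kinked_grid :: "real \<Rightarrow> real \<Rightarrow> nat \<Rightarrow> nat \<Rightarrow> real" where
  "kinked_grid m l N j = (if j \<le> N then m * (real j / real N) else m + (l - m) * ((real j - real N) / real N))"

lemma kinked_grid:
  assumes "0 < m" "m < l" "0 < N"
  shows kinked_grid_0: "kinked_grid m l N 0 = 0"
    and kinked_grid_end: "kinked_grid m l N (2 * N) = l"
    and kinked_grid_less: "kinked_grid m l N j < kinked_grid m l N (Suc j)"
    and kinked_grid_mesh: "kinked_grid m l N (Suc j) - kinked_grid m l N j \<le> l / N"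
    and kinked_grid_before: "j < N \<Longrightarrow> kinked_grid m l N (Suc j) \<le> m"
    and kinked_grid_after: "N \<le> j \<Longrightarrow> m \<le> kinked_grid m l N j"
proof -
  have diff: "kinked_grid m l N (Suc j) - kinked_grid m l N j = (if j < N then m else l - m) / N"
  proof (cases "j = N")
    case True
    then show ?thesis using assms by (simp add: kinked_grid_def field_simps)
  next
    case False
    then show ?thesis using assms by (auto simp: kinked_grid_def field_simps)
  qed
  show "kinked_grid m l N 0 = 0" "kinked_grid m l N (2 * N) = l"
    using assms by (auto simp: kinked_grid_def)
  have "0 < (if j < N then m else l - m) / N" "(if j < N then m else l - m) / N \<le> l / N"
    using assms by (auto simp: divide_right_mono)
  then show "kinked_grid m l N j < kinked_grid m l N (Suc j)"
    "kinked_grid m l N (Suc j) - kinked_grid m l N j \<le> l / N"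
    using diff by linarith+
  show "kinked_grid m l N (Suc j) \<le> m" if "j < N"
  proof -
    have "m * (real (Suc j) / real N) \<le> m * 1" using that assms by (intro mult_left_mono) auto
    then show ?thesis using that by (simp add: kinked_grid_def)
  qed
  show "m \<le> kinked_grid m l N j" if "N \<le> j"
    using that assms by (cases "j = N") (auto simp: kinked_grid_def)
qed

text \<open>The antiderivative of \<open>(r + \<epsilon> * \<bar>w\<bar>)\<^sup>2\<close> that vanishes at 0, for \<open>\<epsilon>\<^sup>2 = 1\<close>.\<close>

definition tent_primitive :: "real \<Rightarrow> real \<Rightarrow> real \<Rightarrow> real" where
  "tent_primitive \<epsilon> r w = r\<^sup>2 * w + \<epsilon> * r * w * \<bar>w\<bar> + w ^ 3 / 3"

lemma tent_primitive_minus: "tent_primitive \<epsilon> r (- w) = - tent_primitive \<epsilon> r w"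
  by (simp add: tent_primitive_def)

lemma tent_primitive_diff:
  assumes "\<epsilon>\<^sup>2 = 1" and "w' \<le> 0 \<and> w \<le> 0 \<or> 0 \<le> w \<and> 0 \<le> w'"
  shows "(w' - w) / 3 * ((r + \<epsilon> * \<bar>w\<bar>)\<^sup>2 + (r + \<epsilon> * \<bar>w\<bar>) * (r + \<epsilon> * \<bar>w'\<bar>) + (r + \<epsilon> * \<bar>w'\<bar>)\<^sup>2)
    = tent_primitive \<epsilon> r w' - tent_primitive \<epsilon> r w"
proof -
  have gen: "(w' - w) / 3 * ((r + \<delta> * w)\<^sup>2 + (r + \<delta> * w) * (r + \<delta> * w') + (r + \<delta> * w')\<^sup>2)
    = (r\<^sup>2 * w' + \<delta> * r * w' * w' + w' ^ 3 / 3) - (r\<^sup>2 * w + \<delta> * r * w * w + w ^ 3 / 3)" if "\<delta>\<^sup>2 = 1" for \<delta>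
  proof -
    have "(w' - w) / 3 * ((r + \<delta> * w)\<^sup>2 + (r + \<delta> * w) * (r + \<delta> * w') + (r + \<delta> * w')\<^sup>2)
      = (r\<^sup>2 * w' + \<delta> * r * w' * w' + \<delta>\<^sup>2 * (w' ^ 3 / 3)) - (r\<^sup>2 * w + \<delta> * r * w * w + \<delta>\<^sup>2 * (w ^ 3 / 3))"
      by (simp add: field_simps power2_eq_square power3_eq_cube)
    then show ?thesis using that by simp
  qed
  from assms(2) show ?thesis
  proof
    assume "w' \<le> 0 \<and> w \<le> 0"
    then show ?thesis using gen[of "- \<epsilon>"] assms(1) by (simp add: tent_primitive_def)
  next
    assume "0 \<le> w \<and> 0 \<le> w'"
    then show ?thesis using gen[of \<epsilon>] assms(1) by (simp add: tent_primitive_def)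
  qed
qed

text \<open>The integral of the square of the piecewise linear function with the values \<open>a j\<close> at \<open>x j\<close>.\<close>

definition piecewise_sq :: "(nat \<Rightarrow> real) \<Rightarrow> nat \<Rightarrow> (nat \<Rightarrow> real) \<Rightarrow> real" where
  "piecewise_sq x n a = (\<Sum>j<n. (x (Suc j) - x j) / 3 * ((a j)\<^sup>2 + a j * a (Suc j) + (a (Suc j))\<^sup>2))"

lemma piecewise_sq_nonneg:
  assumes "\<And>j. j < n \<Longrightarrow> x j \<le> x (Suc j)"
  shows "0 \<le> piecewise_sq x n a"
  unfolding piecewise_sq_def
proof (rule sum_nonneg)
  fix j assume "j \<in> {..<n}"
  have "(a j)\<^sup>2 + a j * a (Suc j) + (a (Suc j))\<^sup>2 = (a j + a (Suc j) / 2)\<^sup>2 + 3 / 4 * (a (Suc j))\<^sup>2"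
    by (simp add: power2_eq_square field_simps)
  then have "0 \<le> (a j)\<^sup>2 + a j * a (Suc j) + (a (Suc j))\<^sup>2" by simp
  then show "0 \<le> (x (Suc j) - x j) / 3 * ((a j)\<^sup>2 + a j * a (Suc j) + (a (Suc j))\<^sup>2)"
    using assms[of j] \<open>j \<in> {..<n}\<close> by (intro mult_nonneg_nonneg) auto
qed

lemma piecewise_sq_tent:
  assumes \<epsilon>: "\<epsilon>\<^sup>2 = 1" and step: "\<And>j. j < n \<Longrightarrow> w (Suc j) - w j = x (Suc j) - x j"
    and side: "\<And>j. j < n \<Longrightarrow> w (Suc j) \<le> 0 \<and> w j \<le> 0 \<or> 0 \<le> w j \<and> 0 \<le> w (Suc j)"
    and a: "\<And>j. j \<le> n \<Longrightarrow> a j = r + \<epsilon> * \<bar>w j\<bar>"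
  shows "piecewise_sq x n a = tent_primitive \<epsilon> r (w n) - tent_primitive \<epsilon> r (w 0)"
proof -
  have "piecewise_sq x n a = (\<Sum>j<n. tent_primitive \<epsilon> r (w (Suc j)) - tent_primitive \<epsilon> r (w j))"
    unfolding piecewise_sq_def
  proof (rule sum.cong[OF refl])
    fix j assume "j \<in> {..<n}"
    then have j: "j < n" "j \<le> n" "Suc j \<le> n" by auto
    show "(x (Suc j) - x j) / 3 * ((a j)\<^sup>2 + a j * a (Suc j) + (a (Suc j))\<^sup>2)
        = tent_primitive \<epsilon> r (w (Suc j)) - tent_primitive \<epsilon> r (w j)"
      unfolding step[OF j(1), symmetric] a[OF j(2)] a[OF j(3)] by (rule tent_primitive_diff[OF \<epsilon> side[OF j(1)]])
  qed
  also have "\<dots> = tent_primitive \<epsilon> r (w n) - tent_primitive \<epsilon> r (w 0)"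
    by (rule sum_lessThan_telescope)
  finally show ?thesis .
qed

text \<open>The left side is the integral of \<open>(f + t)\<^sup>2\<close> over the cycle, the tent \<open>f\<close> having height \<open>\<bar>w\<bar>\<close> on \<open>e\<close> and
  \<open>(l + D) / 2 - \<bar>w\<bar>\<close> on the walk. The right side completes the square in \<open>t\<close>: the mean of the tent
  is \<open>(l + D) / 4\<close>.\<close>

lemma cycle_tent_sq:
  "(tent_primitive 1 t (l / 2) - tent_primitive 1 t (- (l / 2))) +
    (tent_primitive (- 1) ((l + D) / 2 + t) (D / 2) - tent_primitive (- 1) ((l + D) / 2 + t) (- (D / 2)))
   = (l + D) * (t + (l + D) / 4)\<^sup>2 + (l + D) ^ 3 / 48" if "0 \<le> l" "0 \<le> D"
  using that by (simp add: tent_primitive_def abs_of_nonneg power2_eq_square power3_eq_cube field_simps)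

text \<open>The contributions of the edges telescope, since consecutive edges of the walk share a vertex.\<close>

lemma tight_walk_sum:
  assumes d: "edge_lipschitz G F d" and "walk G F a es b" and "d b = d a + walk_length G es"
    and S: "\<And>f u v. f \<in> F \<Longrightarrow> joins G f u v \<Longrightarrow> d v = d u + len G f \<Longrightarrow> S f = \<Phi> (d v) - (\<Phi> (d u) :: real)"
  shows "sum_list (map S es) = \<Phi> (d b) - \<Phi> (d a)"
  using assms(2,3)
proof induction
  case (Cons f a b es c)
  note t = tight_walk_Cons[OF d Cons.hyps Cons.prems]
  show ?case using Cons.IH[OF t(2)] S[OF Cons.hyps(1,2) t(1)] by simp
qed simp

context subdivided_graph
begin

text \<open>Replacing sinusoids by linear functions increases the form, strictly on a piece with different end values.
  The linear functions have slopes at most 1, so their energy is at most the total length.\<close>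

lemma form_less_length:
  assumes lip: "\<And>e j. e \<in> edges G \<Longrightarrow> j < n \<Longrightarrow> \<bar>c (node e j) - c (node e (Suc j))\<bar> \<le> width e j"
    and nonconst: "e\<^sub>0 \<in> edges G" "j\<^sub>0 < n" "c (node e\<^sub>0 j\<^sub>0) \<noteq> c (node e\<^sub>0 (Suc j\<^sub>0))"
  shows "pencil.form K c c < total_length G - K\<^sup>2 * (\<Sum>e\<in>edges G. piecewise_sq (x e) n (\<lambda>j. c (node e j)))"
proof -
  define lhs where "lhs = (\<lambda>(e, j). stiffness (width e j) K * ((c (node e j) - c (node e (Suc j))) * (c (node e j) - c (node e (Suc j))))
      - K\<^sup>2 * (lump (width e j) K * ((c (node e j) + c (node e (Suc j))) * (c (node e j) + c (node e (Suc j))))))"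
  define rhs where "rhs = (\<lambda>(e, j). width e j - K\<^sup>2 * (width e j / 3 *
      ((c (node e j))\<^sup>2 + c (node e j) * c (node e (Suc j)) + (c (node e (Suc j)))\<^sup>2)))"
  have fin: "finite (edges G)" using graph by (simp add: compact_metric_graph_def)
  have slope: "(c (node e j) - c (node e (Suc j)))\<^sup>2 / width e j \<le> width e j" if "e \<in> edges G" "j < n" for e j
  proof -
    have "(c (node e j) - c (node e (Suc j)))\<^sup>2 \<le> (width e j)\<^sup>2"
      using power_mono[OF lip[OF that], of 2] by simp
    then show ?thesis using x_less[OF that] by (simp add: divide_le_eq power2_eq_square)
  qed
  have "(\<Sum>z\<in>pieces. lhs z) < (\<Sum>z\<in>pieces. rhs z)"
  proof (rule sum_strict_mono_ex1)
    show "finite pieces" using fin by simp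
    show "\<forall>z\<in>pieces. lhs z \<le> rhs z"
    proof
      fix z assume "z \<in> pieces"
      then obtain e j where "z = (e, j)" "e \<in> edges G" "j < n" by auto
      then show "lhs z \<le> rhs z"
        using interval_form_le_linear(1)[of "width e j" K "c (node e j)" "c (node e (Suc j))"]
          slope[of e j] x_less[of e j] mesh[of e j] K_pos by (simp add: lhs_def rhs_def)
    qed
    have "lhs (e\<^sub>0, j\<^sub>0) < rhs (e\<^sub>0, j\<^sub>0)"
      using interval_form_le_linear(2)[of "width e\<^sub>0 j\<^sub>0" K "c (node e\<^sub>0 j\<^sub>0)" "c (node e\<^sub>0 (Suc j\<^sub>0))"] nonconst
          slope[of e\<^sub>0 j\<^sub>0] x_less[of e\<^sub>0 j\<^sub>0] mesh[of e\<^sub>0 j\<^sub>0] K_pos by (simp add: lhs_def rhs_def)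
    then show "\<exists>z\<in>pieces. lhs z < rhs z" using nonconst by blast
  qed
  moreover have "pencil.form K c c = (\<Sum>z\<in>pieces. lhs z)"
    unfolding pencil.form_def by (rule sum.cong) (auto simp: lhs_def)
  moreover have "(\<Sum>z\<in>pieces. rhs z) = (\<Sum>e\<in>edges G. (\<Sum>j<n. width e j) - K\<^sup>2 * piecewise_sq (x e) n (\<lambda>j. c (node e j)))"
    unfolding rhs_def sum.cartesian_product[symmetric] piecewise_sq_def sum_subtractf sum_distrib_left ..
  moreover have "\<dots> = (\<Sum>e\<in>edges G. len G e - K\<^sup>2 * piecewise_sq (x e) n (\<lambda>j. c (node e j)))"
  proof (rule sum.cong[OF refl])
    fix e assume e: "e \<in> edges G"
    have "(\<Sum>j<n. width e j) = x e n - x e 0" by (rule sum_lessThan_telescope)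
    then show "(\<Sum>j<n. width e j) - K\<^sup>2 * piecewise_sq (x e) n (\<lambda>j. c (node e j)) =
        len G e - K\<^sup>2 * piecewise_sq (x e) n (\<lambda>j. c (node e j))"
      by (simp only: x_zero[OF e] x_n[OF e] diff_zero)
  qed
  moreover have "\<dots> = total_length G - K\<^sup>2 * (\<Sum>e\<in>edges G. piecewise_sq (x e) n (\<lambda>j. c (node e j)))"
    by (simp only: sum_subtractf sum_distrib_left total_length_def)
  ultimately show ?thesis by simp
qed

end

text \<open>A cycle formed by the edge \<open>e\<close> and a walk \<open>es\<close> of length \<open>D\<close> that is tight for \<open>d\<close>.\<close>

locale tight_cycle =
  fixes G :: "('v, 'e) metric_graph" and e :: 'e and d :: "'v \<Rightarrow> real" and es :: "'e list"
  assumes graph: "compact_metric_graph G" and connected: "connected_space (graph_topology G)"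
    and e: "e \<in> edges G" and lipschitz: "edge_lipschitz G (edges G - {e}) d"
    and d_init: "d (init_vert G e) = 0"
    and walk: "walk G (edges G - {e}) (init_vert G e) es (term_vert G e)"
    and d_term: "d (term_vert G e) = walk_length G es"
begin

abbreviation l :: real where "l \<equiv> len G e"
abbreviation D :: real where "D \<equiv> walk_length G es"

text \<open>The linear extension of \<open>d\<close> to the edge \<open>f\<close>.\<close>

definition height :: "'e \<Rightarrow> real \<Rightarrow> real" where
  "height f y = d (init_vert G f) + (d (term_vert G f) - d (init_vert G f)) * (y / len G f)"

text \<open>For \<open>z = d\<close> on the walk this is the distance to the midpoint of \<open>e\<close> along the cycle: it is \<open>l / 2\<close> at both ends of
  the walk and \<open>(l + D) / 2\<close> half way.\<close>

definition tent :: "real \<Rightarrow> real" where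
  "tent z = (l + D) / 2 - \<bar>z - D / 2\<bar>"

definition profile :: "'e \<Rightarrow> real \<Rightarrow> real" where
  "profile f y = (if f = e then \<bar>y - l / 2\<bar> else tent (height f y))"

definition test :: "('v, 'e) graph_point \<Rightarrow> real" where
  "test i = (case i of Vertex w \<Rightarrow> tent (d w) | Inner f y \<Rightarrow> profile f y)"

text \<open>The point of \<open>f\<close> at which the linear extension of \<open>d\<close> takes the value \<open>D / 2\<close>, where the tent has its
  peak. If there is no such inner point (in particular if \<open>d\<close> takes equal values at both ends and the quotient has its
  default value 0), and also for \<open>f = e\<close>, the midpoint is used; on \<open>e\<close> the tent has its minimum there.\<close>

definition kink :: "'e \<Rightarrow> real" where
  "kink f = (let m = (D / 2 - d (init_vert G f)) / (d (term_vert G f) - d (init_vert G f)) * len G f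
     in if f \<noteq> e \<and> 0 < m \<and> m < len G f then m else len G f / 2)"

lemma len_pos: "f \<in> edges G \<Longrightarrow> 0 < len G f"
  using graph by (simp add: compact_metric_graph_def)

lemma D_nonneg: "0 \<le> D"
  using walk_edges[OF walk] by (intro sum_list_nonneg) (auto intro: less_imp_le len_pos)

lemma kink_bounds: "f \<in> edges G \<Longrightarrow> 0 < kink f \<and> kink f < len G f"
  using len_pos[of f] by (simp add: kink_def Let_def)

lemma profile_lipschitz:
  assumes "f \<in> edges G"
  shows "\<bar>profile f y - profile f y'\<bar> \<le> \<bar>y - y'\<bar>"
proof (cases "f = e")
  case True
  then show ?thesis by (simp add: profile_def) 
next
  case False
  have "height f y - height f y' = (d (term_vert G f) - d (init_vert G f)) / len G f * (y - y')"
    by (simp add: height_def right_diff_distrib)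
  moreover have "\<bar>(d (term_vert G f) - d (init_vert G f)) / len G f\<bar> \<le> 1"
    using lipschitz assms False len_pos[OF assms]
    by (auto simp: edge_lipschitz_def abs_divide abs_minus_commute)
  ultimately have "\<bar>height f y - height f y'\<bar> \<le> \<bar>y - y'\<bar>"
    by (simp only: abs_mult mult_left_le_one_le abs_ge_zero)
  moreover have "\<bar>tent z - tent z'\<bar> \<le> \<bar>z - z'\<bar>" for z z'
    unfolding tent_def by linarith
  ultimately show ?thesis using False by (simp add: profile_def) (meson order_trans)
qed

lemma profile_ends:
  assumes "f \<in> edges G"
  shows "profile f 0 = tent (d (init_vert G f))" "profile f (len G f) = tent (d (term_vert G f))"
  using len_pos[OF assms] len_pos[OF e] D_nonneg d_init d_term
  by (auto simp: profile_def height_def tent_def add_divide_distrib)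

text \<open>The tent function and the constants serve as test space for \<open>second_eigenvalue_less\<close> with \<open>K\<^sup>2 = 48 L / s\<^sup>3\<close>:
  the energy is at most \<open>L\<close>, and the square integral over the cycle alone is at least \<open>s\<^sup>3 / 48\<close>.\<close>

theorem second_eigenvalue_less_of_cycle:
  assumes s: "0 < s" "s \<le> l + D"
  shows "laplacian_eigenvalue G 2 < 48 * total_length G / s ^ 3"
proof -
  have fin: "finite (edges G)" using graph by (simp add: compact_metric_graph_def)
  have len_le: "len G f \<le> total_length G" if "f \<in> edges G" for f
    unfolding total_length_def using that fin len_pos by (intro member_le_sum) (auto intro: less_imp_le)
  have L: "0 < total_length G" using len_le[OF e] len_pos[OF e] by simp
  define K where "K = sqrt (48 * total_length G / s ^ 3)"
  have K: "0 < K" "K\<^sup>2 = 48 * total_length G / s ^ 3" using L s by (auto simp: K_def)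
  define N where "N = Suc (nat \<lceil>K * total_length G / pi\<rceil>)"
  have N: "0 < N" "K * total_length G / N < pi"
  proof -
    have "K * total_length G / pi < N" unfolding N_def by linarith
    then have "K * total_length G < N * pi" by (simp add: pos_divide_less_eq)
    then show "K * total_length G / N < pi" by (simp add: N_def pos_divide_less_eq mult.commute)
  qed (simp add: N_def)
  define x where "x f = kinked_grid (kink f) (len G f) N" for f
  note grid = kinked_grid[OF kink_bounds[THEN conjunct1] kink_bounds[THEN conjunct2] N(1), folded x_def]
  interpret S: subdivided_graph G x "2 * N" K
  proof
    show "K * (x f (Suc j) - x f j) < pi" if "f \<in> edges G" for f j
    proof -
      have "K * (x f (Suc j) - x f j) \<le> K * (total_length G / N)"
        using order_trans[OF grid(4)[OF that that, of j] divide_right_mono[OF len_le[OF that], of "real N"]] K(1)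
        by (intro mult_left_mono) auto
      then show ?thesis using N(2) by simp
    qed
    show "A = verts G" if "A \<subseteq> verts G" "A \<noteq> {}"
      "\<forall>e\<in>edges G. (init_vert G e \<in> A) = (term_vert G e \<in> A)" for A
      using vertex_set_connected[OF graph connected that(1,2)] that(3) by blast
  qed (use graph e K(1) N(1) grid in auto)
  have test_node: "test (S.node f j) = profile f (x f j)" if "f \<in> edges G" "j \<le> 2 * N" for f j
    using S.node_eq[OF that] profile_ends[OF that(1)] grid(1,2)[OF that(1) that(1)]
    by (auto simp: test_def)
  have "S.pencil.form K (\<lambda>i. test i + t) (\<lambda>i. test i + t) < 0" for t
  proof -
    define sq where "sq f = piecewise_sq (x f) (2 * N) (\<lambda>j. test (S.node f j) + t)" for f
    have "S.pencil.form K (\<lambda>i. test i + t) (\<lambda>i. test i + t) < total_length G - K\<^sup>2 * (\<Sum>f\<in>edges G. sq f)"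
      unfolding sq_def
    proof (rule S.form_less_length[OF _ e])
      fix f j assume f: "f \<in> edges G" and j: "j < 2 * N"
      then show "\<bar>test (S.node f j) + t - (test (S.node f (Suc j)) + t)\<bar> \<le> S.width f j"
        using profile_lipschitz[OF f, of "x f j" "x f (Suc j)"] S.x_less[OF f j] by (simp add: test_node)
    next
      show "0 < 2 * N" using N by simp
      have "0 < x e 1" "x e 1 \<le> l / 2"
        using grid(1)[OF e e] grid(3)[OF e e, of 0] grid(5)[OF e e, of 0] N(1) by (auto simp: kink_def)
      then show "test (S.node e 0) + t \<noteq> test (S.node e (Suc 0)) + t"
        using N(1) grid(1)[OF e e] by (simp add: test_node[OF e] profile_def)
    qed
    moreover have "s ^ 3 / 48 \<le> (\<Sum>f\<in>edges G. sq f)"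
    proof -
      have sq_e: "sq e = tent_primitive 1 t (l / 2) - tent_primitive 1 t (- (l / 2))"
      proof -
        have "sq e = tent_primitive 1 t (x e (2 * N) - l / 2) - tent_primitive 1 t (x e 0 - l / 2)"
          unfolding sq_def
        proof (rule piecewise_sq_tent)
          fix j assume "j < 2 * N"
          show "x e (Suc j) - l / 2 \<le> 0 \<and> x e j - l / 2 \<le> 0 \<or> 0 \<le> x e j - l / 2 \<and> 0 \<le> x e (Suc j) - l / 2"
            using grid(3)[OF e e, of j] grid(5)[OF e e, of j] grid(6)[OF e e, of j]
            by (cases "j < N") (auto simp: kink_def)
        qed (simp_all add: test_node[OF e] profile_def)
        then show ?thesis by (simp add: grid(1,2)[OF e e])
      qed
      define \<Phi> where "\<Phi> z = tent_primitive (- 1) ((l + D) / 2 + t) (z - D / 2)" for z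
      have sq_tight: "sq f = \<Phi> (d v) - \<Phi> (d u)"
        if f: "f \<in> edges G - {e}" and uv: "joins G f u v" and tight: "d v = d u + len G f" for f u v
      proof -
        have f': "f \<in> edges G" "f \<noteq> e" using f by auto
        \<comment> \<open>The walk may traverse \<open>f\<close> against its orientation; the sign \<open>\<sigma>\<close> makes \<open>w\<close> increase with the
            edge coordinate in both cases, and \<open>tent_primitive\<close> is odd.\<close>
        define \<sigma> :: real where "\<sigma> = (if init_vert G f = u then 1 else - 1)"
        define w where "w j = \<sigma> * (height f (x f j) - D / 2)" for j
        have dir: "d (term_vert G f) - d (init_vert G f) = \<sigma> * len G f"
          using uv tight len_pos[OF f'(1)] by (auto simp: joins_def \<sigma>_def)
        have height: "height f y = d (init_vert G f) + \<sigma> * y" for y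
          unfolding height_def dir using len_pos[OF f'(1)] by simp
        have \<sigma>: "\<sigma> * \<sigma> = 1" "\<bar>\<sigma>\<bar> = 1" by (auto simp: \<sigma>_def)
        have w: "w j = \<sigma> * (d (init_vert G f) - D / 2) + x f j" for j
          unfolding w_def height using \<sigma> by (simp add: algebra_simps)
        define m where "m = - \<sigma> * (d (init_vert G f) - D / 2)"
        have wm: "w j = x f j - m" for j by (simp add: w m_def)
        have m: "kink f = (if 0 < m \<and> m < len G f then m else len G f / 2)"
          using len_pos[OF f'(1)] f'(2) \<sigma> unfolding kink_def dir Let_def m_def
          by (auto simp: \<sigma>_def)
        have range: "0 \<le> x f j" "x f j \<le> len G f" if "j \<le> 2 * N" for j
          using S.x_strict_mono[OF f'(1), of 0 j] S.x_strict_mono[OF f'(1), of j "2 * N"] that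
            grid(1,2)[OF f'(1) f'(1)] by (cases "j = 0"; cases "j = 2 * N"; auto)+
        have "sq f = tent_primitive (- 1) ((l + D) / 2 + t) (w (2 * N)) - tent_primitive (- 1) ((l + D) / 2 + t) (w 0)"
          unfolding sq_def
        proof (rule piecewise_sq_tent)
          fix j assume j: "j < 2 * N"
          show "w (Suc j) \<le> 0 \<and> w j \<le> 0 \<or> 0 \<le> w j \<and> 0 \<le> w (Suc j)"
            using grid(3)[OF f'(1) f'(1), of j] grid(5)[OF f'(1) f'(1), of j] grid(6)[OF f'(1) f'(1), of j]
              range[of j] range[of "Suc j"] j m unfolding wm
            by (cases "j < N") (auto split: if_splits)
        next
          fix j assume "j \<le> 2 * N"
          then show "test (S.node f j) + t = (l + D) / 2 + t + - 1 * \<bar>w j\<bar>"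
            using \<sigma>(2) f'(2) by (simp add: test_node[OF f'(1)] profile_def tent_def w_def abs_mult)
        qed (simp_all add: wm)
        also have "w 0 = \<sigma> * (d (init_vert G f) - D / 2)"
          unfolding w using grid(1)[OF f'(1) f'(1)] by simp
        also have "w (2 * N) = \<sigma> * (d (term_vert G f) - D / 2)"
          unfolding w using grid(2)[OF f'(1) f'(1)] dir \<sigma> by (simp add: algebra_simps)
        finally show ?thesis
          using uv tight len_pos[OF f'(1)] tent_primitive_minus[of "- 1" "(l + D) / 2 + t" "d u - D / 2"]
            tent_primitive_minus[of "- 1" "(l + D) / 2 + t" "d v - D / 2"]
          by (auto simp: \<sigma>_def joins_def \<Phi>_def split: if_splits)
      qed
      have tight: "d (term_vert G e) = d (init_vert G e) + walk_length G es" by (simp add: d_init d_term)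
      have es: "distinct es" "set es \<subseteq> edges G" "e \<notin> set es"
        using tight_walk_distinct[OF lipschitz _ walk tight] walk_edges[OF walk] len_pos by auto
      have "sum_list (map sq es) = \<Phi> (d (term_vert G e)) - \<Phi> (d (init_vert G e))"
        by (rule tight_walk_sum[OF lipschitz walk tight]) (rule sq_tight)
      then have "(\<Sum>f\<in>set es. sq f) = \<Phi> D - \<Phi> 0"
        unfolding d_init d_term sum_list_distinct_conv_sum_set[OF es(1), of sq] .
      then have "sq e + (\<Sum>f\<in>set es. sq f) = (l + D) * (t + (l + D) / 4)\<^sup>2 + (l + D) ^ 3 / 48"
        unfolding sq_e using cycle_tent_sq[of l D t] len_pos[OF e] D_nonneg by (simp add: \<Phi>_def)
      moreover have "sq e + (\<Sum>f\<in>set es. sq f) = (\<Sum>f\<in>insert e (set es). sq f)" using es by simp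
      moreover have "(\<Sum>f\<in>insert e (set es). sq f) \<le> (\<Sum>f\<in>edges G. sq f)"
        using es e fin S.x_less unfolding sq_def
        by (intro sum_mono2 piecewise_sq_nonneg) (auto intro: less_imp_le)
      moreover have "0 \<le> (l + D) * (t + (l + D) / 4)\<^sup>2" using s by simp
      moreover have "s ^ 3 \<le> (l + D) ^ 3" using s by (intro power_mono) auto
      ultimately show ?thesis by simp
    qed
    then have "K\<^sup>2 * (s ^ 3 / 48) \<le> K\<^sup>2 * (\<Sum>f\<in>edges G. sq f)" by (rule mult_left_mono) simp
    moreover have "K\<^sup>2 * (s ^ 3 / 48) = total_length G" using s by (simp add: K(2))
    ultimately show ?thesis by linarith
  qed
  from S.second_eigenvalue_less[OF this] show ?thesis by (simp add: K(2))
qed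

end

lemma girth_nonneg: "0 \<le> girth G"
proof (cases "cycles G = {}")
  case False
  have "0 \<le> subset_length G C" for C by (simp add: subset_length_def sum_nonneg)
  then have "0 \<le> Inf (subset_length G ` cycles G)" using False by (intro cInf_greatest) auto
  then show ?thesis by (simp add: girth_def)
qed (simp add: girth_def)

theorem proposition1p8:
  fixes G :: "('v, 'e) metric_graph"
  assumes "compact_metric_graph G"
    and "connected_space (graph_topology G)"
  shows "ereal (laplacian_eigenvalue G 2) <
    (if girth G = 0 then \<infinity> else ereal (48 * total_length G / girth G ^ 3))"
proof (cases "girth G = 0")
  case False
  then have "cycles G \<noteq> {}" by (auto simp: girth_def)
  from cycle_imp_non_bridge[OF assms(1) this] obtain e where
    e: "e \<in> edges G" "\<And>A. \<not> bridge_cut G e A" by blast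
  from exists_distance_function[OF assms e] obtain d es where
    d: "edge_lipschitz G (edges G - {e}) d" "d (init_vert G e) = 0"
      "walk G (edges G - {e}) (init_vert G e) es (term_vert G e)" "d (term_vert G e) = walk_length G es"
    by blast
  interpret tight_cycle G e d es
    using assms e(1) d by unfold_locales
  have "girth G \<le> l + D"
    using girth_le_tight_cycle[OF assms(1) e(1) d(1,3)] d by simp
  then have "laplacian_eigenvalue G 2 < 48 * total_length G / girth G ^ 3"
    using False girth_nonneg[of G] by (intro second_eigenvalue_less_of_cycle) auto
  then show ?thesis using False by simp
qed simp

end
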